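(* Let $X\subseteq\mathbb{N}\setminus\{0\}$ be a $\Pi_2$ set, where each $k\in X$ is identified with the finite order-type $\mathbf{k}$. Let $C\subseteq\mathbb{N}$ be a co-c.e. cohesive set. Then there is a computable linear order $\mathcal{M}$ of order-type $\omega$ such that the cohesive power $\Pi_C\mathcal{M}$ has order-type $\omega+\boldsymbol{\sigma}(X\cup\{\alpha\})$, where $\alpha=\omega+\zeta\eta+\omega^*$.
   Context: A set $C\subseteq\mathbb{N}$ is cohesive if it is infinite and for every c.e. set $W$, either $C\setminus W$ or $C\cap W$ is finite; co-c.e. means $\mathbb{N}\setminus C$ is c.e. Write $X\subseteq^* Y$ if $X\setminus Y$ is finite. For a computable linear order $\mathcal{L}=(L,\prec_{\mathcal{L}})$, the cohesive power $\Pi_C\mathcal{L}$ has as elements the classes $[\varphi]$ of partial computable $\varphi\colon\mathbb{N}\to L$ with $C\subseteq^*\mathrm{dom}(\varphi)$ under $\varphi=_C\psi$ iff $C\subseteq^*\{x:\varphi(x)\downarrow=\psi(x)\downarrow\}$, ordered by $[\varphi]\prec[\psi]$ iff $C\subseteq^*\{x:\varphi(x)\downarrow,\psi(x)\downarrow,\varphi(x)\prec_{\mathcal{L}}\psi(x)\}$. $\mathbf{k}$ is the order-type of a $k$-element linear order; $\omega,\zeta,\eta$ are the order-types of $\mathbb{N},\mathbb{Z},\mathbb{Q}$; $\omega^*$ is the reverse of $\omega$; $\zeta\eta$ is $\eta$-many copies of $\zeta$ ordered lexicographically. Shuffle: for a non-empty at most countable set $X$ of order-types, choose a coloring of $\mathbb{Q}$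 with $|X|$ colors each of which is dense in $\mathbb{Q}$, assign distinct colors to members of $X$, and replace each rational by a copy of the order-type assigned to its color; the resulting order-type is $\boldsymbol{\sigma}(X)$. *)

theory Defs
  imports Complex_Main "HOL-Library.Countable_Set"
begin

section \<open>Partial recursive functions\<close>

text \<open>
  Kleene's schemes. A description has no fixed arity: on argument lists of each fixed length it
  computes one partial function, which is partial recursive. An ill-formed application
  (such as a projection beyond the end of the list) diverges.
\<close>

datatype recf =
    Zero
  | Succ
  | Proj nat
  | Comp recf "recf list"
  | PrimRec recf recf
  | Mu recf

inductive computes :: "recf \<Rightarrow> nat list \<Rightarrow> nat \<Rightarrow> bool" where
  Zero: "computes Zero xs 0"
| Succ: "computes Succ [x] (Suc x)"
| Proj: "i < length xs \<Longrightarrow> computes (Proj i) xs (xs ! i)"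
| Comp: "list_all2 (\<lambda>g y. computes g xs y) gs ys \<Longrightarrow> computes f ys z \<Longrightarrow> computes (Comp f gs) xs z"
| PrimRec_0: "computes f xs y \<Longrightarrow> computes (PrimRec f g) (0 # xs) y"
| PrimRec_Suc: "computes (PrimRec f g) (n # xs) y \<Longrightarrow> computes g (n # y # xs) z
    \<Longrightarrow> computes (PrimRec f g) (Suc n # xs) z"
| Mu: "computes f (n # xs) 0 \<Longrightarrow> (\<And>i. i < n \<Longrightarrow> \<exists>y>0. computes f (i # xs) y)
    \<Longrightarrow> computes (Mu f) xs n"

lemma computes_deterministic:
  "computes r xs y \<Longrightarrow> computes r xs z \<Longrightarrow> y = z"
proof (induction arbitrary: z rule: computes.induct)
  case (Zero xs)
  then show ?case by (auto elim: computes.cases)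
next
  case (Succ x)
  then show ?case by (auto elim: computes.cases)
next
  case (Proj i xs)
  from Proj.prems show ?case by (auto elim: computes.cases)
next
  case (Comp xs gs ys f z')
  from Comp.prems obtain ys' where ys': "list_all2 (\<lambda>g y. computes g xs y) gs ys'"
    and f: "computes f ys' z" by (auto elim: computes.cases)
  have "ys = ys'"
    using Comp.IH(1) ys' by (auto simp: list_all2_conv_all_nth intro!: nth_equalityI)
  with Comp.IH(2) f show ?case by blast
next
  case (PrimRec_0 f xs y g)
  from PrimRec_0.prems have "computes f xs z" by (auto elim: computes.cases)
  with PrimRec_0.IH show ?case by blast
next
  case (PrimRec_Suc f g n xs y z')
  from PrimRec_Suc.prems obtain y' where "computes (PrimRec f g) (n # xs) y'"
    and "computes g (n # y' # xs) z" by (auto elim: computes.cases)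
  with PrimRec_Suc.IH show ?case by blast
next
  case (Mu f n xs)
  from Mu.prems have z: "computes f (z # xs) 0"
    and less: "\<And>i. i < z \<Longrightarrow> \<exists>y>0. computes f (i # xs) y" by (auto elim: computes.cases)
  have "\<not> n < z" using less[of n] Mu.IH(1) by auto
  moreover have "\<not> z < n" using Mu.IH(2)[of z] z by auto
  ultimately show ?case by simp
qed

definition partial_computable :: "(nat \<rightharpoonup> nat) \<Rightarrow> bool" where
  "partial_computable \<phi> \<longleftrightarrow> (\<exists>r. \<forall>x y. \<phi> x = Some y \<longleftrightarrow> computes r [x] y)"

definition decidable :: "nat \<Rightarrow> (nat list \<Rightarrow> bool) \<Rightarrow> bool" where
  "decidable k P \<longleftrightarrow> (\<exists>r. \<forall>xs. length xs = k \<longrightarrow> computes r xs (if P xs then 1 else 0))"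

definition ce :: "nat set \<Rightarrow> bool" where
  "ce W \<longleftrightarrow> (\<exists>\<phi>. partial_computable \<phi> \<and> W = dom \<phi>)"

definition co_ce :: "nat set \<Rightarrow> bool" where
  "co_ce C \<longleftrightarrow> ce (UNIV - C)"

definition Pi2 :: "nat set \<Rightarrow> bool" where
  "Pi2 X \<longleftrightarrow> (\<exists>R. decidable 3 R \<and> X = {n. \<forall>y. \<exists>z. R [n, y, z]})"

definition cohesive :: "nat set \<Rightarrow> bool" where
  "cohesive C \<longleftrightarrow> infinite C \<and> (\<forall>W. ce W \<longrightarrow> finite (C - W) \<or> finite (C \<inter> W))"


section \<open>Linear orders and order-types\<close>

text \<open>An order is a carrier together with a strict order relation on it.\<close>

type_synonym 'a ord = "'a set \<times> 'a rel"

definition linear :: "'a ord \<Rightarrow> bool" where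
  "linear = (\<lambda>(A, r). r \<subseteq> A \<times> A \<and> strict_linear_order_on A r)"

text \<open>
  Order-types are represented by concrete orders; ``\<open>A\<close> has the order-type of \<open>B\<close>'' is \<open>A \<cong> B\<close>.
\<close>

definition order_iso :: "'a ord \<Rightarrow> 'b ord \<Rightarrow> bool" (infix "\<cong>" 50) where
  "order_iso = (\<lambda>(A, r) (B, s). \<exists>f. bij_betw f A B \<and>
     (\<forall>x\<in>A. \<forall>y\<in>A. (x, y) \<in> r \<longleftrightarrow> (f x, f y) \<in> s))"

definition fin_ord :: "nat \<Rightarrow> nat ord" where
  "fin_ord k = ({..<k}, {(i, j). i < j \<and> j < k})"

definition omega :: "nat ord" where
  "omega = (UNIV, {(i, j). i < j})"

definition zeta :: "int ord" where
  "zeta = (UNIV, {(i, j). i < j})"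

definition reverse :: "'a ord \<Rightarrow> 'a ord" where
  "reverse = (\<lambda>(A, r). (A, r\<inverse>))"

definition ord_plus :: "'a ord \<Rightarrow> 'b ord \<Rightarrow> ('a + 'b) ord" (infixl "\<oplus>" 65) where
  "ord_plus = (\<lambda>(A, r) (B, s). (A <+> B,
     map_prod Inl Inl ` r \<union> map_prod Inr Inr ` s \<union> (Inl ` A) \<times> (Inr ` B)))"

definition ord_image :: "('a \<Rightarrow> 'b) \<Rightarrow> 'a ord \<Rightarrow> 'b ord" where
  "ord_image f = (\<lambda>(A, r). (f ` A, map_prod f f ` r))"

text \<open>The order obtained from the rationals by replacing each \<open>q\<close> by a copy of \<open>F q\<close>.\<close>

definition rat_sum :: "(rat \<Rightarrow> 'a ord) \<Rightarrow> (rat \<times> 'a) ord" where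
  "rat_sum F = (let A = (SIGMA q:UNIV. fst (F q)) in
     (A, {((p, x), (q, y)). (p, x) \<in> A \<and> (q, y) \<in> A \<and>
            (p < q \<or> p = q \<and> (x, y) \<in> snd (F q))}))"

definition dense_coloring :: "'c set \<Rightarrow> (rat \<Rightarrow> 'c) \<Rightarrow> bool" where
  "dense_coloring S c \<longleftrightarrow> range c \<subseteq> S \<and>
     (\<forall>s\<in>S. \<forall>a b. a < b \<longrightarrow> (\<exists>q. a < q \<and> q < b \<and> c q = s))"

text \<open>
  The shuffle of a non-empty countable set of orders, which themselves serve as the colors.
  By back-and-forth its order-type does not depend on the chosen coloring.
\<close>

definition shuffle :: "'a ord set \<Rightarrow> (rat \<times> 'a) ord" where
  "shuffle S = rat_sum (SOME c. dense_coloring S c)"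

lemma dense_coloring_exists:
  assumes "countable S" "S \<noteq> {}"
  shows "\<exists>c. dense_coloring S c"
proof -
  define D :: "nat \<Rightarrow> rat set" where
    "D n = {q. \<exists>p d :: int. odd p \<and> odd d \<and> q = of_int p / (2 ^ n * of_int d)}" for n
  have disj: "\<not> m < n" if q: "q \<in> D m" "q \<in> D n" for q m n
  proof
    assume "m < n"
    then obtain k where n: "n = m + Suc k" using less_imp_Suc_add by force
    from q obtain p d p' d' :: int where odds: "odd p" "odd d" "odd p'" "odd d'"
      and "(of_int p :: rat) / (2 ^ m * of_int d) = of_int p' / (2 ^ n * of_int d')"
      unfolding D_def by auto
    moreover have "(of_int d :: rat) \<noteq> 0" "(of_int d' :: rat) \<noteq> 0" using odds by auto
    ultimately have "(of_int (p * (2 * 2 ^ k * d')) :: rat) = of_int (p' * d)"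
      by (simp add: n field_simps power_add)
    then have "p * (2 * 2 ^ k * d') = p' * d" by (simp only: of_int_eq_iff)
    then have "even (p' * d)" by (metis dvd_mult dvd_triv_left mult.assoc)
    with odds show False by simp
  qed
  have uniq: "(THE n. q \<in> D n) = n" if "q \<in> D n" for q n
    using that disj by (metis linorder_neqE_nat the_equality)
  define c where "c q = from_nat_into S (THE n. q \<in> D n)" for q
  have "\<exists>q. a < q \<and> q < b \<and> c q = s" if s: "s \<in> S" and ab: "a < b" for s and a b :: rat
  proof -
    obtain n where n: "from_nat_into S n = s" using assms(1) s from_nat_into_surj by metis
    obtain k :: nat where k: "2 / (b - a) < of_nat k" using reals_Archimedean2 by blast
    define d :: int where "d = 2 * int k + 1"
    define N :: rat where "N = 2 ^ n * of_int d"
    have d: "odd d" "(of_int d :: rat) > of_nat k" "d > 0" by (auto simp: d_def)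
    have "N \<ge> of_int d" using d(3) by (simp add: N_def)
    then have N: "N > 2 / (b - a)" "N > 0" using k d by (auto intro: order.strict_trans2)
    then have len: "a * N + 2 < b * N" using ab by (simp add: field_simps)
    define j where "j = \<lfloor>a * N\<rfloor>"
    define p where "p = (if even j then j + 1 else j + 2)"
    have p: "odd p" "a * N < of_int p" "of_int p \<le> a * N + 2"
      unfolding p_def j_def by (auto; linarith)+
    then have "a < of_int p / N" "of_int p / N < b" using N len by (auto simp: field_simps)
    moreover have "of_int p / N \<in> D n" using p d unfolding D_def N_def by blast
    then have "c (of_int p / N) = s" using uniq n by (simp add: c_def)
    ultimately show ?thesis by blast
  qed
  moreover have "range c \<subseteq> S" using from_nat_into[OF assms(2)] by (auto simp: c_def)
  ultimately show ?thesis unfolding dense_coloring_def by blast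
qed

text \<open>The order-type \<open>\<omega> + \<zeta>\<eta> + \<omega>\<^sup>*\<close>.\<close>

definition alpha :: "((nat + rat \<times> int) + nat) ord" where
  "alpha = omega \<oplus> rat_sum (\<lambda>_. zeta) \<oplus> reverse omega"

text \<open>
  The set of orders \<open>X \<union> {\<alpha>}\<close>, where \<open>k \<in> X\<close> stands for the \<open>k\<close>-element order. The injection only
  serves to transfer that order to the type of \<open>alpha\<close>.
\<close>

definition with_alpha :: "nat set \<Rightarrow> ((nat + rat \<times> int) + nat) ord set" where
  "with_alpha X = (\<lambda>k. ord_image (Inl \<circ> Inl) (fin_ord k)) ` X \<union> {alpha}"


section \<open>Computable linear orders and cohesive powers\<close>

definition computable_linear_order :: "nat ord \<Rightarrow> bool" where
  "computable_linear_order M \<longleftrightarrow> linear M \<and>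
     decidable 1 (\<lambda>xs. xs ! 0 \<in> fst M) \<and>
     decidable 2 (\<lambda>xs. (xs ! 0, xs ! 1) \<in> snd M)"

definition almost_subset :: "'a set \<Rightarrow> 'a set \<Rightarrow> bool" (infix "\<subseteq>\<^sup>*" 50) where
  "X \<subseteq>\<^sup>* Y \<longleftrightarrow> finite (X - Y)"

definition power_funs :: "nat set \<Rightarrow> nat ord \<Rightarrow> (nat \<rightharpoonup> nat) set" where
  "power_funs C M = {\<phi>. partial_computable \<phi> \<and> ran \<phi> \<subseteq> fst M \<and> C \<subseteq>\<^sup>* dom \<phi>}"

definition power_eq :: "nat set \<Rightarrow> nat ord \<Rightarrow> (nat \<rightharpoonup> nat) rel" where
  "power_eq C M = {(\<phi>, \<psi>). \<phi> \<in> power_funs C M \<and> \<psi> \<in> power_funs C M \<and>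
     C \<subseteq>\<^sup>* {x. \<exists>y. \<phi> x = Some y \<and> \<psi> x = Some y}}"

definition cohesive_power :: "nat set \<Rightarrow> nat ord \<Rightarrow> (nat \<rightharpoonup> nat) set ord" where
  "cohesive_power C M = (let Q = power_funs C M // power_eq C M in
     (Q, {(P, R). P \<in> Q \<and> R \<in> Q \<and> (\<exists>\<phi>\<in>P. \<exists>\<psi>\<in>R.
            C \<subseteq>\<^sup>* {x. \<exists>y z. \<phi> x = Some y \<and> \<psi> x = Some z \<and> (y, z) \<in> snd M})}))"

end

theory Submission
  imports Defs
begin

text \<open>
  Let \<open>count n\<close> be the number of elements of \<open>C\<close> below \<open>n\<close>. Call \<open>x\<close> admissible if \<open>x\<close> codes a
  positive dyadic rational of integer part \<open>d\<close> such that \<open>count x \<le> 2 d + 1\<close> and, if its color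
  \<open>k\<close> is not \<open>0\<close>, such that \<open>k\<close> passes the tests up to \<open>d\<close> of the \<open>\<Pi>\<^sub>2\<close> condition defining
  \<open>X\<close>. Replace every admissible \<open>x\<close> by \<open>k\<close> points, or by \<open>d + 1\<close> points if \<open>k = 0\<close>. Since \<open>C\<close> is
  infinite, only finitely many \<open>x\<close> are admissible for each \<open>d\<close>, so the result has type \<open>\<omega>\<close>; it is
  c.e., because \<open>C\<close> is co-c.e., hence isomorphic to a computable order.

  The cohesive power is rich in points for two reasons. A computable function \<open>f\<close> that is not
  eventually constant on \<open>C\<close> satisfies \<open>count n \<le> 2 f n\<close> for almost all \<open>n \<in> C\<close>, and every computable
  \<open>f\<close> satisfies \<open>count (f n) \<le> count n + 1\<close> for almost all \<open>n \<in> C\<close>. Therefore a computable choice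
  of dyadic rationals whose integer parts tend to infinity along \<open>C\<close>, with a fixed color in
  \<open>X \<union> {0}\<close>, is admissible almost everywhere on \<open>C\<close>: all these colors are dense in the
  nonstandard part. No enumeration of the partial computable functions is needed.
  A nonstandard point whose color is almost always \<open>k > 0\<close> is replaced by \<open>k\<close> points; otherwise it is
  replaced by a nonstandard number of points, that is, by \<open>\<omega> + \<zeta>\<eta> + \<omega>\<^sup>*\<close>.
\<close>

section \<open>Computable functions and semidecidable predicates\<close>

text \<open>Each integer part may carry only finitely many points, yet every computable choice along
  \<open>C\<close> must eventually be allowed. A computable bound on the codes admissible at
  \<open>d\<close> cannot achieve this, since a computable choice can exceed it everywhere. The
  bound through \<open>count\<close> is not computable, but the finite sets of codes that it allows
  are c.e., because the approximations to \<open>count\<close> decrease as numbers leave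
  \<open>C\<close>. That \<open>C\<close> is co-c.e. is used a second time: a search along
  \<open>C\<close> may also stop when its input is enumerated outside \<open>C\<close>. So every
  element of the cohesive power has a total computable representative. Since cohesiveness decides
  c.e. conditions almost everywhere on \<open>C\<close>, total computable functions can be handled
  like nonstandard numbers. Membership in \<open>X\<close> need not be c.e., but each finite stage
  of its tests is. A color outside \<open>X\<close> fails at a standard level and hence at all
  nonstandard points. A color that is not constant almost everywhere avoids each standard value, so
  it also yields a nonstandard number of points and adds no new order-type.\<close>

definition total_computable :: "nat \<Rightarrow> (nat list \<Rightarrow> nat) \<Rightarrow> bool" where
  "total_computable k f \<longleftrightarrow> (\<exists>r. \<forall>xs. length xs = k \<longrightarrow> computes r xs (f xs))"

lemma decidable_iff: "decidable k P \<longleftrightarrow> total_computable k (\<lambda>xs. if P xs then 1 else 0)"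
  by (simp add: decidable_def total_computable_def)

lemma total_computable_cong:
  assumes "total_computable k f" "\<And>xs. length xs = k \<Longrightarrow> f xs = g xs"
  shows "total_computable k g"
  using assms unfolding total_computable_def by metis

lemma decidable_cong:
  assumes "decidable k P" "\<And>xs. length xs = k \<Longrightarrow> P xs = Q xs"
  shows "decidable k Q"
  using assms unfolding decidable_def by metis

text \<open>Maps between argument lists, computable in each coordinate. These are what
  \<open>Comp\<close> substitutes, so reordering, dropping and duplicating arguments all become
  instances of \<open>computable_subst\<close>.\<close>

definition list_computable :: "nat \<Rightarrow> nat \<Rightarrow> (nat list \<Rightarrow> nat list) \<Rightarrow> bool" where
  "list_computable k m F \<longleftrightarrow> (\<forall>xs. length xs = k \<longrightarrow> length (F xs) = m) \<and>
     (\<forall>i<m. total_computable k (\<lambda>xs. F xs ! i))"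

lemma computable_subst:
  assumes "total_computable m f" "list_computable k m F"
  shows "total_computable k (\<lambda>xs. f (F xs))"
proof -
  obtain r where r: "\<And>xs. length xs = m \<Longrightarrow> computes r xs (f xs)"
    using assms(1) unfolding total_computable_def by blast
  have "\<forall>i. \<exists>g. i < m \<longrightarrow> (\<forall>xs. length xs = k \<longrightarrow> computes g xs (F xs ! i))"
    using assms(2) unfolding list_computable_def total_computable_def by blast
  then obtain g where g: "\<And>i xs. i < m \<Longrightarrow> length xs = k \<Longrightarrow> computes (g i) xs (F xs ! i)"
    by metis
  have "computes (Comp r (map g [0..<m])) xs (f (F xs))" if "length xs = k" for xs
  proof (rule computes.Comp)
    have l: "length (F xs) = m" using assms(2) that by (simp add: list_computable_def)
    then show "list_all2 (\<lambda>g y. computes g xs y) (map g [0..<m]) (F xs)"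
      using g that by (auto simp: list_all2_conv_all_nth)
    show "computes r (F xs) (f (F xs))" using r l by simp
  qed
  then show ?thesis unfolding total_computable_def by blast
qed

lemma decidable_subst:
  assumes "decidable m P" "list_computable k m F"
  shows "decidable k (\<lambda>xs. P (F xs))"
  using computable_subst[OF assms[unfolded decidable_iff]] by (simp add: decidable_iff)

lemma computable_nth: "i < k \<Longrightarrow> total_computable k (\<lambda>xs. xs ! i)"
  unfolding total_computable_def by (metis computes.Proj)

lemma list_computable_id: "list_computable k k (\<lambda>xs. xs)"
  by (simp add: list_computable_def computable_nth)

lemma list_computable_Nil: "list_computable k 0 (\<lambda>xs. [])"
  by (simp add: list_computable_def)

lemma list_computable_Cons:
  "total_computable k f \<Longrightarrow> list_computable k m F \<Longrightarrow> list_computable k (Suc m) (\<lambda>xs. f xs # F xs)"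
  by (auto simp: list_computable_def less_Suc_eq_0_disj)

lemma list_computable_tl:
  assumes "list_computable k (Suc m) F"
  shows "list_computable k m (\<lambda>xs. tl (F xs))"
proof -
  have "total_computable k (\<lambda>xs. tl (F xs) ! i)" if "i < m" for i
    by (rule total_computable_cong[where f = "\<lambda>xs. F xs ! Suc i"])
      (use assms that in \<open>auto simp: list_computable_def nth_tl\<close>)
  then show ?thesis using assms by (simp add: list_computable_def)
qed

lemma list_computable_nth: "list_computable k m F \<Longrightarrow> i < m \<Longrightarrow> total_computable k (\<lambda>xs. F xs ! i)"
  by (simp add: list_computable_def)

lemma list_computable_hd:
  assumes "list_computable k m F" "0 < m"
  shows "total_computable k (\<lambda>xs. hd (F xs))"
  by (rule total_computable_cong[where f = "\<lambda>xs. F xs ! 0"])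
    (use assms in \<open>auto simp: list_computable_def hd_conv_nth\<close>)

lemmas list_intros = list_computable_Nil list_computable_Cons list_computable_id
  list_computable_tl[OF list_computable_id[of "Suc k" for k]]
  list_computable_tl[OF list_computable_tl[OF list_computable_id[of "Suc (Suc k)" for k]]]

lemma computable_tl_nth: "Suc i < k \<Longrightarrow> total_computable k (\<lambda>xs. tl xs ! i)"
  by (rule total_computable_cong[where f = "\<lambda>xs. xs ! Suc i"]) (auto simp: computable_nth nth_tl)

lemma computable_tl_tl_nth: "Suc (Suc i) < k \<Longrightarrow> total_computable k (\<lambda>xs. tl (tl xs) ! i)"
  by (rule total_computable_cong[where f = "\<lambda>xs. xs ! Suc (Suc i)"]) (auto simp: computable_nth nth_tl)

lemma computable_hd: "0 < k \<Longrightarrow> total_computable k hd"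
  by (rule list_computable_hd[OF list_computable_id])

lemma computable_hd_tl: "1 < k \<Longrightarrow> total_computable k (\<lambda>xs. hd (tl xs))"
  using list_computable_hd[OF list_computable_tl[OF list_computable_id[of "Suc (k - 1)"]]] by simp

lemma computable_Suc: "total_computable k f \<Longrightarrow> total_computable k (\<lambda>xs. Suc (f xs))"
proof -
  have "total_computable 1 (\<lambda>xs. Suc (xs ! 0))"
    unfolding total_computable_def
    by (rule exI[of _ Succ]) (auto simp: length_Suc_conv intro: computes.Succ)
  then show "total_computable k f \<Longrightarrow> ?thesis"
    using computable_subst[of 1 "\<lambda>xs. Suc (xs ! 0)" k "\<lambda>xs. [f xs]"]
      list_computable_Cons[OF _ list_computable_Nil] by simp
qed

lemma computable_const: "total_computable k (\<lambda>xs. c)"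
proof (induction c)
  case 0
  show ?case unfolding total_computable_def by (rule exI[of _ Zero]) (simp add: computes.Zero)
qed (rule computable_Suc)

lemma computable_app1:
  assumes "total_computable 1 (\<lambda>xs. h (xs ! 0))" "total_computable k f"
  shows "total_computable k (\<lambda>xs. h (f xs))"
  using computable_subst[OF assms(1), of k "\<lambda>xs. [f xs]"] assms(2)
  by (simp add: list_computable_Cons list_computable_Nil)

lemma decidable_app1:
  assumes "decidable 1 (\<lambda>xs. P (xs ! 0))" "total_computable k f"
  shows "decidable k (\<lambda>xs. P (f xs))"
  using decidable_subst[OF assms(1), of k "\<lambda>xs. [f xs]"] assms(2)
  by (simp add: list_computable_Cons list_computable_Nil)

lemma decidable_app2:
  assumes "decidable 2 (\<lambda>xs. P (xs ! 0) (xs ! 1))" "total_computable k f" "total_computable k g"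
  shows "decidable k (\<lambda>xs. P (f xs) (g xs))"
  using decidable_subst[OF assms(1), of k "\<lambda>xs. [f xs, g xs]"] assms(2,3)
  by (simp add: list_computable_Cons list_computable_Nil numeral_2_eq_2)

text \<open>A bound variable is the head of the argument list and the parameters are its tail, as
  \<open>PrimRec\<close> demands. The rules below for sums, bounded quantifiers and searches follow
  the same convention.\<close>

lemma computable_rec:
  assumes f: "total_computable k f" and h: "total_computable k h"
    and g: "total_computable (Suc (Suc k)) (\<lambda>ys. g (hd ys) (hd (tl ys)) (tl (tl ys)))"
  shows "total_computable k (\<lambda>xs. rec_nat (f xs) (\<lambda>m v. g m v xs) (h xs))"
proof -
  obtain rf where rf: "\<And>xs. length xs = k \<Longrightarrow> computes rf xs (f xs)"
    using f unfolding total_computable_def by blast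
  obtain rg where "\<And>ys. length ys = Suc (Suc k) \<Longrightarrow> computes rg ys (g (hd ys) (hd (tl ys)) (tl (tl ys)))"
    using g unfolding total_computable_def by blast
  from this[of "m # v # xs" for m v xs]
  have rg: "\<And>m v xs. length xs = k \<Longrightarrow> computes rg (m # v # xs) (g m v xs)" by simp
  have "computes (PrimRec rf rg) (n # xs) (rec_nat (f xs) (\<lambda>m v. g m v xs) n)"
    if "length xs = k" for n xs
    by (induction n) (auto intro: computes.intros rf rg that)
  then have "total_computable (Suc k) (\<lambda>ys. rec_nat (f (tl ys)) (\<lambda>m v. g m v (tl ys)) (hd ys))"
    unfolding total_computable_def by (intro exI[of _ "PrimRec rf rg"]) (auto simp: length_Suc_conv)
  from computable_subst[OF this list_computable_Cons[OF h list_computable_id]] show ?thesis by simp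
qed

section \<open>Arithmetic, Boolean operations and bounded quantifiers\<close>

lemma computable_add: "total_computable k f \<Longrightarrow> total_computable k g \<Longrightarrow> total_computable k (\<lambda>xs. f xs + g xs)"
proof -
  assume fg: "total_computable k f" "total_computable k g"
  have e: "rec_nat a (\<lambda>m v. Suc v) b = a + b" for a b :: nat by (induction b) auto
  have "total_computable k (\<lambda>xs. rec_nat (f xs) (\<lambda>m v. Suc v) (g xs))"
    by (intro computable_rec fg computable_Suc computable_hd_tl) simp
  then show ?thesis by (simp only: e)
qed

lemma computable_mult: "total_computable k f \<Longrightarrow> total_computable k g \<Longrightarrow> total_computable k (\<lambda>xs. f xs * g xs)"
proof -
  assume fg: "total_computable k f" "total_computable k g"
  have e: "rec_nat 0 (\<lambda>m v. v + a) b = a * b" for a b :: nat by (induction b) auto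
  have "total_computable k (\<lambda>xs. rec_nat 0 (\<lambda>m v. v + f xs) (g xs))"
    by (intro computable_rec fg computable_add computable_hd_tl computable_const
        computable_subst[OF fg(1)] list_intros) simp
  then show ?thesis by (simp only: e)
qed

lemma computable_power: "total_computable k f \<Longrightarrow> total_computable k g \<Longrightarrow> total_computable k (\<lambda>xs. f xs ^ g xs)"
proof -
  assume fg: "total_computable k f" "total_computable k g"
  have e: "rec_nat 1 (\<lambda>m v. a * v) b = a ^ b" for a b :: nat by (induction b) auto
  have "total_computable k (\<lambda>xs. rec_nat 1 (\<lambda>m v. f xs * v) (g xs))"
    by (intro computable_rec fg computable_mult computable_hd_tl computable_const
        computable_subst[OF fg(1)] list_intros) simp
  then show ?thesis by (simp only: e)
qed

lemma computable_diff: "total_computable k f \<Longrightarrow> total_computable k g \<Longrightarrow> total_computable k (\<lambda>xs. f xs - g xs)"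
proof -
  assume fg: "total_computable k f" "total_computable k g"
  have e1: "rec_nat 0 (\<lambda>m v. m) b = b - 1" for b :: nat by (cases b) auto
  have pred: "total_computable k (\<lambda>xs. f xs - 1)" if "total_computable k f" for k f
    using computable_rec[OF computable_const that computable_hd, of 0] by (simp add: e1)
  have e: "rec_nat a (\<lambda>m v. v - 1) b = a - b" for a b :: nat by (induction b) auto
  have "total_computable k (\<lambda>xs. rec_nat (f xs) (\<lambda>m v. v - 1) (g xs))"
    by (intro computable_rec fg pred computable_hd_tl) simp
  then show ?thesis by (simp only: e)
qed

lemma decidable_le: "total_computable k f \<Longrightarrow> total_computable k g \<Longrightarrow> decidable k (\<lambda>xs. f xs \<le> g xs)"
proof -
  assume fg: "total_computable k f" "total_computable k g"
  have "total_computable k (\<lambda>xs. 1 - (f xs - g xs))"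
    by (intro computable_diff computable_const fg)
  then show ?thesis unfolding decidable_iff
    by (rule total_computable_cong) auto
qed

lemma decidable_less: "total_computable k f \<Longrightarrow> total_computable k g \<Longrightarrow> decidable k (\<lambda>xs. f xs < g xs)"
  using decidable_le[OF computable_Suc, of k f g] by (simp add: Suc_le_eq)

lemma decidable_not: "decidable k P \<Longrightarrow> decidable k (\<lambda>xs. \<not> P xs)"
  unfolding decidable_iff
  by (rule total_computable_cong[OF computable_diff[OF computable_const[of _ 1]]]) auto

lemma decidable_conj:
  assumes "decidable k P" "decidable k Q"
  shows "decidable k (\<lambda>xs. P xs \<and> Q xs)"
  unfolding decidable_iff
  by (rule total_computable_cong[OF computable_mult[OF assms[unfolded decidable_iff]]]) auto

lemma decidable_disj: "decidable k P \<Longrightarrow> decidable k Q \<Longrightarrow> decidable k (\<lambda>xs. P xs \<or> Q xs)"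
  using decidable_not[OF decidable_conj[OF decidable_not decidable_not, of k P Q]] by simp

lemma decidable_eq: "total_computable k f \<Longrightarrow> total_computable k g \<Longrightarrow> decidable k (\<lambda>xs. f xs = g xs)"
  unfolding order.eq_iff by (intro decidable_conj decidable_le)

lemma computable_if: 
  assumes "decidable k P" "total_computable k f" "total_computable k g"
  shows "total_computable k (\<lambda>xs. if P xs then f xs else g xs)"
proof -
  have "total_computable k (\<lambda>xs. (if P xs then 1 else 0) * f xs + (1 - (if P xs then 1 else 0)) * g xs)"
    by (intro computable_add computable_mult computable_diff computable_const assms
        assms(1)[unfolded decidable_iff])
  then show ?thesis by (rule total_computable_cong) auto
qed

lemma computable_sum:
  assumes h: "total_computable k h" and f: "total_computable (Suc k) (\<lambda>ys. f (hd ys) (tl ys))"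
  shows "total_computable k (\<lambda>xs. \<Sum>i<h xs. f i xs)"
proof -
  have e: "rec_nat 0 (\<lambda>m v. v + f m xs) n = (\<Sum>i<n. f i xs)" for n xs by (induction n) auto
  have "total_computable (Suc (Suc k)) (\<lambda>ys. f (hd ys) (tl (tl ys)))"
    using computable_subst[OF f, of "Suc (Suc k)" "\<lambda>ys. hd ys # tl (tl ys)"]
    by (simp add: list_intros computable_hd)
  then have "total_computable k (\<lambda>xs. rec_nat 0 (\<lambda>m v. v + f m xs) (h xs))"
    by (intro computable_rec h computable_add computable_hd_tl computable_const) simp
  then show ?thesis by (simp only: e)
qed

lemma computable_count:
  assumes h: "total_computable k h" and P: "decidable (Suc k) (\<lambda>ys. P (hd ys) (tl ys))"
  shows "total_computable k (\<lambda>xs. card {i. i < h xs \<and> P i xs})"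
proof -
  have "(\<Sum>i<n. if P i xs then 1 else 0) = card {i. i < n \<and> P i xs}" for n xs
  proof -
    have "{i. i < n \<and> P i xs} = {i \<in> {..<n}. P i xs}" by auto
    then show ?thesis by (simp add: sum.If_cases Int_def)
  qed
  then show ?thesis using computable_sum[OF h P[unfolded decidable_iff]] by simp
qed

lemma decidable_bex:
  assumes "decidable (Suc k) (\<lambda>ys. P (hd ys) (tl ys))" "total_computable k h"
  shows "decidable k (\<lambda>xs. \<exists>i<h xs. P i xs)"
proof -
  have "decidable k (\<lambda>xs. 0 < card {i. i < h xs \<and> P i xs})"
    by (intro decidable_less computable_const computable_count assms)
  then show ?thesis by (rule decidable_cong) (auto simp: card_gt_0_iff)
qed

lemma decidable_ball:
  assumes "decidable (Suc k) (\<lambda>ys. P (hd ys) (tl ys))" "total_computable k h"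
  shows "decidable k (\<lambda>xs. \<forall>i<h xs. P i xs)"
  using decidable_not[OF decidable_bex[OF decidable_not[OF assms(1)] assms(2)]] by simp

text \<open>Bounded search; when nothing is found the value is the bound.\<close>
lemma computable_bounded_search:
  assumes "decidable (Suc k) (\<lambda>ys. P (hd ys) (tl ys))" "total_computable k h"
  shows "total_computable k (\<lambda>xs. card {i. i < h xs \<and> (\<forall>j<Suc i. \<not> P j xs)})"
proof (rule computable_count[OF assms(2)], rule decidable_ball)
  have "decidable (Suc (Suc k)) (\<lambda>ys. P (hd ys) (tl (tl ys)))"
    using decidable_subst[OF assms(1), of "Suc (Suc k)" "\<lambda>ys. hd ys # tl (tl ys)"]
    by (simp add: list_intros computable_hd)
  then show "decidable (Suc (Suc k)) (\<lambda>ys. \<not> P (hd ys) (tl (tl ys)))" by (rule decidable_not)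
  show "total_computable (Suc k) (\<lambda>ys. Suc (hd ys))" by (simp add: computable_Suc computable_hd)
qed

text \<open>The indices up to which no witness has occurred form the initial segment below the first
  witness, so counting them returns that witness.\<close>

lemma bounded_search_eq:
  assumes "P n" "\<And>j. j < n \<Longrightarrow> \<not> P j" "n \<le> (h::nat)"
  shows "card {i. i < h \<and> (\<forall>j<Suc i. \<not> P j)} = n"
proof -
  have "{i. i < h \<and> (\<forall>j<Suc i. \<not> P j)} = {..<n}"
    using assms by (auto simp: less_Suc_eq_le) (meson leI less_Suc_eq_le)
  then show ?thesis by simp
qed

section \<open>Evaluation of descriptions in stages\<close>

text \<open>
  The value \<open>0\<close> means that no result is known at stage \<open>s\<close>, and \<open>Suc y\<close> that the result is \<open>y\<close>.
  Only the searches of \<open>Mu\<close> depend on the stage.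
\<close>
fun stage_eval :: "recf \<Rightarrow> nat \<Rightarrow> nat list \<Rightarrow> nat" where
  "stage_eval Zero s xs = 1"
| "stage_eval Succ s xs = (if length xs = 1 then Suc (Suc (xs ! 0)) else 0)"
| "stage_eval (Proj i) s xs = (if i < length xs then Suc (xs ! i) else 0)"
| "stage_eval (Comp f gs) s xs =
     (if \<exists>g\<in>set gs. stage_eval g s xs = 0 then 0
      else stage_eval f s (map (\<lambda>g. stage_eval g s xs - 1) gs))"
| "stage_eval (PrimRec f g) s xs = (if xs = [] then 0 else
     rec_nat (stage_eval f s (tl xs))
       (\<lambda>m v. if v = 0 then 0 else stage_eval g s (m # (v - 1) # tl xs)) (hd xs))"
| "stage_eval (Mu f) s xs =
     (if \<exists>n<s. stage_eval f s (n # xs) = 1 \<and> (\<forall>i<n. 1 < stage_eval f s (i # xs))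
      then Suc (card {i. i < s \<and> (\<forall>j<Suc i. \<not> stage_eval f s (j # xs) = 1)}) else 0)"

lemma stage_eval_PrimRec_Cons [simp]:
  "stage_eval (PrimRec f g) s (n # xs) = rec_nat (stage_eval f s xs)
     (\<lambda>m v. if v = 0 then 0 else stage_eval g s (m # (v - 1) # xs)) n"
  by (simp cong: if_cong)

lemma stage_eval_PrimRec_Nil [simp]: "stage_eval (PrimRec f g) s [] = 0"
  by simp

declare stage_eval.simps(5) [simp del]

text \<open>Once the searches of \<open>Mu\<close> are bounded by the stage, every clause is a
  primitive recursive scheme. The description is fixed, so induction on it takes the place of a
  universal function; \<open>k\<close> varies because recursion and search change the arity.\<close>

lemma computable_stage_eval:
  "total_computable (Suc k) (\<lambda>ys. stage_eval r (hd ys) (tl ys))"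
proof (induction r arbitrary: k)
  case Succ
  show ?case
  proof (cases "k = 1")
    case True
    show ?thesis by (rule total_computable_cong[of _ "\<lambda>ys. Suc (Suc (tl ys ! 0))"], intro computable_Suc computable_tl_nth) (use True in auto)
  next
    case False
    show ?thesis by (rule total_computable_cong[of _ "\<lambda>ys. 0"], intro computable_const) (use False in auto)
  qed
next
  case (Proj i)
  show ?case
  proof (cases "i < k")
    case True
    show ?thesis by (rule total_computable_cong[of _ "\<lambda>ys. Suc (tl ys ! i)"], intro computable_Suc computable_tl_nth) (use True in auto)
  next
    case False
    show ?thesis by (rule total_computable_cong[of _ "\<lambda>ys. 0"], intro computable_const) (use False in auto)
  qed
next
  case (Comp f gs)
  have "decidable (Suc k) (\<lambda>ys. \<exists>g\<in>set hs. stage_eval g (hd ys) (tl ys) = 0)" if "set hs \<subseteq> set gs" for hs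
    using that
  proof (induction hs)
    case Nil
    show ?case using decidable_le[OF computable_const[of _ 1] computable_const[of _ 0]] by simp
  next
    case (Cons h hs)
    then show ?case using Comp.IH(2)[of h k] by (auto intro!: decidable_disj decidable_eq computable_const)
  qed
  moreover have map: "list_computable (Suc k) (length hs) (\<lambda>ys. map (\<lambda>g. stage_eval g (hd ys) (tl ys) - 1) hs)"
    if "set hs \<subseteq> set gs" for hs
    using that by (induction hs)
      (auto intro!: list_intros computable_diff computable_const Comp.IH(2)[of _ k, simplified])
  have "list_computable (Suc k) (Suc (length gs))
      (\<lambda>ys. hd ys # map (\<lambda>g. stage_eval g (hd ys) (tl ys) - 1) gs)"
    by (intro list_intros computable_hd map) auto
  from computable_subst[OF Comp.IH(1) this]
  have "total_computable (Suc k) (\<lambda>ys. stage_eval f (hd ys) (map (\<lambda>g. stage_eval g (hd ys) (tl ys) - 1) gs))"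
    by simp
  ultimately show ?case unfolding stage_eval.simps by (intro computable_if computable_const) auto
next
  case (PrimRec f g)
  show ?case
  proof (cases k)
    case 0
    show ?thesis by (rule total_computable_cong[of _ "\<lambda>ys. 0"], intro computable_const) (use 0 in \<open>auto simp: length_Suc_conv\<close>)
  next
    case (Suc k')
    have "total_computable (Suc k) (\<lambda>ys. stage_eval f (hd ys) (tl (tl ys)))"
      using computable_subst[OF PrimRec.IH(1)[of k'], of "Suc k" "\<lambda>ys. hd ys # tl (tl ys)"] Suc
      by (simp add: list_intros computable_hd)
    moreover have "total_computable (Suc (Suc (Suc k)))
      (\<lambda>zs. stage_eval g (hd (tl (tl zs))) (hd zs # (hd (tl zs) - 1) # tl (tl (tl (tl zs)))))"
      using computable_subst[OF PrimRec.IH(2)[of "Suc k"], of "Suc (Suc (Suc k))"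
          "\<lambda>zs. hd (tl (tl zs)) # hd zs # (hd (tl zs) - 1) # tl (tl (tl (tl zs)))"] Suc
      by (simp add: list_intros computable_hd computable_hd_tl computable_diff computable_const
          list_computable_tl list_computable_hd[of _ "Suc k"])
    ultimately have "total_computable (Suc k) (\<lambda>ys. rec_nat (stage_eval f (hd ys) (tl (tl ys)))
       (\<lambda>m v. if v = 0 then 0 else stage_eval g (hd ys) (m # (v - 1) # tl (tl ys))) (hd (tl ys)))"
      using Suc by (intro computable_rec computable_if decidable_eq computable_const computable_hd_tl) auto
    then show ?thesis by (rule total_computable_cong) (use Suc in \<open>auto simp: length_Suc_conv cong: if_cong\<close>)
  qed
next
  case (Mu f)
  have "total_computable (Suc (Suc k)) (\<lambda>ys. stage_eval f (hd (tl ys)) (hd ys # tl (tl ys)))"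
    using computable_subst[OF Mu.IH[of "Suc k"], of "Suc (Suc k)" "\<lambda>ys. hd (tl ys) # hd ys # tl (tl ys)"]
    by (simp add: list_intros computable_hd computable_hd_tl)
  moreover have "total_computable (Suc (Suc (Suc k))) (\<lambda>ys. stage_eval f (hd (tl (tl ys))) (hd ys # tl (tl (tl ys))))"
    using computable_subst[OF Mu.IH[of "Suc k"], of "Suc (Suc (Suc k))" "\<lambda>ys. hd (tl (tl ys)) # hd ys # tl (tl (tl ys))"]
    by (simp add: list_intros computable_hd list_computable_tl list_computable_hd[of _ "Suc k"])
  ultimately show ?case unfolding stage_eval.simps
    by (intro computable_if decidable_bex decidable_conj decidable_ball computable_Suc computable_const
        decidable_eq decidable_less computable_hd computable_bounded_search) auto
qed (simp add: computable_const)

lemma stage_eval_sound: "stage_eval r s xs = Suc y \<Longrightarrow> computes r xs y"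
proof (induction r arbitrary: xs y)
  case Zero
  then show ?case by (auto intro: computes.intros)
next
  case Succ
  then show ?case by (auto intro: computes.intros simp: length_Suc_conv split: if_splits)
next
  case (Proj i)
  then show ?case by (auto intro: computes.intros split: if_splits)
next
  case (Comp f gs)
  from Comp.prems have 0: "\<forall>g\<in>set gs. stage_eval g s xs \<noteq> 0"
    and y: "stage_eval f s (map (\<lambda>g. stage_eval g s xs - 1) gs) = Suc y"
    by (auto split: if_splits)
  show ?case
  proof (rule computes.Comp)
    show "computes f (map (\<lambda>g. stage_eval g s xs - 1) gs) y" using Comp.IH(1) y .
    show "list_all2 (\<lambda>g y. computes g xs y) gs (map (\<lambda>g. stage_eval g s xs - 1) gs)"
      using 0 by (auto simp: list_all2_conv_all_nth intro!: Comp.IH(2))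
  qed
next
  case (PrimRec f g)
  from PrimRec.prems obtain n zs where xs: "xs = n # zs" by (cases xs) auto
  have "rec_nat (stage_eval f s zs)
       (\<lambda>m v. if v = 0 then 0 else stage_eval g s (m # (v - 1) # zs)) n = Suc y
    \<Longrightarrow> computes (PrimRec f g) (n # zs) y" for y
  proof (induction n arbitrary: y)
    case 0
    then show ?case by (auto intro: computes.intros PrimRec.IH)
  next
    case (Suc n)
    let ?v = "rec_nat (stage_eval f s zs)
       (\<lambda>m v. if v = 0 then 0 else stage_eval g s (m # (v - 1) # zs)) n"
    from Suc.prems have v: "?v \<noteq> 0" "stage_eval g s (n # (?v - 1) # zs) = Suc y"
      by (auto split: if_splits)
    then have "?v = Suc (?v - 1)" by simp
    from computes.PrimRec_Suc[OF Suc.IH[OF this] PrimRec.IH(2)[OF v(2)]] show ?case .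
  qed
  with PrimRec.prems xs show ?case by simp
next
  case (Mu f)
  from Mu.prems obtain n where n: "n < s" "stage_eval f s (n # xs) = 1"
      "\<And>i. i < n \<Longrightarrow> 1 < stage_eval f s (i # xs)"
    and y: "y = card {i. i < s \<and> (\<forall>j<Suc i. \<not> stage_eval f s (j # xs) = 1)}"
    by (auto split: if_splits)
  have "y = n" unfolding y using n by (intro bounded_search_eq) (auto simp: less_imp_le dest!: n(3))
  moreover have "computes (Mu f) xs n"
  proof (rule computes.Mu)
    show "computes f (n # xs) 0" using Mu.IH n(2) by simp
    show "\<exists>y>0. computes f (i # xs) y" if "i < n" for i
      using n(3)[OF that] Mu.IH[of "i # xs" "stage_eval f s (i # xs) - 1"] 
      by (intro exI[of _ "stage_eval f s (i # xs) - 1"]) auto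
  qed
  ultimately show ?case by simp
qed

lemma bounded_uniform:
  fixes P :: "nat \<Rightarrow> nat \<Rightarrow> bool"
  assumes "\<And>i. i < n \<Longrightarrow> \<exists>s0. \<forall>s\<ge>s0. P i s"
  shows "\<exists>s0. \<forall>s\<ge>s0. \<forall>i<n. P i s"
proof -
  obtain b where b: "\<And>i s. i < n \<Longrightarrow> b i \<le> s \<Longrightarrow> P i s" using assms by metis
  have "b i \<le> (\<Sum>i<n. b i)" if "i < n" for i using that by (intro member_le_sum) auto
  then show ?thesis using b by (meson le_trans)
qed

text \<open>Claiming the result at all large stages, not just at one, lets finitely many
  subcomputations share a stage without a separate proof of monotonicity.\<close>

lemma stage_eval_complete: "computes r xs y \<Longrightarrow> \<exists>s0. \<forall>s\<ge>s0. stage_eval r s xs = Suc y"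
proof (induction rule: computes.induct)
  case (Comp xs gs ys f z)
  then have l: "length gs = length ys" by (auto simp: list_all2_conv_all_nth)
  have "\<exists>s0. \<forall>s\<ge>s0. \<forall>i<length gs. stage_eval (gs ! i) s xs = Suc (ys ! i)"
    using Comp by (intro bounded_uniform) (auto simp: list_all2_conv_all_nth)
  then obtain s1 where s1: "\<And>s i. s \<ge> s1 \<Longrightarrow> i < length gs \<Longrightarrow> stage_eval (gs ! i) s xs = Suc (ys ! i)"
    by blast
  obtain s2 where s2: "\<And>s. s \<ge> s2 \<Longrightarrow> stage_eval f s ys = Suc z" using Comp by blast
  show ?case
  proof (intro exI[of _ "max s1 s2"] allI impI)
    fix s assume s: "max s1 s2 \<le> s"
    have "map (\<lambda>g. stage_eval g s xs - 1) gs = ys"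
      using s1[of s] s l by (auto intro!: nth_equalityI)
    moreover have "\<forall>g\<in>set gs. stage_eval g s xs \<noteq> 0"
      using s1[of s] s by (auto simp: in_set_conv_nth)
    ultimately show "stage_eval (Comp f gs) s xs = Suc z" using s2[of s] s by auto
  qed
next
  case (PrimRec_Suc f g n xs y z)
  then obtain s1 s2 where s: "\<And>s. s \<ge> s1 \<Longrightarrow> stage_eval (PrimRec f g) s (n # xs) = Suc y"
    "\<And>s. s \<ge> s2 \<Longrightarrow> stage_eval g s (n # y # xs) = Suc z" by metis
  show ?case
    by (intro exI[of _ "max s1 s2"]) (use s in auto)
next
  case (Mu f n xs)
  then obtain s1 where s1: "\<And>s. s \<ge> s1 \<Longrightarrow> stage_eval f s (n # xs) = 1" by auto
  have "\<exists>s0. \<forall>s\<ge>s0. \<forall>i<n. 1 < stage_eval f s (i # xs)"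
  proof (rule bounded_uniform)
    fix i assume "i < n"
    from Mu(3)[OF this] obtain y s0 where "0 < y" "\<forall>s\<ge>s0. stage_eval f s (i # xs) = Suc y" by blast
    then show "\<exists>s0. \<forall>s\<ge>s0. 1 < stage_eval f s (i # xs)" by (intro exI[of _ s0]) simp
  qed
  then obtain s2 where s2: "\<And>s i. s \<ge> s2 \<Longrightarrow> i < n \<Longrightarrow> 1 < stage_eval f s (i # xs)" by blast
  \<comment> \<open>The stage must also exceed \<open>n\<close>, since the search of
    \<open>Mu\<close> inspects only numbers below the stage.\<close>
  show ?case
  proof (intro exI[of _ "Suc (s1 + s2 + n)"] allI impI)
    fix s assume s: "Suc (s1 + s2 + n) \<le> s"
    have "stage_eval f s (j # xs) \<noteq> 1" if "j < n" for j
      using s2[of s j] s that by simp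
    then have "card {i. i < s \<and> (\<forall>j<Suc i. \<not> stage_eval f s (j # xs) = 1)} = n"
      using s1[of s] s by (intro bounded_search_eq) auto
    moreover have "\<exists>n<s. stage_eval f s (n # xs) = 1 \<and> (\<forall>i<n. 1 < stage_eval f s (i # xs))"
      using s1[of s] s2[of s] s by (intro exI[of _ n]) auto
    ultimately show "stage_eval (Mu f) s xs = Suc n" unfolding stage_eval.simps by (simp only: if_True)
  qed
qed auto

lemma computes_iff_stage: "computes r xs y \<longleftrightarrow> (\<exists>s. stage_eval r s xs = Suc y)"
  using stage_eval_sound stage_eval_complete by blast


section \<open>Semidecidable predicates and their closure properties\<close>

lemma computable_tail: "total_computable k f \<Longrightarrow> total_computable (Suc k) (\<lambda>ys. f (tl ys))"
  by (erule computable_subst) (rule list_computable_tl[OF list_computable_id])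

text \<open>A Sigma-1 normal form with the stage at the head of the list. Closure properties then
  reduce to decidability of bounded quantifiers; \<open>semidecidable_ce\<close> and
  \<open>ce_semidecidable\<close> connect it with \<open>ce\<close>.\<close>

definition semidecidable :: "nat \<Rightarrow> (nat list \<Rightarrow> bool) \<Rightarrow> bool" where
  "semidecidable k P \<longleftrightarrow> (\<exists>Q. decidable (Suc k) (\<lambda>ys. Q (hd ys) (tl ys)) \<and>
     (\<forall>xs. length xs = k \<longrightarrow> P xs = (\<exists>s. Q s xs)))"

lemma semidecidableI:
  assumes "decidable (Suc k) (\<lambda>ys. Q (hd ys) (tl ys))"
    and "\<And>xs. length xs = k \<Longrightarrow> P xs \<longleftrightarrow> (\<exists>s. Q s xs)"
  shows "semidecidable k P"
  using assms unfolding semidecidable_def by blast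

lemma ex_common_bound:
  fixes A B :: "nat \<Rightarrow> bool"
  assumes "A s" "B t"
  shows "\<exists>b. (\<exists>s<b. A s) \<and> (\<exists>t<b. B t)"
proof (intro exI conjI)
  show "s < Suc (s + t)" "t < Suc (s + t)" by auto
qed (fact assms)+

lemma decidable_tail: "decidable k P \<Longrightarrow> decidable (Suc k) (\<lambda>ys. P (tl ys))"
  by (erule decidable_subst) (rule list_computable_tl[OF list_computable_id])

lemma semidecidable_decidable: "decidable k P \<Longrightarrow> semidecidable k P"
  by (rule semidecidableI[OF decidable_tail]) auto

lemma semidecidable_subst:
  assumes "semidecidable m P" and F: "list_computable k m F"
  shows "semidecidable k (\<lambda>xs. P (F xs))"
proof -
  obtain Q where Q: "decidable (Suc m) (\<lambda>ys. Q (hd ys) (tl ys))"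
    "\<And>xs. length xs = m \<Longrightarrow> P xs \<longleftrightarrow> (\<exists>s. Q s xs)" using assms(1) unfolding semidecidable_def by blast
  have "list_computable (Suc k) m (\<lambda>ys. F (tl ys))"
    using F by (auto simp: list_computable_def intro: computable_tail)
  then have "list_computable (Suc k) (Suc m) (\<lambda>ys. hd ys # F (tl ys))"
    by (intro list_intros computable_hd) auto
  from decidable_subst[OF Q(1) this] show ?thesis
    using F by (intro semidecidableI[of k "\<lambda>s xs. Q s (F xs)"]) (auto simp: Q(2) list_computable_def)
qed

lemma semidecidable_app1:
  assumes "semidecidable 1 (\<lambda>xs. P (xs ! 0))" "total_computable k f"
  shows "semidecidable k (\<lambda>xs. P (f xs))"
  using semidecidable_subst[OF assms(1), of k "\<lambda>xs. [f xs]"] assms(2)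
  by (simp add: list_computable_Cons list_computable_Nil)

lemma semidecidable_app2:
  assumes "semidecidable 2 (\<lambda>xs. P (xs ! 0) (xs ! 1))" "total_computable k f" "total_computable k g"
  shows "semidecidable k (\<lambda>xs. P (f xs) (g xs))"
  using semidecidable_subst[OF assms(1), of k "\<lambda>xs. [f xs, g xs]"] assms(2,3)
  by (simp add: list_computable_Cons list_computable_Nil numeral_2_eq_2)

lemma decidable_snd_tail:
  assumes "decidable (Suc k) (\<lambda>ys. Q (hd ys) (tl ys))"
  shows "decidable (Suc (Suc k)) (\<lambda>ys. Q (hd ys) (tl (tl ys)))"
  using decidable_subst[OF assms, of "Suc (Suc k)" "\<lambda>ys. hd ys # tl (tl ys)"]
  by (simp add: list_intros computable_hd)

text \<open>One bound on both the witness and the stage merges the two unbounded quantifiers,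
  without coding pairs.\<close>

lemma semidecidable_ex:
  assumes "semidecidable (Suc k) (\<lambda>ys. P (hd ys) (tl ys))"
  shows "semidecidable k (\<lambda>xs. \<exists>y. P y xs)"
proof -
  obtain Q where Q: "decidable (Suc (Suc k)) (\<lambda>ys. Q (hd ys) (tl ys))"
    "\<And>ys. length ys = Suc k \<Longrightarrow> P (hd ys) (tl ys) \<longleftrightarrow> (\<exists>s. Q s ys)"
    using assms unfolding semidecidable_def by blast
  have "list_computable (Suc (Suc (Suc k))) (Suc (Suc k)) (\<lambda>zs. hd zs # hd (tl zs) # tl (tl (tl zs)))"
    by (intro list_intros computable_hd computable_hd_tl
        list_computable_tl[OF list_computable_tl[OF list_computable_tl[OF list_computable_id]]]) auto
  from decidable_subst[OF Q(1) this]
  have "decidable (Suc k) (\<lambda>ys. \<exists>y<hd ys. \<exists>s<hd ys. Q s (y # tl ys))"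
    by (intro decidable_bex computable_hd computable_hd_tl) simp_all
  moreover have "(\<exists>y. P y xs) \<longleftrightarrow> (\<exists>b. \<exists>y<b. \<exists>s<b. Q s (y # xs))" if "length xs = k" for xs
  proof
    assume "\<exists>y. P y xs"
    then obtain y where "P y xs" by blast
    with Q(2)[of "y # xs"] that have "\<exists>s. Q s (y # xs)" by simp
    then obtain s where "Q s (y # xs)" ..
    then show "\<exists>b. \<exists>y<b. \<exists>s<b. Q s (y # xs)"
      by (intro exI[of _ "Suc (y + s)"] exI[of _ y] conjI exI[of _ s]) auto
  next
    assume "\<exists>b. \<exists>y<b. \<exists>s<b. Q s (y # xs)"
    then show "\<exists>y. P y xs" using Q(2)[of "y # xs" for y] that by auto
  qed
  ultimately show ?thesis by (intro semidecidableI[of k "\<lambda>b xs. \<exists>y<b. \<exists>s<b. Q s (y # xs)"])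
qed

lemma semidecidable_conj:
  assumes "semidecidable k P" "semidecidable k P'"
  shows "semidecidable k (\<lambda>xs. P xs \<and> P' xs)"
proof -
  obtain Q where Q: "decidable (Suc k) (\<lambda>ys. Q (hd ys) (tl ys))"
    "\<And>xs. length xs = k \<Longrightarrow> P xs \<longleftrightarrow> (\<exists>s. Q s xs)" using assms(1) unfolding semidecidable_def by blast
  obtain Q' where Q': "decidable (Suc k) (\<lambda>ys. Q' (hd ys) (tl ys))"
    "\<And>xs. length xs = k \<Longrightarrow> P' xs \<longleftrightarrow> (\<exists>s. Q' s xs)" using assms(2) unfolding semidecidable_def by blast
  have "decidable (Suc k) (\<lambda>ys. (\<exists>s<hd ys. Q s (tl ys)) \<and> (\<exists>s<hd ys. Q' s (tl ys)))"
    by (intro decidable_conj decidable_bex decidable_snd_tail Q(1) Q'(1) computable_hd) auto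
  moreover have "P xs \<and> P' xs \<longleftrightarrow> (\<exists>b. (\<exists>s<b. Q s xs) \<and> (\<exists>s<b. Q' s xs))" if "length xs = k" for xs
    using Q(2)[OF that] Q'(2)[OF that] ex_common_bound[of "\<lambda>s. Q s xs" _ "\<lambda>s. Q' s xs"] by blast
  ultimately show ?thesis
    by (intro semidecidableI[of k "\<lambda>b xs. (\<exists>s<b. Q s xs) \<and> (\<exists>s<b. Q' s xs)"])
qed

lemma semidecidable_disj:
  assumes "semidecidable k P" "semidecidable k P'"
  shows "semidecidable k (\<lambda>xs. P xs \<or> P' xs)"
proof -
  obtain Q where Q: "decidable (Suc k) (\<lambda>ys. Q (hd ys) (tl ys))"
    "\<And>xs. length xs = k \<Longrightarrow> P xs \<longleftrightarrow> (\<exists>s. Q s xs)" using assms(1) unfolding semidecidable_def by blast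
  obtain Q' where Q': "decidable (Suc k) (\<lambda>ys. Q' (hd ys) (tl ys))"
    "\<And>xs. length xs = k \<Longrightarrow> P' xs \<longleftrightarrow> (\<exists>s. Q' s xs)" using assms(2) unfolding semidecidable_def by blast
  show ?thesis
    by (intro semidecidableI[of k "\<lambda>s xs. Q s xs \<or> Q' s xs"] decidable_disj Q(1) Q'(1)) (auto simp: Q(2) Q'(2))
qed

text \<open>Bounded collection: the stages needed for the finitely many \<open>y\<close> have a
  common bound, which can be moved in front of the quantifier.\<close>

lemma semidecidable_ball:
  assumes "semidecidable (Suc k) (\<lambda>ys. P (hd ys) (tl ys))" and h: "total_computable k h"
  shows "semidecidable k (\<lambda>xs. \<forall>y<h xs. P y xs)"
proof -
  obtain Q where Q: "decidable (Suc (Suc k)) (\<lambda>ys. Q (hd ys) (tl ys))"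
    "\<And>ys. length ys = Suc k \<Longrightarrow> P (hd ys) (tl ys) \<longleftrightarrow> (\<exists>s. Q s ys)"
    using assms(1) unfolding semidecidable_def by blast
  have "list_computable (Suc (Suc (Suc k))) (Suc (Suc k)) (\<lambda>zs. hd zs # hd (tl zs) # tl (tl (tl zs)))"
    by (intro list_intros computable_hd computable_hd_tl
        list_computable_tl[OF list_computable_tl[OF list_computable_tl[OF list_computable_id]]]) auto
  from decidable_subst[OF Q(1) this]
  have "decidable (Suc k) (\<lambda>ys. \<forall>y<h (tl ys). \<exists>s<hd ys. Q s (y # tl ys))"
    by (intro decidable_bex decidable_ball computable_tail h computable_hd_tl) simp_all
  moreover have "(\<forall>y<h xs. P y xs) \<longleftrightarrow> (\<exists>b. \<forall>y<h xs. \<exists>s<b. Q s (y # xs))" if "length xs = k" for xs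
  proof
    assume "\<forall>y<h xs. P y xs"
    then have "\<exists>s. Q s (y # xs)" if "y < h xs" for y
      using Q(2)[of "y # xs"] \<open>length xs = k\<close> that by simp
    then have "\<exists>b. \<forall>c\<ge>b. \<forall>y<h xs. \<exists>s<c. Q s (y # xs)"
      by (intro bounded_uniform) (meson less_Suc_eq_le order_less_le_trans)
    then show "\<exists>b. \<forall>y<h xs. \<exists>s<b. Q s (y # xs)" by blast
  next
    assume "\<exists>b. \<forall>y<h xs. \<exists>s<b. Q s (y # xs)"
    then show "\<forall>y<h xs. P y xs" using Q(2)[of "y # xs" for y] that by auto
  qed
  ultimately show ?thesis by (intro semidecidableI[of k "\<lambda>b xs. \<forall>y<h xs. \<exists>s<b. Q s (y # xs)"])
qed

section \<open>Unbounded search, computable choice and c.e. sets\<close>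

lemma computes_Mu:
  assumes r: "\<And>y. computes r (y # xs) (if P y then 0 else 1)"
  shows "computes (Mu r) xs n \<longleftrightarrow> P n \<and> (\<forall>i<n. \<not> P i)"
proof
  assume "computes (Mu r) xs n"
  then have n: "computes r (n # xs) 0" and i: "\<And>i. i < n \<Longrightarrow> \<exists>y>0. computes r (i # xs) y"
    by (auto elim: computes.cases)
  have "P n" using computes_deterministic[OF n r] by (auto split: if_splits)
  moreover have "\<not> P i" if "i < n" for i
    using i[OF that] computes_deterministic[OF _ r[of i]] by fastforce
  ultimately show "P n \<and> (\<forall>i<n. \<not> P i)" by blast
next
  assume n: "P n \<and> (\<forall>i<n. \<not> P i)"
  show "computes (Mu r) xs n"
    by (rule computes.Mu) (use n r[of n] in simp, use n r in \<open>metis zero_less_one\<close>)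
qed

lemma decidable_Mu:
  assumes "decidable (Suc k) (\<lambda>ys. P (hd ys) (tl ys))"
  obtains r where "\<And>xs n. length xs = k \<Longrightarrow> computes (Mu r) xs n \<longleftrightarrow> P n xs \<and> (\<forall>i<n. \<not> P i xs)"
proof -
  \<comment> \<open>\<open>Mu\<close> looks for a zero, so the search runs on the characteristic
    function of the negation.\<close>
  obtain r where r: "\<And>ys. length ys = Suc k \<Longrightarrow> computes r ys (if \<not> P (hd ys) (tl ys) then 1 else 0)"
    using decidable_not[OF assms] unfolding decidable_def by blast
  have "computes (Mu r) xs n \<longleftrightarrow> P n xs \<and> (\<forall>i<n. \<not> P i xs)" if "length xs = k" for xs n
  proof (rule computes_Mu)
    show "computes r (y # xs) (if P y xs then 0 else 1)" for y
      using r[of "y # xs"] that by (cases "P y xs") simp_all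
  qed
  then show ?thesis by (rule that)
qed

lemma computable_Least:
  assumes "decidable (Suc k) (\<lambda>ys. P (hd ys) (tl ys))" "\<And>xs. length xs = k \<Longrightarrow> \<exists>y. P y xs"
  shows "total_computable k (\<lambda>xs. LEAST y. P y xs)"
proof -
  obtain r where r: "\<And>xs n. length xs = k \<Longrightarrow> computes (Mu r) xs n \<longleftrightarrow> P n xs \<and> (\<forall>i<n. \<not> P i xs)"
    using decidable_Mu[OF assms(1)] by blast
  have "computes (Mu r) xs (LEAST y. P y xs)" if "length xs = k" for xs
    using r[OF that] LeastI_ex[OF assms(2)[OF that]] not_less_Least by blast
  then show ?thesis unfolding total_computable_def by blast
qed

text \<open>The witness is found by bounding both the value and the stage with one search variable.\<close>
lemma semidecidable_choice:
  assumes "semidecidable 2 (\<lambda>xs. P (xs ! 0) (xs ! 1))" "\<And>n. \<exists>y. P n y"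
  shows "\<exists>g. total_computable 1 (\<lambda>xs. g (xs ! 0)) \<and> (\<forall>n. P n (g n))"
proof -
  obtain Q where Q: "decidable (Suc 2) (\<lambda>ys. Q (hd ys) (tl ys))"
    "\<And>xs. length xs = 2 \<Longrightarrow> P (xs ! 0) (xs ! 1) \<longleftrightarrow> (\<exists>s. Q s xs)"
    using assms(1) unfolding semidecidable_def by blast
  have P: "P n y \<longleftrightarrow> (\<exists>s. Q s [n, y])" for n y using Q(2)[of "[n, y]"] by simp
  have l: "list_computable (Suc (Suc (Suc 1))) (Suc (Suc (Suc 0))) (\<lambda>zs. [hd zs, tl (tl (tl zs)) ! 0, hd (tl zs)])"
    by (intro list_intros computable_hd computable_hd_tl list_computable_nth[OF
        list_computable_tl[OF list_computable_tl[OF list_computable_tl[OF list_computable_id]]]]) auto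
  have d: "decidable (Suc 1) (\<lambda>ys. \<exists>y<hd ys. \<exists>s<hd ys. Q s [tl ys ! 0, y])"
    using decidable_subst[OF Q(1)[unfolded numeral_2_eq_2] l]
    by (intro decidable_bex computable_hd_tl computable_hd) auto
  define b where "b = (\<lambda>n. LEAST b. \<exists>y<b. \<exists>s<b. Q s [n, y])"
  have ex: "\<exists>b. \<exists>y<b. \<exists>s<b. Q s [n, y]" for n
  proof -
    obtain y s where "Q s [n, y]" using assms(2)[of n] unfolding P by blast
    then show ?thesis by (intro exI[of _ "Suc (y + s)"] exI[of _ y] conjI exI[of _ s]) auto
  qed
  have b: "total_computable 1 (\<lambda>xs. b (xs ! 0))"
    unfolding b_def by (rule computable_Least[OF d ex])
  \<comment> \<open>Once \<open>b n\<close> bounds the stage, the value itself is found by a second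
    search, which terminates.\<close>
  define g where "g = (\<lambda>n. LEAST y. \<exists>s<b n. Q s [n, y])"
  have bn: "\<exists>y. \<exists>s<b n. Q s [n, y]" for n
    using LeastI_ex[OF ex[of n]] unfolding b_def by blast
  have l: "list_computable (Suc (Suc 1)) (Suc (Suc (Suc 0))) (\<lambda>zs. [hd zs, tl (tl zs) ! 0, hd (tl zs)])"
    by (intro list_intros computable_hd computable_hd_tl list_computable_nth[OF
        list_computable_tl[OF list_computable_tl[OF list_computable_id]]]) auto
  have d: "decidable (Suc 1) (\<lambda>ys. \<exists>s<b (tl ys ! 0). Q s [tl ys ! 0, hd ys])"
    using decidable_subst[OF Q(1)[unfolded numeral_2_eq_2] l]
    by (intro decidable_bex computable_app1[OF b] computable_tl_nth) auto
  have "total_computable 1 (\<lambda>xs. g (xs ! 0))"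
    unfolding g_def by (rule computable_Least[OF d bn])
  moreover have "P n (g n)" for n
    using LeastI_ex[OF bn[of n]] unfolding g_def P by blast
  ultimately show ?thesis by blast
qed


lemma semidecidable_graph:
  assumes "partial_computable \<phi>"
  shows "semidecidable 2 (\<lambda>xs. \<phi> (xs ! 0) = Some (xs ! 1))"
proof -
  obtain r where r: "\<And>x y. \<phi> x = Some y \<longleftrightarrow> computes r [x] y"
    using assms unfolding partial_computable_def by blast
  have "list_computable (Suc 2) (Suc (Suc 0)) (\<lambda>ys. [hd ys, tl ys ! 0])"
    by (intro list_intros computable_hd computable_tl_nth) auto
  from computable_subst[OF computable_stage_eval this]
  have "decidable (Suc 2) (\<lambda>ys. stage_eval r (hd ys) [tl ys ! 0] = Suc (tl ys ! 1))"
    by (intro decidable_eq computable_Suc computable_tl_nth) auto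
  then show ?thesis
    by (rule semidecidableI) (simp add: r computes_iff_stage)
qed

lemma semidecidable_ce:
  assumes "ce W" shows "semidecidable 1 (\<lambda>xs. xs ! 0 \<in> W)"
proof -
  obtain \<phi> where \<phi>: "partial_computable \<phi>" "W = dom \<phi>" using assms unfolding ce_def by blast
  have "list_computable (Suc 1) (Suc (Suc 0)) (\<lambda>ys. [tl ys ! 0, hd ys])"
    by (intro list_intros computable_hd computable_tl_nth) auto
  from semidecidable_subst[OF semidecidable_graph[OF \<phi>(1), unfolded numeral_2_eq_2] this]
  have "semidecidable 1 (\<lambda>xs. \<exists>y. \<phi> (xs ! 0) = Some y)"
    by (intro semidecidable_ex) simp
  then show ?thesis by (simp add: \<phi>(2) domIff)
qed

lemma ce_semidecidable:
  assumes "semidecidable 1 (\<lambda>xs. P (xs ! 0))" shows "ce {n. P n}"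
proof -
  obtain Q where Q: "decidable (Suc 1) (\<lambda>ys. Q (hd ys) (tl ys))"
    "\<And>xs. length xs = 1 \<Longrightarrow> P (xs ! 0) \<longleftrightarrow> (\<exists>s. Q s xs)"
    using assms(1) unfolding semidecidable_def by blast
  have P: "P n \<longleftrightarrow> (\<exists>s. Q s [n])" for n using Q(2)[of "[n]"] by simp
  obtain r where r: "\<And>xs n. length xs = 1 \<Longrightarrow> computes (Mu r) xs n \<longleftrightarrow> Q n xs \<and> (\<forall>i<n. \<not> Q i xs)"
    using decidable_Mu[OF Q(1)] by blast
  define \<phi> where "\<phi> n = (if P n then Some (LEAST s. Q s [n]) else None)" for n
  have "\<phi> n = Some y \<longleftrightarrow> computes (Mu r) [n] y" for n y
  proof -
    have "(\<exists>s. Q s [n]) \<and> (LEAST s. Q s [n]) = y \<longleftrightarrow> Q y [n] \<and> (\<forall>i<y. \<not> Q i [n])"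
      by (metis LeastI_ex not_less_Least linorder_neqE_nat)
    then have "\<phi> n = Some y \<longleftrightarrow> Q y [n] \<and> (\<forall>i<y. \<not> Q i [n])" by (auto simp: \<phi>_def P)
    then show ?thesis using r[of "[n]" y] by simp
  qed
  then have "partial_computable \<phi>" unfolding partial_computable_def by blast
  moreover have "{n. P n} = dom \<phi>" by (auto simp: \<phi>_def split: if_splits)
  ultimately show ?thesis unfolding ce_def by blast
qed

lemma partial_computable_total:
  assumes "total_computable 1 (\<lambda>xs. g (xs ! 0))"
  shows "partial_computable (\<lambda>n. Some (g n))"
proof -
  obtain r where "\<And>xs. length xs = 1 \<Longrightarrow> computes r xs (g (xs ! 0))"
    using assms unfolding total_computable_def by blast
  from this[of "[n]" for n] have "computes r [n] (g n)" for n by simp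
  then have "Some (g n) = Some y \<longleftrightarrow> computes r [n] y" for n y
    using computes_deterministic by blast
  then show ?thesis unfolding partial_computable_def by blast
qed

instance recf :: countable
  by countable_datatype

text \<open>Cantor's theorem for orders of germs requires countability of the set of
  representatives. It holds because a description determines its function.\<close>

lemma countable_total_computable: "countable {g. total_computable 1 (\<lambda>xs. g (xs ! 0))}"
proof -
  have "{g. total_computable 1 (\<lambda>xs. g (xs ! 0))} \<subseteq> range (\<lambda>r n. THE y. computes r [n] y)"
  proof
    fix g :: "nat \<Rightarrow> nat" assume "g \<in> {g. total_computable 1 (\<lambda>xs. g (xs ! 0))}"
    then obtain r where r: "\<And>xs. length xs = 1 \<Longrightarrow> computes r xs (g (xs ! 0))"
      unfolding total_computable_def by blast
    from r[of "[n]" for n] have "computes r [n] (g n)" for n by simp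
    then have "g = (\<lambda>n. THE y. computes r [n] y)"
      by (intro ext) (metis computes_deterministic the_equality)
    then show "g \<in> range (\<lambda>r n. THE y. computes r [n] y)" by blast
  qed
  then show ?thesis by (rule countable_subset) simp
qed

section \<open>Division and pairing\<close>

lemma computable_div:
  assumes "total_computable k f" "total_computable k g"
  shows "total_computable k (\<lambda>xs. f xs div g xs)"
proof -
  \<comment> \<open>The quotient counts the positive multiples of \<open>b\<close> up to
    \<open>a\<close>. For \<open>b = 0\<close> every \<open>i\<close> would be counted, so that case
    is split off with the HOL value 0.\<close>
  have "card {i. i < a \<and> Suc i * b \<le> a} = a div b" if "b \<noteq> 0" for a b :: nat
  proof -
    have "{i. i < a \<and> Suc i * b \<le> a} = {..<a div b}"
      using that by (auto simp: less_eq_div_iff_mult_less_eq[symmetric] Suc_le_eq simp del: mult_Suc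
          dest: less_le_trans[OF _ div_le_dividend])
    then show ?thesis by simp
  qed
  then have "(if b = 0 then 0 else card {i. i < a \<and> Suc i * b \<le> a}) = a div b" for a b :: nat by simp
  moreover have "total_computable k (\<lambda>xs. if g xs = 0 then 0 else card {i. i < f xs \<and> Suc i * g xs \<le> f xs})"
    by (intro computable_if decidable_eq computable_const computable_count decidable_le computable_mult
        computable_Suc computable_hd computable_tail assms) simp
  ultimately show ?thesis by simp
qed

lemma computable_pair:
  assumes "total_computable k f" "total_computable k g"
  shows "total_computable k (\<lambda>xs. prod_encode (f xs, g xs))"
  unfolding prod_encode_def triangle_def prod.case
  by (intro computable_add computable_div computable_mult computable_Suc computable_const assms)

definition pfst :: "nat \<Rightarrow> nat" where "pfst w = fst (prod_decode w)"
definition psnd :: "nat \<Rightarrow> nat" where "psnd w = snd (prod_decode w)"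

lemma pfst_encode [simp]: "pfst (prod_encode (a, b)) = a"
  and psnd_encode [simp]: "psnd (prod_encode (a, b)) = b"
  and prod_encode_pfst_psnd [simp]: "prod_encode (pfst w, psnd w) = w"
  by (simp_all add: pfst_def psnd_def)

lemma pair_eq_iff: "prod_encode (a, b) = w \<longleftrightarrow> a = pfst w \<and> b = psnd w"
  by auto

lemma computable_pfst:
  assumes "total_computable k f" shows "total_computable k (\<lambda>xs. pfst (f xs))"
proof -
  have d: "decidable (Suc 1) (\<lambda>ys. \<exists>b<Suc (tl ys ! 0). prod_encode (hd ys, b) = tl ys ! 0)"
    by (intro decidable_bex decidable_eq computable_pair computable_Suc computable_hd computable_hd_tl
        computable_tl_nth computable_tl_tl_nth) auto
  have "psnd w < Suc w" for w
    using le_prod_encode_2[of "psnd w" "pfst w"] by simp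
  then have e: "(\<exists>b<Suc w. prod_encode (a, b) = w) \<longleftrightarrow> a = pfst w" for a w by (auto simp: pair_eq_iff)
  have "total_computable 1 (\<lambda>xs. LEAST a. \<exists>b<Suc (xs ! 0). prod_encode (a, b) = xs ! 0)"
    by (rule computable_Least[OF d]) (simp add: e)
  then have "total_computable 1 (\<lambda>xs. pfst (xs ! 0))" by (simp add: e Least_equality)
  then show ?thesis using assms by (rule computable_app1)
qed

lemma computable_psnd:
  assumes "total_computable k f" shows "total_computable k (\<lambda>xs. psnd (f xs))"
proof -
  have d: "decidable (Suc 1) (\<lambda>ys. prod_encode (pfst (tl ys ! 0), hd ys) = tl ys ! 0)"
    by (intro decidable_eq computable_pair computable_pfst computable_hd
        computable_tl_nth) auto
  have "total_computable 1 (\<lambda>xs. LEAST b. prod_encode (pfst (xs ! 0), b) = xs ! 0)"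
    by (rule computable_Least[OF d]) (auto simp: pair_eq_iff)
  then have "total_computable 1 (\<lambda>xs. psnd (xs ! 0))" by (simp add: pair_eq_iff Least_equality)
  then show ?thesis using assms by (rule computable_app1)
qed

section \<open>Dense colored orders\<close>

text \<open>The third clause makes incomparability an equivalence relation. Total functions can
  therefore be ordered directly, as representatives of their germs, without forming a
  quotient.\<close>

definition strict_weak_on :: "'a set \<Rightarrow> ('a \<Rightarrow> 'a \<Rightarrow> bool) \<Rightarrow> bool" where
  "strict_weak_on A lt \<longleftrightarrow> (\<forall>a\<in>A. \<not> lt a a) \<and>
     (\<forall>a\<in>A. \<forall>b\<in>A. \<forall>c\<in>A. lt a b \<longrightarrow> lt b c \<longrightarrow> lt a c) \<and>
     (\<forall>a\<in>A. \<forall>b\<in>A. \<forall>c\<in>A. lt a c \<longrightarrow> lt a b \<or> lt b c)"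

lemma strict_weak_on_irrefl: "strict_weak_on A lt \<Longrightarrow> a \<in> A \<Longrightarrow> \<not> lt a a"
  and strict_weak_on_trans:
    "strict_weak_on A lt \<Longrightarrow> lt a b \<Longrightarrow> lt b c \<Longrightarrow> a \<in> A \<Longrightarrow> b \<in> A \<Longrightarrow> c \<in> A \<Longrightarrow> lt a c"
  and strict_weak_on_cotrans:
    "strict_weak_on A lt \<Longrightarrow> lt a c \<Longrightarrow> a \<in> A \<Longrightarrow> b \<in> A \<Longrightarrow> c \<in> A \<Longrightarrow> lt a b \<or> lt b c"
  unfolding strict_weak_on_def by blast+

lemma strict_weak_on_subset: "strict_weak_on A lt \<Longrightarrow> B \<subseteq> A \<Longrightarrow> strict_weak_on B lt"
  unfolding strict_weak_on_def by blast

lemma strict_weak_on_flip: "strict_weak_on A lt \<Longrightarrow> strict_weak_on A (\<lambda>x y. lt y x)"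
  unfolding strict_weak_on_def by blast

lemma strict_weak_on_maximal:
  assumes "finite L" "L \<noteq> {}" "L \<subseteq> A" "strict_weak_on A lt"
  shows "\<exists>m\<in>L. \<forall>l\<in>L. \<not> lt m l"
  using assms(1-3)
proof (induction rule: finite_ne_induct)
  case (singleton x)
  then show ?case using strict_weak_on_irrefl[OF assms(4)] by blast
next
  case (insert x F)
  then obtain m where m: "m \<in> F" "\<forall>l\<in>F. \<not> lt m l" by blast
  have A: "x \<in> A" "m \<in> A" "F \<subseteq> A" using insert m by auto
  show ?case
  proof (cases "lt m x")
    case True
    have "\<not> lt x l" if "l \<in> insert x F" for l
      using that strict_weak_on_irrefl[OF assms(4), of x] A m True
        strict_weak_on_trans[OF assms(4) True, of l] by blast
    then show ?thesis by blast
  next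
    case False
    then show ?thesis using m by blast
  qed
qed

text \<open>Elements that are incomparable under \<open>lt\<close> represent the same point of the order.\<close>
locale dense_colored =
  fixes S :: "'c set" and A :: "'a set" and lt :: "'a \<Rightarrow> 'a \<Rightarrow> bool" and col :: "'a \<Rightarrow> 'c"
  assumes countable: "countable A"
    and nonempty: "A \<noteq> {}"
    and weak: "strict_weak_on A lt"
    and col: "a \<in> A \<Longrightarrow> col a \<in> S"
    and col_cong: "a \<in> A \<Longrightarrow> b \<in> A \<Longrightarrow> \<not> lt a b \<Longrightarrow> \<not> lt b a \<Longrightarrow> col a = col b"
    and above: "s \<in> S \<Longrightarrow> a \<in> A \<Longrightarrow> \<exists>x\<in>A. lt a x \<and> col x = s"
    and below: "s \<in> S \<Longrightarrow> a \<in> A \<Longrightarrow> \<exists>x\<in>A. lt x a \<and> col x = s"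
    and middle: "s \<in> S \<Longrightarrow> a \<in> A \<Longrightarrow> b \<in> A \<Longrightarrow> lt a b \<Longrightarrow> \<exists>x\<in>A. lt a x \<and> lt x b \<and> col x = s"

text \<open>Density is applied only to a maximal element of \<open>L\<close> and a minimal element
  of \<open>H\<close>; cotransitivity carries the inequalities over to the other elements. If one of
  the sets is empty, the absence of endpoints takes the place of density.\<close>

lemma dense_colored_between:
  assumes D: "dense_colored S A lt col" and s: "s \<in> S"
    and L: "finite L" "L \<subseteq> A" and H: "finite H" "H \<subseteq> A" and LH: "\<And>l h. l \<in> L \<Longrightarrow> h \<in> H \<Longrightarrow> lt l h"
  shows "\<exists>x\<in>A. col x = s \<and> (\<forall>l\<in>L. lt l x) \<and> (\<forall>h\<in>H. lt x h)"
proof -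
  have w: "strict_weak_on A lt" using dense_colored.weak[OF D] .
  have up: "\<forall>l\<in>L. lt l x" if "m \<in> L" "\<forall>l\<in>L. \<not> lt m l" "lt m x" "x \<in> A" for m x
    using strict_weak_on_cotrans[OF w that(3)] that L(2) by blast
  have dn: "\<forall>h\<in>H. lt x h" if "m \<in> H" "\<forall>h\<in>H. \<not> lt h m" "lt x m" "x \<in> A" for m x
    using strict_weak_on_cotrans[OF w that(3)] that H(2) by blast
  have M: "\<exists>m\<in>L. \<forall>l\<in>L. \<not> lt m l" if "L \<noteq> {}"
    using strict_weak_on_maximal[OF L(1) that L(2) w] .
  have N: "\<exists>m\<in>H. \<forall>h\<in>H. \<not> lt h m" if "H \<noteq> {}"
    using strict_weak_on_maximal[OF H(1) that H(2) strict_weak_on_flip[OF w]] .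
  consider "L = {}" "H = {}" | "L = {}" "H \<noteq> {}" | "L \<noteq> {}" "H = {}" | "L \<noteq> {}" "H \<noteq> {}" by blast
  then show ?thesis
  proof cases
    case 1
    obtain a where "a \<in> A" using dense_colored.nonempty[OF D] by blast
    then obtain x where "x \<in> A" "col x = s" using dense_colored.above[OF D s] by blast
    then show ?thesis using 1 by blast
  next
    case 2
    then obtain m where m: "m \<in> H" "\<forall>h\<in>H. \<not> lt h m" using N by blast
    then obtain x where "x \<in> A" "lt x m" "col x = s" using dense_colored.below[OF D s, of m] H(2) by blast
    then show ?thesis using 2 dn m by blast
  next
    case 3
    then obtain m where m: "m \<in> L" "\<forall>h\<in>L. \<not> lt m h" using M by blast
    then obtain x where "x \<in> A" "lt m x" "col x = s" using dense_colored.above[OF D s, of m] L(2) by blast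
    then show ?thesis using 3 up m by blast
  next
    case 4
    then obtain m where m: "m \<in> L" "\<forall>h\<in>L. \<not> lt m h" using M by blast
    obtain n where n: "n \<in> H" "\<forall>h\<in>H. \<not> lt h n" using N 4 by blast
    have "lt m n" using LH m n by blast
    then obtain x where "x \<in> A" "lt m x" "lt x n" "col x = s"
      using dense_colored.middle[OF D s, of m n] L(2) H(2) m n by blast
    then show ?thesis using up[OF m] dn[OF n] by blast
  qed
qed

text \<open>A relation instead of an injection, because several incomparable elements on one side
  may share a partner on the other.\<close>

definition partial_iso ::
    "'a set \<Rightarrow> ('a \<Rightarrow> 'a \<Rightarrow> bool) \<Rightarrow> ('a \<Rightarrow> 'c) \<Rightarrow> 'b set \<Rightarrow> ('b \<Rightarrow> 'b \<Rightarrow> bool) \<Rightarrow> ('b \<Rightarrow> 'c) \<Rightarrow> ('a \<times> 'b) set \<Rightarrow> bool"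
  where
  "partial_iso A lt col B lt' col' p \<longleftrightarrow> finite p \<and> p \<subseteq> A \<times> B \<and>
     (\<forall>(a, b)\<in>p. \<forall>(a', b')\<in>p. lt a a' \<longleftrightarrow> lt' b b') \<and> (\<forall>(a, b)\<in>p. col a = col' b)"

lemma converse_insert: "(insert (a, b) p)\<inverse> = insert (b, a) (p\<inverse>)"
  by auto

lemma partial_iso_converse:
  "partial_iso A lt col B lt' col' p \<Longrightarrow> partial_iso B lt' col' A lt col (p\<inverse>)"
  unfolding partial_iso_def by fastforce

text \<open>The forth step. If \<open>a\<close> is incomparable with an element that has a partner,
  it inherits that partner. Otherwise the partners of the elements below \<open>a\<close> all lie
  below the partners of those above \<open>a\<close>, and a point of the right color exists in
  between.\<close>

lemma partial_iso_extend:
  assumes A: "dense_colored S A lt col" and B: "dense_colored S B lt' col'"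
    and p: "partial_iso A lt col B lt' col' p" and a: "a \<in> A"
  shows "\<exists>b. partial_iso A lt col B lt' col' (insert (a, b) p)"
proof -
  have wA: "strict_weak_on A lt" and wB: "strict_weak_on B lt'"
    using dense_colored.weak[OF A] dense_colored.weak[OF B] .
  have fin: "finite p" and sub: "\<And>x y. (x, y) \<in> p \<Longrightarrow> x \<in> A \<and> y \<in> B"
    and ord: "\<And>x y x' y'. (x, y) \<in> p \<Longrightarrow> (x', y') \<in> p \<Longrightarrow> lt x x' \<longleftrightarrow> lt' y y'"
    and col: "\<And>x y. (x, y) \<in> p \<Longrightarrow> col x = col' y"
    using p unfolding partial_iso_def by blast+
  have key: "partial_iso A lt col B lt' col' (insert (a, b) p)"
    if b: "b \<in> B" "col a = col' b" and
      ab: "\<And>x y. (x, y) \<in> p \<Longrightarrow> (lt a x \<longleftrightarrow> lt' b y) \<and> (lt x a \<longleftrightarrow> lt' y b)" for b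
    using fin sub ord col that a strict_weak_on_irrefl[OF wA a] strict_weak_on_irrefl[OF wB b(1)]
    unfolding partial_iso_def by auto
  show ?thesis
  proof (cases "\<exists>x y. (x, y) \<in> p \<and> \<not> lt a x \<and> \<not> lt x a")
    case True
    then obtain x y where xy: "(x, y) \<in> p" "\<not> lt a x" "\<not> lt x a" by blast
    have "(lt a x' \<longleftrightarrow> lt x x') \<and> (lt x' a \<longleftrightarrow> lt x' x)" if "x' \<in> A" for x'
      using xy sub[OF xy(1)] a that strict_weak_on_cotrans[OF wA] by meson
    moreover have "col a = col x" using dense_colored.col_cong[OF A a _ xy(2,3)] sub[OF xy(1)] by blast
    ultimately show ?thesis
      using key[of y] xy(1) sub ord col by metis
  next
    case False
    define L where "L = snd ` {q \<in> p. lt (fst q) a}"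
    define H where "H = snd ` {q \<in> p. lt a (fst q)}"
    have "\<exists>b\<in>B. col' b = col a \<and> (\<forall>l\<in>L. lt' l b) \<and> (\<forall>h\<in>H. lt' b h)"
    proof (rule dense_colored_between[OF B])
      show "col a \<in> S" using dense_colored.col[OF A a] .
      show "finite L" "finite H" using fin by (auto simp: L_def H_def)
      show "L \<subseteq> B" "H \<subseteq> B" using sub by (auto simp: L_def H_def)
      show "lt' l h" if "l \<in> L" "h \<in> H" for l h
      proof -
        obtain x z where "(x, l) \<in> p" "lt x a" "(z, h) \<in> p" "lt a z"
          using \<open>l \<in> L\<close> \<open>h \<in> H\<close> by (auto simp: L_def H_def)
        then show ?thesis using ord sub a strict_weak_on_trans[OF wA] by metis
      qed
    qed
    then obtain b where b: "b \<in> B" "col' b = col a" "\<And>l. l \<in> L \<Longrightarrow> lt' l b" "\<And>h. h \<in> H \<Longrightarrow> lt' b h" by blast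
    have "(lt a x \<longleftrightarrow> lt' b y) \<and> (lt x a \<longleftrightarrow> lt' y b)" if xy: "(x, y) \<in> p" for x y
    proof -
      have "\<not> (lt a x \<and> lt x a)"
        using strict_weak_on_trans[OF wA] strict_weak_on_irrefl[OF wA] a sub[OF xy] by blast
      moreover have "\<not> (lt' b y \<and> lt' y b)"
        using strict_weak_on_trans[OF wB] strict_weak_on_irrefl[OF wB] b(1) sub[OF xy] by blast
      moreover have "lt a x \<or> lt x a" using False xy by blast
      moreover have "lt a x \<Longrightarrow> lt' b y" using b(4)[of y] xy by (force simp: H_def)
      moreover have "lt x a \<Longrightarrow> lt' y b" using b(3)[of y] xy by (force simp: L_def)
      ultimately show ?thesis by blast
    qed
    then show ?thesis using key[of b] b(1,2) by auto
  qed
qed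

lemma dense_colored_iso:
  assumes A: "dense_colored S A lt col" and B: "dense_colored S B lt' col'"
  obtains P where "P \<subseteq> A \<times> B" "Domain P = A" "Range P = B"
    "\<And>a b a' b'. (a, b) \<in> P \<Longrightarrow> (a', b') \<in> P \<Longrightarrow> lt a a' \<longleftrightarrow> lt' b b'"
    "\<And>a b. (a, b) \<in> P \<Longrightarrow> col a = col' b"
proof -
  let ?I = "partial_iso A lt col B lt' col'"
  have neA: "A \<noteq> {}" and neB: "B \<noteq> {}" and cA: "countable A" and cB: "countable B"
    using dense_colored.countable[OF A] dense_colored.nonempty[OF A]
      dense_colored.countable[OF B] dense_colored.nonempty[OF B] by blast+
  have "\<exists>f. \<forall>n. ?I (f n) \<and> (f n \<subseteq> f (Suc n) \<and> from_nat_into A n \<in> Domain (f (Suc n)) \<and>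
      from_nat_into B n \<in> Range (f (Suc n)))"
  proof (rule dependent_nat_choice)
    show "\<exists>p. ?I p" by (rule exI[of _ "{}"]) (simp add: partial_iso_def)
    fix p n assume p: "?I p"
    obtain b where b: "?I (insert (from_nat_into A n, b) p)"
      using partial_iso_extend[OF A B p from_nat_into[OF neA]] by blast
    \<comment> \<open>The back step is the forth step for the converse relation.\<close>
    obtain a where "partial_iso B lt' col' A lt col (insert (from_nat_into B n, a) ((insert (from_nat_into A n, b) p)\<inverse>))"
      using partial_iso_extend[OF B A partial_iso_converse[OF b] from_nat_into[OF neB]] by blast
    from partial_iso_converse[OF this]
    have "?I (insert (a, from_nat_into B n) (insert (from_nat_into A n, b) p))"
      by (simp add: converse_insert)
    then show "\<exists>q. ?I q \<and> p \<subseteq> q \<and> from_nat_into A n \<in> Domain q \<and> from_nat_into B n \<in> Range q"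
      by blast
  qed
  then obtain f where f: "\<And>n. ?I (f n)" "\<And>n. f n \<subseteq> f (Suc n)"
      "\<And>n. from_nat_into A n \<in> Domain (f (Suc n))" "\<And>n. from_nat_into B n \<in> Range (f (Suc n))"
    by blast
  have mono: "f m \<subseteq> f n" if "m \<le> n" for m n using lift_Suc_mono_le[of f, OF f(2) that] .
  define P where "P = (\<Union>n. f n)"
  have common: "\<exists>n. u \<in> f n \<and> v \<in> f n" if "u \<in> P" "v \<in> P" for u v
  proof -
    obtain m n where "u \<in> f m" "v \<in> f n" using \<open>u \<in> P\<close> \<open>v \<in> P\<close> unfolding P_def by blast
    then have "u \<in> f (max m n)" "v \<in> f (max m n)"
      using mono[of m "max m n"] mono[of n "max m n"] by auto
    then show ?thesis by blast
  qed
  show thesis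
  proof (rule that[of P])
    show sub: "P \<subseteq> A \<times> B" 
    proof -
      have "f n \<subseteq> A \<times> B" for n using f(1)[of n] unfolding partial_iso_def by blast
      then show ?thesis unfolding P_def by blast
    qed
    show "Domain P = A"
    proof
      show "A \<subseteq> Domain P"
      proof
        fix a assume "a \<in> A"
        then obtain n where "from_nat_into A n = a" using from_nat_into_surj[OF cA] by blast
        then show "a \<in> Domain P" using f(3)[of n] unfolding P_def by blast
      qed
    qed (use sub in blast)
    show "Range P = B"
    proof
      show "B \<subseteq> Range P"
      proof
        fix a assume "a \<in> B"
        then obtain n where "from_nat_into B n = a" using from_nat_into_surj[OF cB] by blast
        then show "a \<in> Range P" using f(4)[of n] unfolding P_def by blast
      qed
    qed (use sub in blast)
    show "lt a a' \<longleftrightarrow> lt' b b'" if ab: "(a, b) \<in> P" "(a', b') \<in> P" for a b a' b'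
    proof -
      obtain n where "(a, b) \<in> f n" "(a', b') \<in> f n" using common[OF ab] by blast
      then show ?thesis using f(1)[of n] unfolding partial_iso_def by blast
    qed
    show "col a = col' b" if ab: "(a, b) \<in> P" for a b
    proof -
      obtain n where "(a, b) \<in> f n" using ab unfolding P_def by blast
      then show ?thesis using f(1)[of n] unfolding partial_iso_def by blast
    qed
  qed
qed

lemma dense_coloring_dense_colored:
  assumes c: "dense_coloring S c"
  shows "dense_colored S (UNIV :: rat set) (<) c"
proof -
  have b: "\<exists>q. a < q \<and> q < b \<and> c q = s" if "s \<in> S" "a < b" for s a b
    using c that unfolding dense_coloring_def by blast
  show ?thesis
  proof
    show "strict_weak_on UNIV ((<) :: rat \<Rightarrow> rat \<Rightarrow> bool)" unfolding strict_weak_on_def by auto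
    show "c a \<in> S" for a using c unfolding dense_coloring_def by blast
    fix s a assume s: "s \<in> S"
    show "\<exists>x\<in>UNIV. a < x \<and> c x = s" using b[OF s, of a "a + 1"] by auto
    show "\<exists>x\<in>UNIV. x < a \<and> c x = s" using b[OF s, of "a - 1" a] by auto
  qed (use b in auto)
qed

text \<open>On the rationals incomparability is equality, so the back-and-forth relation is the
  graph of a function on \<open>A\<close>. That function is onto and identifies exactly the
  incomparable elements.\<close>

lemma colored_Cantor:
  fixes c :: "rat \<Rightarrow> 'c"
  assumes A: "dense_colored S A lt col" and c: "dense_coloring S c"
  shows "\<exists>F. F ` A = UNIV \<and> (\<forall>a\<in>A. \<forall>b\<in>A. F a < F b \<longleftrightarrow> lt a b) \<and> (\<forall>a\<in>A. c (F a) = col a)"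
proof -
  obtain P where P: "P \<subseteq> A \<times> UNIV" "Domain P = A" "Range P = UNIV"
    "\<And>a b a' b'. (a, b) \<in> P \<Longrightarrow> (a', b') \<in> P \<Longrightarrow> lt a a' \<longleftrightarrow> b < b'"
    "\<And>a b. (a, b) \<in> P \<Longrightarrow> col a = c b"
    using dense_colored_iso[OF A dense_coloring_dense_colored[OF c]] by blast
  have uniq: "b = b'" if "(a, b) \<in> P" "(a, b') \<in> P" for a b b'
    using P(4)[OF that] P(4)[OF that(2,1)] A that P(1)
      strict_weak_on_irrefl[OF dense_colored.weak[OF A], of a] by fastforce
  define F where "F a = (SOME b. (a, b) \<in> P)" for a
  have F: "(a, F a) \<in> P" if "a \<in> A" for a
    using that P(2) unfolding F_def by (metis DomainE someI)
  show ?thesis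
  proof (intro exI[of _ F] conjI ballI)
    have "b \<in> F ` A" for b
    proof -
      obtain a where a: "(a, b) \<in> P" using P(3) by blast
      then have "a \<in> A" using P(1) by blast
      with uniq[OF a F] show ?thesis by blast
    qed
    then show "F ` A = UNIV" by blast
    show "F a < F b \<longleftrightarrow> lt a b" if "a \<in> A" "b \<in> A" for a b using P(4) F that by blast
    show "c (F a) = col a" if "a \<in> A" for a using P(5) F that by metis
  qed
qed

text \<open>Incomparable elements are again identified.\<close>
definition presents :: "'a set \<Rightarrow> ('a \<Rightarrow> 'a \<Rightarrow> bool) \<Rightarrow> 'b ord \<Rightarrow> ('a \<Rightarrow> 'b) \<Rightarrow> bool" where
  "presents A lt T F \<longleftrightarrow> F ` A = fst T \<and>
     (\<forall>a\<in>A. \<forall>b\<in>A. (F a, F b) \<in> snd T \<longleftrightarrow> lt a b) \<and>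
     (\<forall>a\<in>A. \<forall>b\<in>A. F a = F b \<longleftrightarrow> \<not> lt a b \<and> \<not> lt b a)"

section \<open>Relations of sums of orders, and recognition of the order-type \<omega>\<close>

lemma fst_ord_plus [simp]: "fst (A \<oplus> B) = fst A <+> fst B"
  by (simp add: ord_plus_def split: prod.splits)

lemma ord_plus_rel [simp]:
  "(Inl x, Inl y) \<in> snd (A \<oplus> B) \<longleftrightarrow> (x, y) \<in> snd A"
  "(Inr u, Inr v) \<in> snd (A \<oplus> B) \<longleftrightarrow> (u, v) \<in> snd B"
  "(Inl x, Inr v) \<in> snd (A \<oplus> B) \<longleftrightarrow> x \<in> fst A \<and> v \<in> fst B"
  "(Inr u, Inl y) \<notin> snd (A \<oplus> B)"
  by (auto simp: ord_plus_def split: prod.splits)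

lemma fst_rat_sum: "fst (rat_sum F) = (SIGMA q:UNIV. fst (F q))"
  by (simp add: rat_sum_def Let_def)

lemma rat_sum_rel:
  "((p, x), (q, y)) \<in> snd (rat_sum F) \<longleftrightarrow> x \<in> fst (F p) \<and> y \<in> fst (F q) \<and>
     (p < q \<or> p = q \<and> (x, y) \<in> snd (F q))"
  by (simp add: rat_sum_def Let_def)

lemma presents_omega:
  assumes w: "strict_weak_on S lt" and tot: "\<And>a b. a \<in> S \<Longrightarrow> b \<in> S \<Longrightarrow> \<not> lt a b \<Longrightarrow> \<not> lt b a \<Longrightarrow> a = b"
    and fin: "\<And>a. a \<in> S \<Longrightarrow> finite {b \<in> S. lt b a}" and inf: "infinite S"
  shows "presents S lt omega (\<lambda>a. card {b \<in> S. lt b a})"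
proof -
  let ?r = "\<lambda>a. card {b \<in> S. lt b a}"
  have mono: "?r a < ?r b" if "a \<in> S" "b \<in> S" "lt a b" for a b
  proof (rule psubset_card_mono[OF fin[OF that(2)]])
    show "{x \<in> S. lt x a} \<subset> {x \<in> S. lt x b}"
      using that strict_weak_on_trans[OF w _ that(3)] strict_weak_on_irrefl[OF w that(1)] by blast
  qed
  then have iff: "?r a < ?r b \<longleftrightarrow> lt a b" if "a \<in> S" "b \<in> S" for a b
  proof (cases "lt a b")
    case True
    then show ?thesis using mono[OF that] by blast
  next
    case False
    then have "a = b \<or> lt b a" using tot[OF that] by blast
    then have "?r b \<le> ?r a" using mono[OF that(2,1)] by auto
    then show ?thesis using False by simp
  qed
  have eq: "?r a = ?r b \<longleftrightarrow> \<not> lt a b \<and> \<not> lt b a" if "a \<in> S" "b \<in> S" for a b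
    using iff[OF that] iff[OF that(2,1)] by linarith
  have inj: "inj_on ?r S"
    by (rule inj_onI) (use eq tot in blast)
  \<comment> \<open>The predecessors of \<open>a\<close> have pairwise distinct ranks below the rank
    of \<open>a\<close>, and their number is that rank, so they exhaust all smaller ranks. The set
    of ranks is thus downward closed, and being infinite it is everything.\<close>
  have down: "m \<in> ?r ` S" if "n \<in> ?r ` S" "m < n" for m n
  proof -
    obtain a where a: "a \<in> S" "n = ?r a" using \<open>n \<in> ?r ` S\<close> by blast
    have "?r ` {b \<in> S. lt b a} \<subseteq> {..<n}" using mono a by auto
    moreover have "card (?r ` {b \<in> S. lt b a}) = n"
      using card_image[OF inj_on_subset[OF inj], of "{b \<in> S. lt b a}"] a by auto
    ultimately have "?r ` {b \<in> S. lt b a} = {..<n}" by (intro card_subset_eq) auto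
    then show ?thesis using \<open>m < n\<close> by blast
  qed
  have "m \<in> ?r ` S" for m
  proof -
    have "infinite (?r ` S)" using inf inj by (simp add: finite_image_iff)
    then obtain n where "n \<in> ?r ` S" "m < n" by (meson infinite_nat_iff_unbounded)
    then show ?thesis by (rule down)
  qed
  then have "?r ` S = UNIV" by blast
  with iff eq show ?thesis unfolding presents_def omega_def by simp
qed

section \<open>Cohesive sets with c.e. complement\<close>

abbreviation recursive :: "(nat \<Rightarrow> nat) \<Rightarrow> bool" where
  "recursive g \<equiv> total_computable 1 (\<lambda>xs. g (xs ! 0))"

locale co_ce_cohesive =
  fixes C :: "nat set"
  assumes co_ce: "co_ce C" and cohesive: "cohesive C"
begin

lemma infinite_C: "infinite C"
  using cohesive by (simp add: cohesive_def)

text \<open>Almost everywhere on \<open>C\<close>, as a filter. By \<open>dichotomy\<close> below it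
  behaves like an ultrafilter on semidecidable predicates.\<close>

definition at_C :: "nat filter" where
  "at_C = inf cofinite (principal C)"

lemma eventually_at_C: "eventually P at_C \<longleftrightarrow> finite {n \<in> C. \<not> P n}"
  by (simp add: at_C_def eventually_inf_principal eventually_cofinite) 

lemma at_C_neq_bot [simp]: "at_C \<noteq> bot"
  using infinite_C eventually_at_C[of "\<lambda>_. False"] by (auto simp: trivial_limit_def)

lemma almost_subset_iff: "C \<subseteq>\<^sup>* A \<longleftrightarrow> eventually (\<lambda>n. n \<in> A) at_C"
proof -
  have "C - A = {n \<in> C. n \<notin> A}" by blast
  then show ?thesis by (simp add: almost_subset_def eventually_at_C)
qed

lemma eventually_at_C_ge: "eventually (\<lambda>n. m \<le> n) at_C"
proof -
  have "{n \<in> C. \<not> m \<le> n} \<subseteq> {..<m}" by auto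
  then show ?thesis unfolding eventually_at_C using finite_subset by blast
qed

lemma eventually_at_C_in: "eventually (\<lambda>n. n \<in> C) at_C"
  unfolding eventually_at_C by simp

lemma eventually_at_C_bound:
  assumes "eventually P at_C"
  obtains N where "\<And>n. n \<in> C \<Longrightarrow> N \<le> n \<Longrightarrow> P n"
proof -
  have "finite {n \<in> C. \<not> P n}" using assms by (simp add: eventually_at_C)
  then obtain N where "\<forall>n\<in>{n \<in> C. \<not> P n}. n < N" using finite_nat_set_iff_bounded by blast
  then show ?thesis using that[of N] by force
qed

lemma dichotomy:
  assumes "semidecidable 1 (\<lambda>xs. P (xs ! 0))"
  shows "eventually P at_C \<or> eventually (\<lambda>n. \<not> P n) at_C"
proof -
  have "finite (C - {n. P n}) \<or> finite (C \<inter> {n. P n})"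
    using cohesive ce_semidecidable[OF assms] unfolding cohesive_def by blast
  moreover have "C - {n. P n} = {n \<in> C. \<not> P n}" "C \<inter> {n. P n} = {n \<in> C. \<not> \<not> P n}" by auto
  ultimately show ?thesis by (simp add: eventually_at_C)
qed

lemma not_eventually_iff:
  assumes "semidecidable 1 (\<lambda>xs. P (xs ! 0))"
  shows "\<not> eventually P at_C \<longleftrightarrow> eventually (\<lambda>n. \<not> P n) at_C"
  using dichotomy[OF assms] eventually_conj[of P at_C "\<lambda>n. \<not> P n"] by auto

lemma semidecidable_not_C: "semidecidable 1 (\<lambda>xs. xs ! 0 \<notin> C)"
  using semidecidable_ce[OF co_ce[unfolded co_ce_def]] by simp

text \<open>A search along \<open>C\<close> becomes total by allowing the default \<open>w\<close>
  below a threshold and off \<open>C\<close>, where the second event can be recognised because the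
  complement of \<open>C\<close> is c.e. The last conjunct gives control over the values everywhere,
  not only on \<open>C\<close>.\<close>

lemma recursive_choice:
  assumes R: "semidecidable 2 (\<lambda>xs. R (xs ! 0) (xs ! 1))" and ev: "eventually (\<lambda>n. \<exists>y. R n y) at_C"
  shows "\<exists>g. recursive g \<and> eventually (\<lambda>n. R n (g n)) at_C \<and> (\<forall>n. R n (g n) \<or> g n = w)"
proof -
  obtain N where N: "\<And>n. n \<in> C \<Longrightarrow> N \<le> n \<Longrightarrow> \<exists>y. R n y"
    using eventually_at_C_bound[OF ev] by blast
  have "semidecidable 2 (\<lambda>xs. R (xs ! 0) (xs ! 1) \<or> xs ! 1 = w \<and> (xs ! 0 < N \<or> xs ! 0 \<notin> C))"
    by (intro semidecidable_disj R semidecidable_conj semidecidable_decidable[OF decidable_eq]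
        semidecidable_decidable[OF decidable_less] semidecidable_app1[OF semidecidable_not_C]
        computable_nth computable_const) auto
  moreover have "\<exists>y. R n y \<or> y = w \<and> (n < N \<or> n \<notin> C)" for n
    using N[of n] leI[of n N] by blast
  ultimately obtain g where g: "recursive g" "\<And>n. R n (g n) \<or> g n = w \<and> (n < N \<or> n \<notin> C)"
    using semidecidable_choice[of "\<lambda>n y. R n y \<or> y = w \<and> (n < N \<or> n \<notin> C)"] by blast
  have "eventually (\<lambda>n. R n (g n)) at_C"
    using eventually_at_C_ge[of N] eventually_at_C_in
  proof eventually_elim
    case (elim n)
    then show ?case using g(2)[of n] by auto
  qed
  then show ?thesis using g by blast
qed

section \<open>The counting function of \<open>C\<close>\<close>

definition count :: "nat \<Rightarrow> nat" where
  "count n = card (C \<inter> {..<n})"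

lemma count_mono: "m \<le> n \<Longrightarrow> count m \<le> count n"
  unfolding count_def by (rule card_mono) auto

text \<open>The number of elements below \<open>n\<close> not yet enumerated outside
  \<open>C\<close> approximates \<open>count n\<close> from above, and it is exact from some stage
  on. So upper bounds on \<open>count\<close> can be confirmed.\<close>

lemma semidecidable_count: "semidecidable 2 (\<lambda>xs. count (xs ! 0) \<le> xs ! 1)"
proof -
  obtain Q where Q: "decidable (Suc 1) (\<lambda>ys. Q (hd ys) (tl ys))"
    "\<And>xs. length xs = 1 \<Longrightarrow> xs ! 0 \<notin> C \<longleftrightarrow> (\<exists>s. Q s xs)"
    using semidecidable_not_C unfolding semidecidable_def by blast
  have nC: "y \<notin> C \<longleftrightarrow> (\<exists>s. Q s [y])" for y using Q(2)[of "[y]"] by simp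
  have l: "list_computable (Suc (Suc (Suc 2))) (Suc (Suc 0)) (\<lambda>zs. [hd zs, hd (tl zs)])"
    by (intro list_intros computable_hd computable_hd_tl) auto
  have dec: "decidable (Suc 2) (\<lambda>ys. card {y. y < tl ys ! 0 \<and> \<not> (\<exists>t<hd ys. Q t [y])} \<le> tl ys ! 1)"
    using decidable_subst[OF Q(1)[unfolded One_nat_def] l]
    by (intro decidable_le computable_count decidable_not decidable_bex computable_hd_tl computable_tl_nth) auto
  show ?thesis
  proof (rule semidecidableI[OF dec])
    fix xs :: "nat list"
    show "count (xs ! 0) \<le> xs ! 1 \<longleftrightarrow> (\<exists>s. card {y. y < xs ! 0 \<and> \<not> (\<exists>t<s. Q t [y])} \<le> xs ! 1)"
    proof
      assume c: "count (xs ! 0) \<le> xs ! 1"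
      have "\<exists>s0. \<forall>s\<ge>s0. \<forall>y<xs ! 0. y \<in> C \<or> (\<exists>t<s. Q t [y])"
      proof (rule bounded_uniform)
        fix y
        show "\<exists>s0. \<forall>s\<ge>s0. y \<in> C \<or> (\<exists>t<s. Q t [y])"
        proof (cases "y \<in> C")
          case False
          then obtain t where "Q t [y]" using nC by blast
          then show ?thesis by (intro exI[of _ "Suc t"]) (auto simp: Suc_le_eq)
        qed simp
      qed
      then obtain s where s: "\<And>y. y < xs ! 0 \<Longrightarrow> y \<in> C \<or> (\<exists>t<s. Q t [y])" by blast
      have "card {y. y < xs ! 0 \<and> \<not> (\<exists>t<s. Q t [y])} \<le> count (xs ! 0)"
        unfolding count_def by (rule card_mono) (use s in auto)
      then show "\<exists>s. card {y. y < xs ! 0 \<and> \<not> (\<exists>t<s. Q t [y])} \<le> xs ! 1" using c by (meson le_trans)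
    next
      assume "\<exists>s. card {y. y < xs ! 0 \<and> \<not> (\<exists>t<s. Q t [y])} \<le> xs ! 1"
      then obtain s where s: "card {y. y < xs ! 0 \<and> \<not> (\<exists>t<s. Q t [y])} \<le> xs ! 1" by blast
      have "count (xs ! 0) \<le> card {y. y < xs ! 0 \<and> \<not> (\<exists>t<s. Q t [y])}"
        unfolding count_def by (rule card_mono) (use nC in auto)
      then show "count (xs ! 0) \<le> xs ! 1" using s by simp
    qed
  qed
qed

text \<open>\<open>V n\<close> says that no earlier element of \<open>C\<close> has the same value
  as \<open>n\<close>, which is a c.e. condition. The first occurrence in \<open>C\<close> of each
  value satisfies it, and there are infinitely many of these because each value is taken only
  finitely often. Cohesiveness then gives \<open>V\<close> almost everywhere.\<close>

lemma eventually_injective: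
  assumes f: "recursive f" and fin: "\<And>d. eventually (\<lambda>n. f n \<noteq> d) at_C"
  shows "\<exists>N. inj_on f (C \<inter> {N..})"
proof -
  define V where "V n \<longleftrightarrow> (\<forall>m<n. f m = f n \<longrightarrow> m \<notin> C)" for n
  have fin': "finite {n \<in> C. f n = d}" for d using fin[of d] by (simp add: eventually_at_C)
  have "semidecidable 1 (\<lambda>xs. \<forall>m<xs ! 0. f m \<noteq> f (xs ! 0) \<or> m \<notin> C)"
    by (intro semidecidable_ball semidecidable_disj semidecidable_decidable[OF decidable_not]
        decidable_eq semidecidable_app1[OF semidecidable_not_C] computable_app1[OF f] computable_hd
        computable_nth computable_tl_nth) auto
  then have "semidecidable 1 (\<lambda>xs. V (xs ! 0))" unfolding V_def imp_conv_disj .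
  moreover have "\<not> eventually (\<lambda>n. \<not> V n) at_C"
  proof
    assume "eventually (\<lambda>n. \<not> V n) at_C"
    then obtain N where N: "\<And>n. n \<in> C \<Longrightarrow> N \<le> n \<Longrightarrow> \<not> V n" using eventually_at_C_bound by blast
    \<comment> \<open>The values taken below \<open>N\<close> account for finitely many elements of
      \<open>C\<close>. Some \<open>c\<close> in \<open>C\<close> therefore has a new value, and the
      first element of \<open>C\<close> with that value is at least \<open>N\<close>.\<close>
    have "finite (\<Union>d\<in>f ` {..<N}. {n \<in> C. f n = d})" using fin' by blast
    then have "\<not> C \<subseteq> (\<Union>d\<in>f ` {..<N}. {n \<in> C. f n = d})" using infinite_C finite_subset by metis
    then obtain c where c: "c \<in> C" "c \<notin> (\<Union>d\<in>f ` {..<N}. {n \<in> C. f n = d})" by (meson subsetI)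
    define m where "m = (LEAST m. m \<in> C \<and> f m = f c)"
    have m: "m \<in> C" "f m = f c" using LeastI[of "\<lambda>m. m \<in> C \<and> f m = f c" c] c(1) by (simp_all add: m_def)
    have "k \<notin> C" if "k < m" "f k = f m" for k
      using not_less_Least[of k "\<lambda>m. m \<in> C \<and> f m = f c"] that m(2) unfolding m_def[symmetric] by auto
    then have "V m" unfolding V_def by blast
    moreover have "N \<le> m"
    proof (rule ccontr)
      assume "\<not> N \<le> m"
      then have "m \<in> {..<N}" by simp
      then show False using c m(2) by (metis (mono_tags, lifting) UN_I image_eqI mem_Collect_eq)
    qed
    ultimately show False using N m by blast
  qed
  ultimately have "eventually V at_C" using dichotomy by blast
  then obtain N where N: "\<And>n. n \<in> C \<Longrightarrow> N \<le> n \<Longrightarrow> V n" using eventually_at_C_bound by blast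
  have "inj_on f (C \<inter> {N..})"
  proof (rule linorder_inj_onI)
    fix x y assume "x < y" "x \<in> C \<inter> {N..}" "y \<in> C \<inter> {N..}"
    then show "f x \<noteq> f y" using N[of y] unfolding V_def by auto
  qed auto
  then show ?thesis ..
qed

text \<open>
  Otherwise \<open>f\<close> would map the elements of \<open>C\<close> below \<open>n\<close>, up to finitely many,
  injectively into half as many values.
\<close>
lemma count_le_double:
  assumes f: "recursive f" and fin: "\<And>d. eventually (\<lambda>n. f n \<noteq> d) at_C"
  shows "eventually (\<lambda>n. count n \<le> 2 * f n) at_C"
proof (rule ccontr)
  assume "\<not> eventually (\<lambda>n. count n \<le> 2 * f n) at_C"
  moreover have "semidecidable 1 (\<lambda>xs. count (xs ! 0) \<le> 2 * f (xs ! 0))"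
    by (intro semidecidable_app2[OF semidecidable_count] computable_mult computable_const
        computable_app1[OF f] computable_nth) auto
  ultimately have "eventually (\<lambda>n. \<not> count n \<le> 2 * f n) at_C"
    using dichotomy[of "\<lambda>n. count n \<le> 2 * f n"] by blast
  then obtain N1 where "\<And>n. n \<in> C \<Longrightarrow> N1 \<le> n \<Longrightarrow> \<not> count n \<le> 2 * f n"
    using eventually_at_C_bound by blast
  then have N1: "\<And>n. n \<in> C \<Longrightarrow> N1 \<le> n \<Longrightarrow> 2 * f n < count n" by (simp add: not_le)
  obtain N2 where "inj_on f (C \<inter> {N2..})" using eventually_injective[OF assms] by blast
  define N where "N = max N1 N2"
  have inj: "inj_on f (C \<inter> {N..})" using \<open>inj_on f (C \<inter> {N2..})\<close>
    by (rule inj_on_subset) (auto simp: N_def)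
  \<comment> \<open>The two estimates give
    \<open>count n \<le> count N + (count n + 1) div 2\<close>, so \<open>count\<close> would be
    bounded although \<open>C\<close> is infinite.\<close>
  have bound: "count n \<le> 2 * count N + 1" for n
  proof -
    have "f ` (C \<inter> {N..<n}) \<subseteq> {..<(count n + 1) div 2}"
    proof
      fix y assume "y \<in> f ` (C \<inter> {N..<n})"
      then obtain x where x: "x \<in> C" "N \<le> x" "x < n" "y = f x" by auto
      then have "2 * f x < count x" using N1 by (simp add: N_def)
      then show "y \<in> {..<(count n + 1) div 2}" using count_mono[of x n] x by auto
    qed
    then have "card (C \<inter> {N..<n}) \<le> (count n + 1) div 2"
    proof -
      have "inj_on f (C \<inter> {N..<n})" by (rule inj_on_subset[OF inj]) auto
      from card_inj_on_le[OF this \<open>f ` (C \<inter> {N..<n}) \<subseteq> _\<close>] show ?thesis by simp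
    qed
    moreover have "count n \<le> count N + card (C \<inter> {N..<n})"
    proof -
      have "C \<inter> {..<n} \<subseteq> C \<inter> {..<N} \<union> C \<inter> {N..<n}" by auto
      then have "count n \<le> card (C \<inter> {..<N} \<union> C \<inter> {N..<n})" unfolding count_def by (intro card_mono) auto
      also have "\<dots> \<le> count N + card (C \<inter> {N..<n})" unfolding count_def by (rule card_Un_le)
      finally show ?thesis .
    qed
    ultimately show ?thesis by linarith
  qed
  obtain B where B: "finite B" "card B = 2 * count N + 2" "B \<subseteq> C"
    using infinite_arbitrarily_large[OF infinite_C] by blast
  then obtain n where "B \<subseteq> {..<n}" using finite_nat_iff_bounded by blast
  then have "card B \<le> count n" unfolding count_def using B by (intro card_mono) auto
  then show False using bound[of n] B by simp
qed

text \<open>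
  If elements of \<open>C\<close> had successors in \<open>C\<close> below \<open>f\<close>, then \<open>C\<close> would meet all the intervals
  between consecutive iterates of an increasing bound of \<open>f\<close>, and the union of every other
  interval would split \<open>C\<close>.
\<close>
lemma count_recursive:
  assumes f: "recursive f"
  shows "eventually (\<lambda>n. count (f n) \<le> Suc (count n)) at_C"
proof -
  define U where "U n \<longleftrightarrow> (\<forall>m<f n. m \<le> n \<or> m \<notin> C)" for n
  have semi: "semidecidable 1 (\<lambda>xs. U (xs ! 0))" unfolding U_def
    by (intro semidecidable_ball semidecidable_disj semidecidable_decidable[OF decidable_le]
        semidecidable_app1[OF semidecidable_not_C] computable_app1[OF f] computable_hd
        computable_nth computable_tl_nth) auto
  have "\<not> eventually (\<lambda>n. \<not> U n) at_C"
  proof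
    assume "eventually (\<lambda>n. \<not> U n) at_C"
    then obtain N where "\<And>n. n \<in> C \<Longrightarrow> N \<le> n \<Longrightarrow> \<not> U n" using eventually_at_C_bound by blast
    then have N: "\<exists>m\<in>C. n < m \<and> m < f n" if "n \<in> C" "N \<le> n" for n
      using that unfolding U_def by (meson not_le)
    \<comment> \<open>The sum over all arguments up to \<open>x\<close> makes \<open>f' x\<close>
      exceed \<open>f m\<close> for every \<open>m \<le> x\<close>; the term \<open>x\<close> makes
      the iterates strictly increasing.\<close>
    define f' where "f' x = Suc (x + (\<Sum>m<Suc x. f m))" for x
    have f'_inc: "x < f' x" for x by (simp add: f'_def)
    have f': "f m < f' x" if "m \<le> x" for m x
      using member_le_sum[of m "{..<Suc x}" f] that by (auto simp: f'_def)
    define a where "a = rec_nat N (\<lambda>m v. f' v)"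
    have a_Suc: "a (Suc k) = f' (a k)" for k by (simp add: a_def)
    have a: "strict_mono a" by (simp add: strict_mono_Suc_iff a_Suc f'_inc)
    obtain c where c: "c \<in> C" "N \<le> c" using infinite_C by (meson infinite_nat_iff_unbounded_le)
    \<comment> \<open>The last element of \<open>C\<close> in the interval from \<open>N\<close> up
      to \<open>a k\<close> has a later element of \<open>C\<close> below its
      \<open>f\<close>-value, which is less than \<open>a (Suc k)\<close>. The condition
      \<open>c < k\<close> ensures through \<open>k \<le> a k\<close> that there is such a last
      element.\<close>
    have hit: "\<exists>m\<in>C. a k \<le> m \<and> m < a (Suc k)" if k: "c < k" for k
    proof -
      have "c < a k" using strict_mono_imp_increasing[OF a, of k] k by simp
      define B where "B = {x \<in> C. N \<le> x \<and> x < a k}"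
      have "finite B" "c \<in> B" using c \<open>c < a k\<close> by (auto simp: B_def)
      then have max: "Max B \<in> B" "\<And>x. x \<in> B \<Longrightarrow> x \<le> Max B" using Max_in by auto
      then obtain m where m: "m \<in> C" "Max B < m" "m < f (Max B)" using N by (auto simp: B_def)
      have "m \<notin> B" using max(2)[of m] m by auto
      then have "a k \<le> m" using m max(1) by (auto simp: B_def)
      moreover have "m < a (Suc k)" using m max(1) f'[of "Max B" "a k"] by (simp add: a_Suc B_def)
      ultimately show ?thesis using m by blast
    qed
    \<comment> \<open>The union of the intervals of even index, written with bounded quantifiers so
      that it is decidable. By \<open>hit\<close>, both it and its complement contain arbitrarily
      large elements of \<open>C\<close>.\<close>
    define P where "P n \<longleftrightarrow> (\<exists>k<Suc n. (\<exists>j<Suc k. k = 2 * j) \<and> a k \<le> n \<and> n < a (Suc k))" for n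
    have P: "P n \<longleftrightarrow> even k" if "a k \<le> n" "n < a (Suc k)" for n k
    proof -
      have *: "k' = k" if "a k' \<le> n" "n < a (Suc k')" for k'
        using that \<open>a k \<le> n\<close> \<open>n < a (Suc k)\<close> strict_mono_less[OF a, of k' "Suc k"] strict_mono_less[OF a, of k "Suc k'"]
        by linarith
      have "k < Suc n" using strict_mono_imp_increasing[OF a, of k] that by simp
      then show ?thesis using that * unfolding P_def even_iff_mod_2_eq_zero
        by (metis dvd_def even_iff_mod_2_eq_zero less_Suc_eq_le le_add2 mult_2)
    qed
    have f'_comp: "total_computable k (\<lambda>xs. f' (h xs))" if "total_computable k h" for k h
      unfolding f'_def
      by (intro computable_Suc computable_add computable_sum computable_app1[OF f] that computable_hd) simp
    then have "recursive a" unfolding a_def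
      by (intro computable_rec computable_const computable_nth f'_comp computable_hd_tl) auto
    then have "decidable 1 (\<lambda>xs. P (xs ! 0))" unfolding P_def
      by (intro decidable_bex decidable_conj decidable_eq decidable_le decidable_less computable_mult
          computable_Suc computable_app1[OF \<open>recursive a\<close>] computable_const computable_hd computable_hd_tl
          computable_nth computable_tl_nth) auto
    then have "eventually P at_C \<or> eventually (\<lambda>n. \<not> P n) at_C"
      by (intro dichotomy semidecidable_decidable)
    then show False
    proof
      assume "eventually P at_C"
      then obtain K where K: "\<And>n. n \<in> C \<Longrightarrow> K \<le> n \<Longrightarrow> P n" using eventually_at_C_bound by blast
      obtain m where m: "m \<in> C" "a (2 * (c + K) + 1) \<le> m" "m < a (Suc (2 * (c + K) + 1))"
        using hit[of "2 * (c + K) + 1"] by auto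
      then show False using P[OF m(2,3)] K[of m] strict_mono_imp_increasing[OF a, of "2 * (c + K) + 1"] by simp
    next
      assume "eventually (\<lambda>n. \<not> P n) at_C"
      then obtain K where K: "\<And>n. n \<in> C \<Longrightarrow> K \<le> n \<Longrightarrow> \<not> P n" using eventually_at_C_bound by blast
      obtain m where m: "m \<in> C" "a (2 * (c + K) + 2) \<le> m" "m < a (Suc (2 * (c + K) + 2))"
        using hit[of "2 * (c + K) + 2"] by auto
      then show False using P[OF m(2,3)] K[of m] strict_mono_imp_increasing[OF a, of "2 * (c + K) + 2"] by simp
    qed
  qed
  then have "eventually U at_C" using dichotomy[OF semi] by blast
  then show ?thesis
  proof (rule eventually_mono)
    fix n assume "U n"
    then have "C \<inter> {..<f n} \<subseteq> insert n (C \<inter> {..<n})" unfolding U_def by (auto simp: le_less)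
    then have "count (f n) \<le> card (insert n (C \<inter> {..<n}))" unfolding count_def by (intro card_mono) auto
    also have "\<dots> \<le> Suc (count n)" unfolding count_def by (rule card_insert_le_m1) auto
    finally show "count (f n) \<le> Suc (count n)" .
  qed
qed


subsection \<open>Cohesive powers as orders of germs\<close>

text \<open>Total functions suffice as representatives by \<open>recursive_choice\<close>. Only
  almost all of their values on \<open>C\<close> have to lie in \<open>S\<close>, so the condition
  does not depend on the representative.\<close>

definition germs :: "(nat \<Rightarrow> bool) \<Rightarrow> (nat \<Rightarrow> nat) set" where
  "germs S = {g. recursive g \<and> eventually (\<lambda>n. S (g n)) at_C}"

definition less_C :: "(nat \<Rightarrow> nat \<Rightarrow> bool) \<Rightarrow> (nat \<Rightarrow> nat) \<Rightarrow> (nat \<Rightarrow> nat) \<Rightarrow> bool" where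
  "less_C lt g h \<longleftrightarrow> eventually (\<lambda>n. lt (g n) (h n)) at_C"

lemma not_less_C:
  assumes "decidable 2 (\<lambda>xs. lt (xs ! 0) (xs ! 1))" "recursive g" "recursive h"
  shows "\<not> less_C lt g h \<longleftrightarrow> eventually (\<lambda>n. \<not> lt (g n) (h n)) at_C"
  unfolding less_C_def
  by (intro not_eventually_iff semidecidable_decidable decidable_app2[OF assms(1)] assms(2,3))

lemma incomparable_C:
  assumes lt: "decidable 2 (\<lambda>xs. lt (xs ! 0) (xs ! 1))" and g: "recursive g" and h: "recursive h"
    and irr: "\<And>a. \<not> lt a a" and tot: "\<And>a b. \<not> lt a b \<Longrightarrow> \<not> lt b a \<Longrightarrow> a = b"
  shows "\<not> less_C lt g h \<and> \<not> less_C lt h g \<longleftrightarrow> eventually (\<lambda>n. g n = h n) at_C"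
proof -
  have "\<not> less_C lt g h \<and> \<not> less_C lt h g \<longleftrightarrow>
      eventually (\<lambda>n. \<not> lt (g n) (h n) \<and> \<not> lt (h n) (g n)) at_C"
    by (simp add: not_less_C[OF lt g h] not_less_C[OF lt h g] eventually_conj_iff)
  also have "(\<lambda>n. \<not> lt (g n) (h n) \<and> \<not> lt (h n) (g n)) = (\<lambda>n. g n = h n)"
    by (intro ext) (use irr tot in metis)
  finally show ?thesis .
qed

lemma strict_weak_on_less_C:
  assumes lt: "decidable 2 (\<lambda>xs. lt (xs ! 0) (xs ! 1))" and w: "strict_weak_on UNIV lt"
  shows "strict_weak_on {g. recursive g} (less_C lt)"
  unfolding strict_weak_on_def
proof (intro conjI ballI impI)
  show "\<not> less_C lt g g" for g
    using strict_weak_on_irrefl[OF w] by (simp add: less_C_def)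
  show "less_C lt f h" if "less_C lt f g" "less_C lt g h" for f g h
    using that unfolding less_C_def
    by eventually_elim (use strict_weak_on_trans[OF w] in blast)
  fix f g h assume r: "f \<in> {g. recursive g}" "g \<in> {g. recursive g}" "h \<in> {g. recursive g}"
    and fh: "less_C lt f h"
  show "less_C lt f g \<or> less_C lt g h"
  proof (rule disjCI)
    assume "\<not> less_C lt g h"
    then have "eventually (\<lambda>n. \<not> lt (g n) (h n)) at_C" using not_less_C[OF lt] r by simp
    with fh show "less_C lt f g" unfolding less_C_def
      by eventually_elim (use strict_weak_on_cotrans[OF w] in blast)
  qed
qed

text \<open>
  The elements of \<open>S\<close> are tagged with the least stage at which they enter \<open>S\<close>,
  which makes the carrier decidable.
\<close>
lemma cohesive_power_presentation:
  fixes S :: "nat \<Rightarrow> bool" and T1 :: "'b ord" and T2 :: "'c ord"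
  assumes S: "semidecidable 1 (\<lambda>xs. S (xs ! 0))" and S0: "S w0"
    and lt: "decidable 2 (\<lambda>xs. lt (xs ! 0) (xs ! 1))"
    and weak: "strict_weak_on UNIV lt" and tot: "\<And>a b. \<not> lt a b \<Longrightarrow> \<not> lt b a \<Longrightarrow> a = b"
    and T1: "presents {w. S w} lt T1 F1" and T2: "presents (germs S) (less_C lt) T2 F2"
  shows "\<exists>M. computable_linear_order M \<and> M \<cong> T1 \<and> cohesive_power C M \<cong> T2"
proof -
  obtain Q where Q: "decidable (Suc 1) (\<lambda>ys. Q (hd ys) (tl ys))"
    "\<And>xs. length xs = 1 \<Longrightarrow> S (xs ! 0) \<longleftrightarrow> (\<exists>s. Q s xs)"
    using S unfolding semidecidable_def by blast
  have SQ: "S w \<longleftrightarrow> (\<exists>s. Q s [w])" for w using Q(2)[of "[w]"] by simp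
  define A where "A = {u. Q (psnd u) [pfst u] \<and> (\<forall>t<psnd u. \<not> Q t [pfst u])}"
  define r where "r = {(u, v). u \<in> A \<and> v \<in> A \<and> lt (pfst u) (pfst v)}"
  let ?M = "(A, r)"
  have irr: "\<not> lt a a" for a using strict_weak_on_irrefl[OF weak] by simp
  have inj: "u = v" if "u \<in> A" "v \<in> A" "pfst u = pfst v" for u v
  proof -
    have "psnd u = psnd v" using that unfolding A_def by (metis (mono_tags, lifting) linorder_neqE_nat mem_Collect_eq)
    then show ?thesis using that(3) by (metis prod_encode_pfst_psnd)
  qed
  have in_S: "S (pfst u)" if "u \<in> A" for u using that by (auto simp: A_def SQ)
  have onto: "\<exists>u\<in>A. pfst u = w" if "S w" for w
  proof -
    have "\<exists>s. Q s [w]" using that SQ by blast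
    then obtain s where "Q s [w]" "\<And>t. t < s \<Longrightarrow> \<not> Q t [w]" 
      using exists_least_iff[of "\<lambda>s. Q s [w]"] by blast
    then show ?thesis by (intro bexI[of _ "prod_encode (w, s)"]) (simp_all add: A_def)
  qed
  have dA: "decidable 1 (\<lambda>xs. xs ! 0 \<in> A)"
  proof -
    have l1: "list_computable 1 (Suc (Suc 0)) (\<lambda>xs. [psnd (xs ! 0), pfst (xs ! 0)])"
      by (intro list_intros computable_psnd computable_pfst computable_nth) auto
    have l2: "list_computable (Suc 1) (Suc (Suc 0)) (\<lambda>ys. [hd ys, pfst (tl ys ! 0)])"
      by (intro list_intros computable_hd computable_pfst computable_tl_nth) auto
    show ?thesis unfolding A_def mem_Collect_eq
      using decidable_subst[OF Q(1)[unfolded One_nat_def] l1] decidable_subst[OF Q(1)[unfolded One_nat_def] l2]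
      by (intro decidable_conj decidable_ball decidable_not computable_psnd computable_nth) auto
  qed
  have dr: "decidable 2 (\<lambda>xs. (xs ! 0, xs ! 1) \<in> r)"
    unfolding r_def mem_Collect_eq prod.case
    by (intro decidable_conj decidable_app1[OF dA] decidable_app2[OF lt] computable_pfst computable_nth) auto
  have "linear ?M"
    unfolding linear_def strict_linear_order_on_def prod.case
  proof (intro conjI)
    show "r \<subseteq> A \<times> A" by (auto simp: r_def)
    show "trans r" by (rule transI) (use strict_weak_on_trans[OF weak] in \<open>auto simp: r_def\<close>)
    show "irrefl r" using irr by (auto simp: r_def irrefl_def)
    show "total_on A r" unfolding total_on_def r_def using tot inj by auto
  qed
  then have comp: "computable_linear_order ?M"
    unfolding computable_linear_order_def using dA dr by simp
  have "?M \<cong> T1"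
  proof -
    have "bij_betw (\<lambda>u. F1 (pfst u)) A (fst T1)"
    proof (rule bij_betw_imageI)
      show "inj_on (\<lambda>u. F1 (pfst u)) A"
      proof (rule inj_onI)
        fix u v assume uv: "u \<in> A" "v \<in> A" "F1 (pfst u) = F1 (pfst v)"
        then have "pfst u = pfst v" using T1 in_S tot unfolding presents_def by blast
        then show "u = v" using inj uv by blast
      qed
      have "(\<lambda>u. F1 (pfst u)) ` A = F1 ` {w. S w}" using onto in_S by force
      then show "(\<lambda>u. F1 (pfst u)) ` A = fst T1" using T1 unfolding presents_def by simp
    qed
    moreover have "(u, v) \<in> r \<longleftrightarrow> (F1 (pfst u), F1 (pfst v)) \<in> snd T1" if "u \<in> A" "v \<in> A" for u v
      using T1 that in_S unfolding presents_def r_def by auto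
    ultimately show ?thesis unfolding order_iso_def by (cases T1) auto
  qed
  moreover have "cohesive_power C ?M \<cong> T2"
  proof -
    let ?P = "power_funs C ?M" and ?E = "power_eq C ?M"
    have P: "partial_computable \<phi>" "ran \<phi> \<subseteq> A" "eventually (\<lambda>n. \<phi> n \<noteq> None) at_C" if "\<phi> \<in> ?P" for \<phi>
      using that by (auto simp: power_funs_def almost_subset_iff domIff)
    have "\<exists>g. recursive g \<and> eventually (\<lambda>n. \<phi> n = Some (g n)) at_C" if "\<phi> \<in> ?P" for \<phi>
    proof -
      have "eventually (\<lambda>n. \<exists>y. \<phi> n = Some y) at_C" using P(3)[OF that] by simp
      then show ?thesis using recursive_choice[OF semidecidable_graph[OF P(1)[OF that]]] by blast
    qed
    then obtain total where total: "\<And>\<phi>. \<phi> \<in> ?P \<Longrightarrow> recursive (total \<phi>)"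
        "\<And>\<phi>. \<phi> \<in> ?P \<Longrightarrow> eventually (\<lambda>n. \<phi> n = Some (total \<phi> n)) at_C" by metis
    define G where "G \<phi> n = pfst (total \<phi> n)" for \<phi> n
    have total_A: "eventually (\<lambda>n. total \<phi> n \<in> A) at_C" if "\<phi> \<in> ?P" for \<phi>
      using total(2)[OF that] by eventually_elim (use P(2)[OF that] in \<open>auto intro: ranI\<close>)
    have recG: "recursive (G \<phi>)" if "\<phi> \<in> ?P" for \<phi>
      unfolding G_def using total(1)[OF that] by (intro computable_pfst)
    have G: "G \<phi> \<in> germs S" if "\<phi> \<in> ?P" for \<phi>
    proof -
      have "eventually (\<lambda>n. S (G \<phi> n)) at_C"
        using total_A[OF that] by eventually_elim (simp add: G_def in_S)
      then show ?thesis using recG[OF that] by (simp add: germs_def)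
    qed
    have less: "C \<subseteq>\<^sup>* {x. \<exists>y z. \<phi> x = Some y \<and> \<psi> x = Some z \<and> (y, z) \<in> r} \<longleftrightarrow>
        (F2 (G \<phi>), F2 (G \<psi>)) \<in> snd T2" if p: "\<phi> \<in> ?P" "\<psi> \<in> ?P" for \<phi> \<psi>
    proof -
      have "C \<subseteq>\<^sup>* {x. \<exists>y z. \<phi> x = Some y \<and> \<psi> x = Some z \<and> (y, z) \<in> r} \<longleftrightarrow>
          eventually (\<lambda>n. lt (G \<phi> n) (G \<psi> n)) at_C"
        unfolding almost_subset_iff
      proof (rule eventually_cong)
        show "eventually (\<lambda>n. \<phi> n = Some (total \<phi> n) \<and> \<psi> n = Some (total \<psi> n) \<and>
            total \<phi> n \<in> A \<and> total \<psi> n \<in> A) at_C"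
          using total(2)[OF p(1)] total(2)[OF p(2)] total_A[OF p(1)] total_A[OF p(2)]
          by (simp add: eventually_conj_iff)
      qed (auto simp: r_def G_def)
      then show ?thesis using T2 G[OF p(1)] G[OF p(2)] unfolding presents_def less_C_def by blast
    qed
    have eq: "(\<phi>, \<psi>) \<in> ?E \<longleftrightarrow> F2 (G \<phi>) = F2 (G \<psi>)" if p: "\<phi> \<in> ?P" "\<psi> \<in> ?P" for \<phi> \<psi>
    proof -
      have "(\<phi>, \<psi>) \<in> ?E \<longleftrightarrow> eventually (\<lambda>n. \<exists>y. \<phi> n = Some y \<and> \<psi> n = Some y) at_C"
        using p unfolding power_eq_def almost_subset_iff by simp
      also have "\<dots> \<longleftrightarrow> eventually (\<lambda>n. G \<phi> n = G \<psi> n) at_C"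
      proof (rule eventually_cong)
        show "eventually (\<lambda>n. \<phi> n = Some (total \<phi> n) \<and> \<psi> n = Some (total \<psi> n) \<and>
            total \<phi> n \<in> A \<and> total \<psi> n \<in> A) at_C"
          using total(2)[OF p(1)] total(2)[OF p(2)] total_A[OF p(1)] total_A[OF p(2)]
          by (simp add: eventually_conj_iff)
      qed (auto simp: G_def inj)
      also have "\<dots> \<longleftrightarrow> F2 (G \<phi>) = F2 (G \<psi>)"
        using incomparable_C[OF lt recG[OF p(1)] recG[OF p(2)] irr tot] T2 G[OF p(1)] G[OF p(2)]
        unfolding presents_def by blast
      finally show ?thesis .
    qed
    have E_P: "\<phi> \<in> ?P \<and> \<psi> \<in> ?P" if "(\<phi>, \<psi>) \<in> ?E" for \<phi> \<psi>
      using that by (simp add: power_eq_def)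
    define K where "K = (\<lambda>c. F2 (G (SOME \<phi>. \<phi> \<in> c)))"
    have K: "K (?E `` {\<phi>}) = F2 (G \<phi>)" if "\<phi> \<in> ?P" for \<phi>
    proof -
      have "\<phi> \<in> ?E `` {\<phi>}" using eq[OF that that] by simp
      then have "(SOME \<psi>. \<psi> \<in> ?E `` {\<phi>}) \<in> ?E `` {\<phi>}"
        by (rule someI[of "\<lambda>\<psi>. \<psi> \<in> ?E `` {\<phi>}"])
      then have "(\<phi>, SOME \<psi>. \<psi> \<in> ?E `` {\<phi>}) \<in> ?E" by blast
      from this eq[OF that, of "SOME \<psi>. \<psi> \<in> ?E `` {\<phi>}"] E_P[OF this] show ?thesis
        unfolding K_def by simp
    qed
    have class_eq: "?E `` {\<phi>} = ?E `` {\<psi>}" if "\<phi> \<in> ?P" "\<psi> \<in> ?P" "F2 (G \<phi>) = F2 (G \<psi>)" for \<phi> \<psi>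
    proof -
      have "?E `` {\<phi>} \<subseteq> ?E `` {\<psi>}" if p: "\<phi> \<in> ?P" "\<psi> \<in> ?P" "F2 (G \<phi>) = F2 (G \<psi>)" for \<phi> \<psi>
      proof
        fix \<chi> assume "\<chi> \<in> ?E `` {\<phi>}"
        then have \<chi>: "(\<phi>, \<chi>) \<in> ?E" by simp
        then have "\<chi> \<in> ?P" using E_P by blast
        then show "\<chi> \<in> ?E `` {\<psi>}" using \<chi> eq[OF p(1)] eq[OF p(2)] p(3) by simp
      qed
      from this[OF that] this[OF that(2,1) that(3)[symmetric]] show ?thesis by blast
    qed
    have "bij_betw K (?P // ?E) (fst T2)"
    proof (rule bij_betw_imageI)
      show "inj_on K (?P // ?E)"
      proof (rule inj_onI)
        fix c d assume "c \<in> ?P // ?E" "d \<in> ?P // ?E" and e: "K c = K d"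
        then obtain \<phi> \<psi> where c: "\<phi> \<in> ?P" "c = ?E `` {\<phi>}" and d: "\<psi> \<in> ?P" "d = ?E `` {\<psi>}"
          by (auto elim!: quotientE)
        have "F2 (G \<phi>) = F2 (G \<psi>)" using e K[OF c(1)] K[OF d(1)] unfolding c d by simp
        then show "c = d" unfolding c d by (rule class_eq[OF c(1) d(1)])
      qed
      have "K ` (?P // ?E) = (\<lambda>\<phi>. F2 (G \<phi>)) ` ?P"
      proof -
        have "?P // ?E = (\<lambda>\<phi>. ?E `` {\<phi>}) ` ?P" by (auto simp: quotient_def)
        then show ?thesis by (simp add: image_image K cong: image_cong)
      qed
      also have "\<dots> = F2 ` germs S"
      proof
        show "(\<lambda>\<phi>. F2 (G \<phi>)) ` ?P \<subseteq> F2 ` germs S" using G by blast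
        show "F2 ` germs S \<subseteq> (\<lambda>\<phi>. F2 (G \<phi>)) ` ?P"
        proof (rule image_subsetI)
          fix g assume g: "g \<in> germs S"
          then have rg: "recursive g" and "eventually (\<lambda>n. S (g n)) at_C" by (simp_all add: germs_def)
          \<comment> \<open>The default \<open>u0\<close> keeps the chosen values in the carrier off
            \<open>C\<close> too, as the range condition of \<open>power_funs\<close>
            demands.\<close>
          obtain u0 where u0: "u0 \<in> A" using onto[OF S0] by blast
          have "semidecidable 2 (\<lambda>xs. xs ! 1 \<in> A \<and> pfst (xs ! 1) = g (xs ! 0))"
            by (intro semidecidable_decidable decidable_conj decidable_app1[OF dA] decidable_eq
                computable_pfst computable_app1[OF rg] computable_nth) auto
          moreover have "eventually (\<lambda>n. \<exists>u. u \<in> A \<and> pfst u = g n) at_C"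
            using \<open>eventually (\<lambda>n. S (g n)) at_C\<close> by eventually_elim (use onto in blast)
          ultimately obtain h where h: "recursive h" "eventually (\<lambda>n. h n \<in> A \<and> pfst (h n) = g n) at_C"
              "\<And>n. (h n \<in> A \<and> pfst (h n) = g n) \<or> h n = u0"
            using recursive_choice[of "\<lambda>n u. u \<in> A \<and> pfst u = g n" u0] by blast
          define \<phi> where "\<phi> n = Some (h n)" for n
          have "h n \<in> A" for n using h(3)[of n] u0 by auto
          then have "ran \<phi> \<subseteq> A" by (auto simp: ran_def \<phi>_def)
          then have \<phi>: "\<phi> \<in> ?P"
            using partial_computable_total[OF h(1)]
            by (auto simp: power_funs_def \<phi>_def[abs_def] almost_subset_def dom_def)
          have "eventually (\<lambda>n. G \<phi> n = g n) at_C"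
            using total(2)[OF \<phi>] h(2) by eventually_elim (auto simp: \<phi>_def G_def)
          then have "F2 (G \<phi>) = F2 g"
            using incomparable_C[OF lt recG[OF \<phi>] rg irr tot] T2 g G[OF \<phi>] unfolding presents_def by blast
          then show "F2 g \<in> (\<lambda>\<phi>. F2 (G \<phi>)) ` ?P" using \<phi> by (metis image_eqI)
        qed
      qed
      finally show "K ` (?P // ?E) = fst T2" using T2 by (simp add: presents_def)
    qed
    moreover have "(\<exists>\<phi>\<in>c. \<exists>\<psi>\<in>d. C \<subseteq>\<^sup>* {x. \<exists>y z. \<phi> x = Some y \<and> \<psi> x = Some z \<and> (y, z) \<in> r}) \<longleftrightarrow>
        (K c, K d) \<in> snd T2" if cd: "c \<in> ?P // ?E" "d \<in> ?P // ?E" for c d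
    proof -
      obtain \<phi> \<psi> where c: "\<phi> \<in> ?P" "c = ?E `` {\<phi>}" and d: "\<psi> \<in> ?P" "d = ?E `` {\<psi>}"
        using cd by (auto elim!: quotientE)
      have c': "\<phi>' \<in> ?P \<and> F2 (G \<phi>') = K c" if "\<phi>' \<in> c" for \<phi>'
      proof -
        have "(\<phi>, \<phi>') \<in> ?E" using that c(2) by simp
        then show ?thesis using eq[OF c(1), of \<phi>'] E_P K[OF c(1)] c(2) by auto
      qed
      have d': "\<phi>' \<in> ?P \<and> F2 (G \<phi>') = K d" if "\<phi>' \<in> d" for \<phi>'
      proof -
        have "(\<psi>, \<phi>') \<in> ?E" using that d(2) by simp
        then show ?thesis using eq[OF d(1), of \<phi>'] E_P K[OF d(1)] d(2) by auto
      qed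
      have "\<phi> \<in> c" "\<psi> \<in> d" using c d eq[OF c(1) c(1)] eq[OF d(1) d(1)] by simp_all
      moreover have "C \<subseteq>\<^sup>* {x. \<exists>y z. \<phi>' x = Some y \<and> \<psi>' x = Some z \<and> (y, z) \<in> r} \<longleftrightarrow>
          (K c, K d) \<in> snd T2" if "\<phi>' \<in> c" "\<psi>' \<in> d" for \<phi>' \<psi>'
        using less[of \<phi>' \<psi>'] c'[OF that(1)] d'[OF that(2)] by simp
      ultimately show ?thesis by blast
    qed
    ultimately show ?thesis
      unfolding order_iso_def cohesive_power_def Let_def by (cases T2) auto
  qed
  ultimately show ?thesis using comp by blast
qed

end

section \<open>Asymmetric orders and presentations obtained from relations\<close>

definition asym_ord :: "'a ord \<Rightarrow> bool" where
  "asym_ord T \<longleftrightarrow> (\<forall>x y. (x, y) \<in> snd T \<longrightarrow> (y, x) \<notin> snd T)"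

lemma asym_omega: "asym_ord omega"
  and asym_zeta: "asym_ord zeta"
  and asym_fin_ord: "asym_ord (fin_ord k)"
  by (auto simp: asym_ord_def omega_def zeta_def fin_ord_def)

lemma asym_reverse: "asym_ord T \<Longrightarrow> asym_ord (reverse T)"
  by (auto simp: asym_ord_def reverse_def split: prod.splits)

lemma asym_ord_plus:
  assumes "asym_ord A" "asym_ord B" shows "asym_ord (A \<oplus> B)"
  unfolding asym_ord_def
proof (intro allI)
  fix x y show "(x, y) \<in> snd (A \<oplus> B) \<longrightarrow> (y, x) \<notin> snd (A \<oplus> B)"
    using assms by (cases x; cases y) (auto simp: asym_ord_def)
qed

lemma asym_rat_sum:
  assumes "\<And>q. asym_ord (F q)" shows "asym_ord (rat_sum F)"
  unfolding asym_ord_def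
proof (intro allI)
  fix x y show "(x, y) \<in> snd (rat_sum F) \<longrightarrow> (y, x) \<notin> snd (rat_sum F)"
    using assms by (cases x; cases y) (auto simp: asym_ord_def rat_sum_rel)
qed

lemma snd_ord_image: "inj f \<Longrightarrow> (f x, f y) \<in> snd (ord_image f T) \<longleftrightarrow> (x, y) \<in> snd T"
  by (force simp: ord_image_def inj_eq split: prod.splits)

lemma asym_ord_image:
  assumes "inj f" "asym_ord T" shows "asym_ord (ord_image f T)"
  unfolding asym_ord_def
proof (intro allI impI notI)
  fix x y assume xy: "(x, y) \<in> snd (ord_image f T)" "(y, x) \<in> snd (ord_image f T)"
  then obtain x' y' where "x = f x'" "y = f y'" by (auto simp: ord_image_def split: prod.splits)
  with xy assms show False by (simp add: snd_ord_image asym_ord_def)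
qed

lemma asym_alpha: "asym_ord alpha"
  unfolding alpha_def by (intro asym_ord_plus asym_rat_sum asym_omega asym_zeta asym_reverse)

text \<open>Asymmetry of \<open>T\<close> turns the two implications into equivalences. It also
  makes \<open>lt\<close> irreflexive on \<open>A\<close>, so \<open>eq\<close> with
  \<open>a = b\<close> shows that \<open>R\<close> assigns only one value to each element.\<close>

lemma presentsI:
  assumes total: "\<And>a. a \<in> A \<Longrightarrow> \<exists>v\<in>fst T. R a v" and onto: "\<And>v. v \<in> fst T \<Longrightarrow> \<exists>a\<in>A. R a v"
    and less: "\<And>a b v w. a \<in> A \<Longrightarrow> b \<in> A \<Longrightarrow> v \<in> fst T \<Longrightarrow> w \<in> fst T \<Longrightarrow> R a v \<Longrightarrow> R b w
      \<Longrightarrow> lt a b \<Longrightarrow> (v, w) \<in> snd T"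
    and eq: "\<And>a b v w. a \<in> A \<Longrightarrow> b \<in> A \<Longrightarrow> v \<in> fst T \<Longrightarrow> w \<in> fst T \<Longrightarrow> R a v \<Longrightarrow> R b w
      \<Longrightarrow> \<not> lt a b \<Longrightarrow> \<not> lt b a \<Longrightarrow> v = w"
    and asym: "asym_ord T"
  shows "\<exists>F. presents A lt T F"
proof -
  obtain F where F: "\<And>a. a \<in> A \<Longrightarrow> F a \<in> fst T \<and> R a (F a)" using total by metis
  have as: "\<And>x y. (x, y) \<in> snd T \<Longrightarrow> (y, x) \<notin> snd T" using asym by (simp add: asym_ord_def)
  have irr: "\<not> lt a a" if "a \<in> A" for a using less[of a a "F a" "F a"] as F that by blast
  have lt: "(F a, F b) \<in> snd T" if "a \<in> A" "b \<in> A" "lt a b" for a b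
    using less[OF that(1,2), of "F a" "F b"] F that by blast
  have inc: "F a = F b" if "a \<in> A" "b \<in> A" "\<not> lt a b" "\<not> lt b a" for a b
    using eq[OF that(1,2), of "F a" "F b"] F that by blast
  have "F ` A = fst T"
  proof
    show "F ` A \<subseteq> fst T" using F by blast
    show "fst T \<subseteq> F ` A"
    proof
      fix v assume v: "v \<in> fst T"
      then obtain a where a: "a \<in> A" "R a v" using onto by blast
      then have "F a = v" using eq[of a a "F a" v] F[OF a(1)] irr v by blast
      then show "v \<in> F ` A" using a by blast
    qed
  qed
  moreover have "(F a, F b) \<in> snd T \<longleftrightarrow> lt a b" if "a \<in> A" "b \<in> A" for a b
    using lt[OF that] lt[OF that(2,1)] inc[OF that] as by metis
  moreover have "F a = F b \<longleftrightarrow> \<not> lt a b \<and> \<not> lt b a" if "a \<in> A" "b \<in> A" for a b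
    using lt[OF that] lt[OF that(2,1)] inc[OF that] as by metis
  ultimately show ?thesis unfolding presents_def by blast
qed

context co_ce_cohesive
begin

subsection \<open>Nonstandard initial segments\<close>

lemma eventually_less_const:
  assumes "\<And>d. eventually (\<lambda>n. f n \<noteq> d) at_C"
  shows "eventually (\<lambda>n. (m::nat) < f n) at_C"
proof -
  have "eventually (\<lambda>n. \<forall>d\<in>{..m}. f n \<noteq> d) at_C" using assms by (intro eventually_ball_finite) auto
  then show ?thesis by eventually_elim (metis atMost_iff not_le)
qed

text \<open>If no value were taken almost everywhere on \<open>C\<close>, the dichotomy would make
  every single value avoided almost everywhere, hence also all of the finitely many values up to
  \<open>b\<close>.\<close>

lemma recursive_eventually_const:
  assumes f: "recursive f" and b: "eventually (\<lambda>n. f n \<le> b) at_C"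
  shows "\<exists>c. eventually (\<lambda>n. f n = c) at_C"
proof (rule ccontr)
  assume "\<nexists>c. eventually (\<lambda>n. f n = c) at_C"
  moreover have "semidecidable 1 (\<lambda>xs. f (xs ! 0) = c)" for c
    by (intro semidecidable_decidable decidable_eq f computable_const)
  ultimately have "eventually (\<lambda>n. f n \<noteq> c) at_C" for c using dichotomy[of "\<lambda>n. f n = c"] by blast
  from eventually_less_const[OF this] have "eventually (\<lambda>n. b < f n) at_C" by blast
  with b have "eventually (\<lambda>n. False) at_C" by eventually_elim simp
  then show False by simp
qed

text \<open>The distance from \<open>f\<close> up to \<open>g\<close> exceeds every standard number.
  The classes of incomparable functions are the galaxies of nonstandard arithmetic.\<close>

definition far :: "(nat \<Rightarrow> nat) \<Rightarrow> (nat \<Rightarrow> nat) \<Rightarrow> bool" where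
  "far f g \<longleftrightarrow> (\<forall>m. eventually (\<lambda>n. f n + m < g n) at_C)"

lemma not_far:
  assumes "recursive f" "recursive g" "\<not> far f g"
  obtains m where "eventually (\<lambda>n. g n \<le> f n + m) at_C"
proof -
  obtain m where m: "\<not> eventually (\<lambda>n. f n + m < g n) at_C" using assms(3) by (auto simp: far_def)
  have "semidecidable 1 (\<lambda>xs. f (xs ! 0) + m < g (xs ! 0))"
    by (intro semidecidable_decidable decidable_less computable_add computable_const assms)
  from dichotomy[OF this] m have "eventually (\<lambda>n. \<not> f n + m < g n) at_C" by blast
  then show ?thesis using that[of m] by (simp add: not_less)
qed

lemma far_trans: "far f g \<Longrightarrow> far g h \<Longrightarrow> far f h"
  unfolding far_def
proof (intro allI)
  fix m assume fg: "\<forall>m. \<forall>\<^sub>F n in at_C. f n + m < g n" and gh: "\<forall>m. \<forall>\<^sub>F n in at_C. g n + m < h n"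
  from fg[rule_format, of m] gh[rule_format, of 0]
  show "\<forall>\<^sub>F n in at_C. f n + m < h n" by eventually_elim simp
qed

lemma far_irrefl: "\<not> far f f"
  by (simp add: far_def)

lemma far_le: "far f g \<Longrightarrow> eventually (\<lambda>n. g n \<le> h n + m) at_C \<Longrightarrow> far f h"
  unfolding far_def
proof (intro allI)
  fix k assume fg: "\<forall>m. \<forall>\<^sub>F n in at_C. f n + m < g n" and gh: "\<forall>\<^sub>F n in at_C. g n \<le> h n + m"
  from fg[rule_format, of "k + m"] gh
  show "\<forall>\<^sub>F n in at_C. f n + k < h n" by eventually_elim simp
qed

lemma far_weak: "strict_weak_on {f. recursive f} far"
  unfolding strict_weak_on_def
proof (intro conjI ballI impI)
  fix f g h assume r: "f \<in> {f. recursive f}" "g \<in> {f. recursive f}" "h \<in> {f. recursive f}" and fh: "far f h"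
  show "far f g \<or> far g h"
  proof (rule disjCI)
    assume "\<not> far g h"
    then obtain m where "eventually (\<lambda>n. h n \<le> g n + m) at_C" using not_far[of g h] r by auto
    then show "far f g" using far_le[OF fh] by blast
  qed
qed (use far_trans far_irrefl in blast)+

lemma far_midpoint:
  assumes "far f g"
  shows "far f (\<lambda>n. (f n + g n) div 2)" "far (\<lambda>n. (f n + g n) div 2) g"
proof -
  have a: "\<forall>\<^sub>F n in at_C. f n + m < g n" for m using assms by (simp add: far_def)
  show "far f (\<lambda>n. (f n + g n) div 2)" unfolding far_def
  proof
    fix m show "\<forall>\<^sub>F n in at_C. f n + m < (f n + g n) div 2"
      using a[of "2 * m + 2"] by eventually_elim linarith
  qed
  show "far (\<lambda>n. (f n + g n) div 2) g" unfolding far_def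
  proof
    fix m show "\<forall>\<^sub>F n in at_C. (f n + g n) div 2 + m < g n"
      using a[of "2 * m + 2"] by eventually_elim linarith
  qed
qed

lemma recursive_midpoint: "recursive f \<Longrightarrow> recursive g \<Longrightarrow> recursive (\<lambda>n. (f n + g n) div 2)"
  by (intro computable_div computable_add computable_const)

lemma near_const:
  assumes "recursive f" "recursive g" "\<not> far f g" "\<not> far g f"
  shows "\<exists>z. eventually (\<lambda>n. int (f n) = int (g n) + z) at_C"
proof -
  obtain m where m: "eventually (\<lambda>n. g n \<le> f n + m) at_C" using not_far assms by blast
  obtain k where k: "eventually (\<lambda>n. f n \<le> g n + k) at_C" using not_far[OF assms(2,1,4)] by blast
  \<comment> \<open>Adding \<open>m\<close> first makes the truncated subtraction exact almost
    everywhere on \<open>C\<close>.\<close>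
  have "recursive (\<lambda>n. f n + m - g n)" by (intro computable_diff computable_add computable_const assms)
  moreover have "eventually (\<lambda>n. f n + m - g n \<le> k + m) at_C" using k by eventually_elim simp
  ultimately obtain c where "eventually (\<lambda>n. f n + m - g n = c) at_C"
    using recursive_eventually_const[of "\<lambda>n. f n + m - g n"] by blast
  with m have "eventually (\<lambda>n. int (f n) = int (g n) + (int c - int m)) at_C" by eventually_elim linarith
  then show ?thesis by blast
qed

lemma shift_near:
  assumes "eventually (\<lambda>n. int (f n) = int (g n) + z) at_C"
  shows "\<not> far f g" "\<not> far g f"
proof -
  show "\<not> far f g"
  proof
    assume "far f g"
    then have "\<forall>\<^sub>F n in at_C. f n + nat \<bar>z\<bar> < g n" by (simp add: far_def)
    with assms have "\<forall>\<^sub>F n in at_C. False" by eventually_elim linarith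
    then show False by simp
  qed
  show "\<not> far g f"
  proof
    assume "far g f"
    then have "\<forall>\<^sub>F n in at_C. g n + nat \<bar>z\<bar> < f n" by (simp add: far_def)
    with assms have "\<forall>\<^sub>F n in at_C. False" by eventually_elim linarith
    then show False by simp
  qed
qed

abbreviation less_nat_C :: "(nat \<Rightarrow> nat) \<Rightarrow> (nat \<Rightarrow> nat) \<Rightarrow> bool" where
  "less_nat_C \<equiv> less_C (<)"

definition initial_segment :: "(nat \<Rightarrow> nat) \<Rightarrow> (nat \<Rightarrow> nat) set" where
  "initial_segment \<sigma> = {\<iota>. recursive \<iota> \<and> eventually (\<lambda>n. \<iota> n < \<sigma> n) at_C}"

lemma decidable_less_nat: "decidable 2 (\<lambda>xs. xs ! 0 < xs ! 1)"
  by (intro decidable_less computable_nth) auto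

lemma not_less_nat_C:
  assumes "recursive f" "recursive g" "\<not> less_nat_C f g" "\<not> less_nat_C g f"
  shows "eventually (\<lambda>n. f n = g n) at_C"
  using incomparable_C[OF decidable_less_nat assms(1,2)] assms(3,4) by auto

text \<open>Below a nonstandard \<sigma>, the functions at standard distance from 0 form \<omega>
  and those at standard distance from \<sigma> form its reverse. Every galaxy in between is a copy
  of the integers. Midpoints show that these galaxies are dense without endpoints, so by Cantor's
  theorem, used with a single color, they are ordered like the rationals.\<close>

lemma initial_segment_alpha:
  assumes \<sigma>: "recursive \<sigma>" and inf: "\<And>m. eventually (\<lambda>n. m < \<sigma> n) at_C"
  shows "\<exists>F. presents (initial_segment \<sigma>) less_nat_C alpha F"
proof -
  define Mid where "Mid = {\<iota>. recursive \<iota> \<and> far (\<lambda>_. 0) \<iota> \<and> far \<iota> \<sigma>}"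
  have rec0: "recursive (\<lambda>_. 0)" by (rule computable_const)
  have far0: "far (\<lambda>_. 0) \<sigma>" using inf by (simp add: far_def)
  have mid: "(\<lambda>n. (f n + g n) div 2) \<in> Mid"
    if "recursive f" "recursive g" "far f g" "f = (\<lambda>_. 0) \<or> f \<in> Mid" "g = \<sigma> \<or> g \<in> Mid" for f g
    using that recursive_midpoint[OF that(1,2)] far_midpoint[OF that(3)] far_trans unfolding Mid_def by blast
  have "dense_colored {()} Mid far (\<lambda>_. ())"
  proof
    have "Mid \<subseteq> {g. recursive g}" by (auto simp: Mid_def)
    then show "countable Mid" using countable_total_computable by (rule countable_subset)
    show "strict_weak_on Mid far"
      by (rule strict_weak_on_subset[OF far_weak]) (auto simp: Mid_def)
    show "Mid \<noteq> {}" using mid[OF rec0 \<sigma> far0] by auto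
    fix s a assume a: "a \<in> Mid" and "s \<in> {()}"
    then have a': "recursive a" "far (\<lambda>_. 0) a" "far a \<sigma>" by (auto simp: Mid_def)
    show "\<exists>x\<in>Mid. far a x \<and> () = s" using mid[OF a'(1) \<sigma> a'(3)] a far_midpoint(1)[OF a'(3)] by auto
    show "\<exists>x\<in>Mid. far x a \<and> () = s" using mid[OF rec0 a'(1) a'(2)] a far_midpoint(2)[OF a'(2)] by auto
    fix b assume b: "b \<in> Mid" and ab: "far a b"
    then have "recursive b" by (auto simp: Mid_def)
    then show "\<exists>x\<in>Mid. far a x \<and> far x b \<and> () = s"
      using mid[OF a'(1) _ ab] a b far_midpoint[OF ab] by auto
  qed auto
  moreover have "dense_coloring {()} (\<lambda>_ :: rat. ())"
    unfolding dense_coloring_def using dense by auto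
  ultimately have "\<exists>Q. Q ` Mid = (UNIV :: rat set) \<and> (\<forall>a\<in>Mid. \<forall>b\<in>Mid. Q a < Q b \<longleftrightarrow> far a b) \<and>
      (\<forall>a\<in>Mid. () = ())"
    by (rule colored_Cantor)
  then obtain Q where Q: "Q ` Mid = (UNIV :: rat set)"
      "\<And>a b. a \<in> Mid \<Longrightarrow> b \<in> Mid \<Longrightarrow> Q a < Q b \<longleftrightarrow> far a b"
    by blast
  have "\<forall>q. \<exists>a. a \<in> Mid \<and> Q a = q" using Q(1) by (metis UNIV_I imageE)
  \<comment> \<open>A representative of each galaxy, serving as the zero of its copy of the
    integers.\<close>
  then obtain \<rho> where \<rho>: "\<And>q. \<rho> q \<in> Mid" "\<And>q. Q (\<rho> q) = q" by metis
  \<comment> \<open>The element \<open>Inr m\<close> stands for the function with values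
    \<open>\<sigma> n - 1 - m\<close>, since 0 is the greatest element of the reverse of
    \<omega>.\<close>
  define R where "R \<iota> v = (case v of
      Inl (Inl m) \<Rightarrow> eventually (\<lambda>n. \<iota> n = m) at_C
    | Inl (Inr (q, z)) \<Rightarrow> \<iota> \<in> Mid \<and> Q \<iota> = q \<and> eventually (\<lambda>n. int (\<iota> n) = int (\<rho> q n) + z) at_C
    | Inr m \<Rightarrow> eventually (\<lambda>n. \<iota> n + m + 1 = \<sigma> n) at_C)" for \<iota> and v :: "(nat + rat \<times> int) + nat"
  have fst_alpha: "fst alpha = UNIV"
    by (auto simp: alpha_def fst_rat_sum omega_def zeta_def reverse_def)
  have ev_False: "\<not> eventually (\<lambda>_. False) at_C" by simp
  have MidD: "recursive a" "\<And>m. eventually (\<lambda>n. m < a n) at_C" "\<And>m. eventually (\<lambda>n. a n + m < \<sigma> n) at_C"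
    if "a \<in> Mid" for a using that by (auto simp: Mid_def far_def)
  \<comment> \<open>A weak comparison serves both order conditions of \<open>presentsI\<close>: with
    \<open>uniq\<close> it yields strict inequality, and applied in both directions it yields
    equality by asymmetry.\<close>
  have le: "v = w \<or> (v, w) \<in> snd alpha"
    if a: "R a v" and b: "R b w" and ab: "eventually (\<lambda>n. a n \<le> b n) at_C" for a b v w
  proof -
    consider m where "v = Inl (Inl m)" | q z where "v = Inl (Inr (q, z))" | m where "v = Inr m"
      by (metis sum.exhaust surj_pair)
    then show ?thesis
    proof cases
      case 1
      with a have v: "eventually (\<lambda>n. a n = m) at_C" by (simp add: R_def)
      consider m' where "w = Inl (Inl m')" | q z where "w = Inl (Inr (q, z))" | m where "w = Inr m"
        by (metis sum.exhaust surj_pair)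
      then show ?thesis
      proof cases
        case (1 m')
        with b have "eventually (\<lambda>n. b n = m') at_C" by (simp add: R_def)
        with v ab have "eventually (\<lambda>n. m \<le> m') at_C" by eventually_elim simp
        then show ?thesis using 1 \<open>v = _\<close> by (auto simp: alpha_def omega_def)
      qed (use 1 in \<open>simp_all add: alpha_def omega_def fst_rat_sum zeta_def reverse_def\<close>)
    next
      case (2 q z)
      with a have v: "a \<in> Mid" "Q a = q" "eventually (\<lambda>n. int (a n) = int (\<rho> q n) + z) at_C"
        by (simp_all add: R_def)
      consider m where "w = Inl (Inl m)" | q z where "w = Inl (Inr (q, z))" | m where "w = Inr m"
        by (metis sum.exhaust surj_pair)
      then show ?thesis
      proof cases
        case (1 m)
        with b have "eventually (\<lambda>n. b n = m) at_C" by (simp add: R_def)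
        with MidD(2)[OF v(1), of m] ab have "eventually (\<lambda>n. False) at_C" by eventually_elim simp
        then show ?thesis by simp
      next
        case w: (2 q' z')
        with b have b': "b \<in> Mid" "Q b = q'" "eventually (\<lambda>n. int (b n) = int (\<rho> q' n) + z') at_C"
          by (simp_all add: R_def)
        have "\<not> far b a"
        proof
          assume "far b a"
          then have "eventually (\<lambda>n. b n + 0 < a n) at_C" unfolding far_def by blast
          with ab have "eventually (\<lambda>n. False) at_C" by eventually_elim simp
          then show False by simp
        qed
        then have "q \<le> q'" using Q(2)[OF b'(1) v(1)] v(2) b'(2) by auto
        moreover have "z \<le> z'" if "q = q'"
        proof -
          have "eventually (\<lambda>n. z \<le> z') at_C" using v(3) b'(3) ab by eventually_elim (use that in simp)
          then show ?thesis by simp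
        qed
        ultimately show ?thesis using 2 w by (auto simp: alpha_def rat_sum_rel zeta_def)
      qed (use 2 in \<open>simp_all add: alpha_def omega_def fst_rat_sum zeta_def reverse_def\<close>)
    next
      case (3 m)
      with a have v: "eventually (\<lambda>n. a n + m + 1 = \<sigma> n) at_C" by (simp add: R_def)
      consider m where "w = Inl (Inl m)" | q z where "w = Inl (Inr (q, z))" | m where "w = Inr m"
        by (metis sum.exhaust surj_pair)
      then show ?thesis
      proof cases
        case (1 k)
        with b have "eventually (\<lambda>n. b n = k) at_C" by (simp add: R_def)
        with v ab inf[of "m + k + 1"] have "eventually (\<lambda>n. False) at_C" by eventually_elim simp
        then show ?thesis by simp
      next
        case (2 q z)
        with b have "b \<in> Mid" by (simp add: R_def)
        from MidD(3)[OF this, of "m + 1"] v ab have "eventually (\<lambda>n. False) at_C" by eventually_elim simp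
        then show ?thesis by simp
      next
        case (3 m')
        with b have "eventually (\<lambda>n. b n + m' + 1 = \<sigma> n) at_C" by (simp add: R_def)
        with v ab have "eventually (\<lambda>n. m' \<le> m) at_C" by eventually_elim simp
        then show ?thesis using 3 \<open>v = _\<close> by (auto simp: alpha_def omega_def reverse_def)
      qed
    qed
  qed
  have uniq: "eventually (\<lambda>n. a n = b n) at_C" if a: "R a v" and b: "R b v" for a b v
  proof -
    consider m where "v = Inl (Inl m)" | q z where "v = Inl (Inr (q, z))" | m where "v = Inr m"
      by (metis sum.exhaust surj_pair)
    then show ?thesis
    proof cases
      case (1 m)
      with a b have "eventually (\<lambda>n. a n = m) at_C" "eventually (\<lambda>n. b n = m) at_C" by (simp_all add: R_def)
      then show ?thesis by eventually_elim simp
    next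
      case (2 q z)
      with a b have "eventually (\<lambda>n. int (a n) = int (\<rho> q n) + z) at_C"
        "eventually (\<lambda>n. int (b n) = int (\<rho> q n) + z) at_C" by (simp_all add: R_def)
      then show ?thesis by eventually_elim simp
    next
      case (3 m)
      with a b have "eventually (\<lambda>n. a n + m + 1 = \<sigma> n) at_C"
        "eventually (\<lambda>n. b n + m + 1 = \<sigma> n) at_C" by (simp_all add: R_def)
      then show ?thesis by eventually_elim simp
    qed
  qed
  show ?thesis
  proof (rule presentsI[where R = R])
    fix \<iota> assume \<iota>: "\<iota> \<in> initial_segment \<sigma>"
    then have r: "recursive \<iota>" and less: "eventually (\<lambda>n. \<iota> n < \<sigma> n) at_C" by (auto simp: initial_segment_def)
    consider "\<iota> \<in> Mid" | "\<not> far (\<lambda>_. 0) \<iota>" | "\<not> far \<iota> \<sigma>" using r by (auto simp: Mid_def)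
    then have "\<exists>v. R \<iota> v"
    proof cases
      case 1
      then have "\<not> far \<iota> (\<rho> (Q \<iota>))" "\<not> far (\<rho> (Q \<iota>)) \<iota>"
        using Q(2)[of \<iota> "\<rho> (Q \<iota>)"] Q(2)[of "\<rho> (Q \<iota>)" \<iota>] \<rho> by auto
      then obtain z where "eventually (\<lambda>n. int (\<iota> n) = int (\<rho> (Q \<iota>) n) + z) at_C"
        using near_const[OF r MidD(1)[OF \<rho>(1)]] by blast
      then have "R \<iota> (Inl (Inr (Q \<iota>, z)))" using 1 by (simp add: R_def)
      then show ?thesis ..
    next
      case 2
      then obtain m where "eventually (\<lambda>n. \<iota> n \<le> 0 + m) at_C" by (rule not_far[OF rec0 r])
      then obtain c where "eventually (\<lambda>n. \<iota> n = c) at_C" using recursive_eventually_const[OF r] by auto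
      then have "R \<iota> (Inl (Inl c))" by (simp add: R_def)
      then show ?thesis ..
    next
      case 3
      then obtain m where m: "eventually (\<lambda>n. \<sigma> n \<le> \<iota> n + m) at_C" by (rule not_far[OF r \<sigma>])
      have "eventually (\<lambda>n. \<sigma> n - \<iota> n - 1 \<le> m) at_C" using m by eventually_elim simp
      moreover have "recursive (\<lambda>n. \<sigma> n - \<iota> n - 1)" by (intro computable_diff computable_const \<sigma> r)
      ultimately obtain c where "eventually (\<lambda>n. \<sigma> n - \<iota> n - 1 = c) at_C"
        using recursive_eventually_const[of "\<lambda>n. \<sigma> n - \<iota> n - 1"] by blast
      with less have "eventually (\<lambda>n. \<iota> n + c + 1 = \<sigma> n) at_C" by eventually_elim simp
      then have "R \<iota> (Inr c)" by (simp add: R_def)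
      then show ?thesis ..
    qed
    then show "\<exists>v\<in>fst alpha. R \<iota> v" by (simp add: fst_alpha)
  next
    fix v assume "v \<in> fst alpha"
    consider m where "v = Inl (Inl m)" | q z where "v = Inl (Inr (q, z))" | m where "v = Inr m"
      by (metis sum.exhaust surj_pair)
    then show "\<exists>\<iota>\<in>initial_segment \<sigma>. R \<iota> v"
    proof cases
      case 1
      then show ?thesis using inf
        by (intro bexI[of _ "\<lambda>_. m"]) (auto simp: R_def initial_segment_def computable_const)
    next
      case 2
      \<comment> \<open>Adds the integer \<open>z\<close> in natural numbers; the subtraction is
        exact almost everywhere on \<open>C\<close> because \<open>\<rho> q\<close> exceeds every
        standard number there.\<close>
      define \<iota> where "\<iota> n = \<rho> q n + nat z - nat (- z)" for n
      have rec: "recursive \<iota>" unfolding \<iota>_def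
        by (intro computable_diff computable_add computable_const MidD(1)[OF \<rho>(1)])
      have eq: "eventually (\<lambda>n. int (\<iota> n) = int (\<rho> q n) + z) at_C"
        using MidD(2)[OF \<rho>(1), of "nat (- z)" q] by eventually_elim (auto simp: \<iota>_def)
      have "far (\<lambda>_. 0) \<iota>" unfolding far_def
      proof
        fix m show "\<forall>\<^sub>F n in at_C. 0 + m < \<iota> n"
          using eq MidD(2)[OF \<rho>(1), of "m + nat (- z)" q] by eventually_elim linarith
      qed
      moreover have far: "far \<iota> \<sigma>" unfolding far_def
      proof
        fix m show "\<forall>\<^sub>F n in at_C. \<iota> n + m < \<sigma> n"
          using eq MidD(3)[OF \<rho>(1), of q "m + nat z"] by eventually_elim linarith
      qed
      ultimately have M: "\<iota> \<in> Mid" using rec by (simp add: Mid_def)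
      have "Q \<iota> = q" using shift_near[OF eq] Q(2)[OF M \<rho>(1), of q] Q(2)[OF \<rho>(1) M, of q] \<rho>(2) by auto
      moreover have "\<iota> \<in> initial_segment \<sigma>"
        using rec far unfolding initial_segment_def far_def by (auto dest: spec[of _ 0])
      ultimately show ?thesis using 2 eq M by (auto simp: R_def)
    next
      case 3
      have "R (\<lambda>n. \<sigma> n - Suc m) v" using inf[of m] 3 by (auto simp: R_def elim!: eventually_mono)
      moreover have "(\<lambda>n. \<sigma> n - Suc m) \<in> initial_segment \<sigma>"
        using inf[of 0] \<sigma> by (auto simp: initial_segment_def intro!: computable_diff computable_const elim!: eventually_mono)
      ultimately show ?thesis by blast
    qed
  next
    fix a b v w assume a: "R a v" and b: "R b w" and "less_nat_C a b"
    then have ab: "eventually (\<lambda>n. a n < b n) at_C" by (simp add: less_C_def)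
    then have "eventually (\<lambda>n. a n \<le> b n) at_C" by eventually_elim simp
    moreover have "v \<noteq> w"
    proof
      assume "v = w"
      with a b have "eventually (\<lambda>n. a n = b n) at_C" using uniq by blast
      with ab have "eventually (\<lambda>n. False) at_C" by eventually_elim simp
      then show False by simp
    qed
    ultimately show "(v, w) \<in> snd alpha" using le[OF a b] by blast
  next
    fix a b v w
    assume A: "a \<in> initial_segment \<sigma>" "b \<in> initial_segment \<sigma>" and a: "R a v" and b: "R b w"
      and "\<not> less_nat_C a b" "\<not> less_nat_C b a"
    then have "eventually (\<lambda>n. a n = b n) at_C"
      using not_less_nat_C by (simp add: initial_segment_def)
    then have "eventually (\<lambda>n. a n \<le> b n) at_C" "eventually (\<lambda>n. b n \<le> a n) at_C"
      by (auto elim: eventually_mono)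
    then show "v = w" using le[OF a b] le[OF b a] asym_alpha unfolding asym_ord_def by blast
  qed (rule asym_alpha)
qed

end

section \<open>The construction\<close>

text \<open>
  The number \<open>x = prod_encode (a, b)\<close> codes the dyadic rational \<open>(2 a + 1) / 2 ^ b\<close>. This misses
  the even integers. The color depends on \<open>b\<close> alone, and every color is taken by infinitely many
  \<open>b\<close>, so that it is dense in the positive reals.
\<close>
definition dpos :: "nat \<Rightarrow> real" where
  "dpos x = real (2 * pfst x + 1) / 2 ^ psnd x"

text \<open>The order of the coded rationals after cross-multiplication, which makes its
  decidability immediate.\<close>

definition dlt :: "nat \<Rightarrow> nat \<Rightarrow> bool" where
  "dlt x y \<longleftrightarrow> (2 * pfst x + 1) * 2 ^ psnd y < (2 * pfst y + 1) * 2 ^ psnd x"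

definition dfloor :: "nat \<Rightarrow> nat" where
  "dfloor x = (2 * pfst x + 1) div 2 ^ psnd x"

definition dcolor :: "nat \<Rightarrow> nat" where
  "dcolor x = pfst (psnd x)"

lemma dlt_iff: "dlt x y \<longleftrightarrow> dpos x < dpos y"
proof -
  have cross: "a / b < c / d \<longleftrightarrow> a * d < c * b" if "0 < b" "0 < d" for a b c d :: real
    using that by (simp add: field_simps)
  have "dpos x < dpos y \<longleftrightarrow> real (2 * pfst x + 1) * 2 ^ psnd y < real (2 * pfst y + 1) * 2 ^ psnd x"
    unfolding dpos_def by (rule cross) simp_all
  also have "\<dots> \<longleftrightarrow> real ((2 * pfst x + 1) * 2 ^ psnd y) < real ((2 * pfst y + 1) * 2 ^ psnd x)"
    by (simp only: of_nat_mult of_nat_power of_nat_numeral)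
  also have "\<dots> \<longleftrightarrow> dlt x y" unfolding dlt_def of_nat_less_iff ..
  finally show ?thesis by simp
qed

lemma odd_mult_power_inj:
  fixes m m' :: nat
  assumes "odd m" "odd m'" "m * 2 ^ b' = m' * 2 ^ b"
  shows "b = b' \<and> m = m'"
proof -
  have le: "b' \<le> b" if "odd m'" "m * 2 ^ b' = m' * 2 ^ b" for m m' b b' :: nat
  proof (rule ccontr)
    assume "\<not> b' \<le> b"
    then have "b < b'" by simp
    then obtain j where "b' = Suc (b + j)" using less_imp_Suc_add by blast
    with that(2) have "(2 * m * 2 ^ j) * 2 ^ b = m' * 2 ^ b" by (simp add: power_add mult_ac)
    then have "m' = 2 * m * 2 ^ j" by simp
    then show False using that(1) by simp
  qed
  have "b = b'" using le[OF assms(2,3)] le[OF assms(1) assms(3)[symmetric]] by simp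
  then show ?thesis using assms(3) by simp
qed

lemma dpos_inj: "dpos x = dpos y \<Longrightarrow> x = y"
proof -
  assume "dpos x = dpos y"
  then have "real (2 * pfst x + 1) * 2 ^ psnd y = real (2 * pfst y + 1) * 2 ^ psnd x"
    unfolding dpos_def by (subst (asm) frac_eq_eq) simp_all
  then have "real ((2 * pfst x + 1) * 2 ^ psnd y) = real ((2 * pfst y + 1) * 2 ^ psnd x)"
    by (simp only: of_nat_mult of_nat_power of_nat_numeral)
  then have "(2 * pfst x + 1) * 2 ^ psnd y = (2 * pfst y + 1) * 2 ^ psnd x" unfolding of_nat_eq_iff .
  from odd_mult_power_inj[OF _ _ this] have "pfst x = pfst y" "psnd x = psnd y" by auto
  then show "x = y" by (metis prod_encode_pfst_psnd)
qed

lemma dfloor_bounds: "real (dfloor x) \<le> dpos x" "dpos x < real (dfloor x) + 1"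
proof -
  let ?m = "2 * pfst x + 1" and ?n = "2 ^ psnd x :: nat"
  have "dfloor x * ?n \<le> ?m" unfolding dfloor_def by (rule div_times_less_eq_dividend)
  then have "real (dfloor x) * real ?n \<le> real ?m" by (metis of_nat_le_iff of_nat_mult)
  then show "real (dfloor x) \<le> dpos x" by (simp add: dpos_def field_simps)
  have "?m < (dfloor x + 1) * ?n" unfolding dfloor_def
    using dividend_less_div_times[of ?n ?m] by (simp add: add.commute)
  then have "real ?m < real (dfloor x + 1) * real ?n" by (metis of_nat_less_iff of_nat_mult)
  then show "dpos x < real (dfloor x) + 1" by (simp add: dpos_def field_simps)
qed

lemma dlt_irrefl: "\<not> dlt x x"
  by (simp add: dlt_iff)

lemma dfloor_mono: "dlt x y \<Longrightarrow> dfloor x \<le> dfloor y"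
  using dfloor_bounds[of x] dfloor_bounds[of y] unfolding dlt_iff by linarith

lemma dfloor_eqI: "real d \<le> dpos x \<Longrightarrow> dpos x < real d + 1 \<Longrightarrow> dfloor x = d"
  using dfloor_bounds[of x] by linarith

text \<open>The exponent can be chosen with the prescribed color and so large that two steps of size
  \<open>1 / 2 ^ b\<close> fit into the gap; one of two consecutive numerators is odd.\<close>

lemma dlt_dense:
  assumes "0 \<le> u" "u < v"
  shows "\<exists>z. u < dpos z \<and> dpos z < v \<and> dcolor z = k"
proof -
  obtain j :: nat where j: "2 / (v - u) < real j" using reals_Archimedean2 by blast
  \<comment> \<open>The first component of \<open>b\<close> is the color \<open>k\<close>. Since
    \<open>b \<ge> j\<close>, the denominator \<open>2 ^ b\<close> exceeds \<open>j\<close>.\<close>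
  define b where "b = prod_encode (k, j)"
  define N :: real where "N = 2 ^ b"
  have "j < 2 ^ j" by simp
  also have "(2::nat) ^ j \<le> 2 ^ b" unfolding b_def by (intro power_increasing le_prod_encode_2) auto
  finally have "real j < N" unfolding N_def by (metis of_nat_less_iff of_nat_numeral of_nat_power)
  then have N: "2 / (v - u) < N" using j by simp
  then have gap: "u * N + 2 < v * N" using assms(2) by (simp add: field_simps)
  define m where "m = nat \<lfloor>u * N\<rfloor>"
  have "0 \<le> u * N" using assms(1) by (simp add: N_def)
  then have m: "real m \<le> u * N" "u * N < real m + 1" unfolding m_def by linarith+
  \<comment> \<open>With this choice \<open>2 * a + 1\<close> is the least odd number above
    \<open>m\<close>.\<close>
  define a where "a = (if even m then m div 2 else (m + 1) div 2)"
  have "m + 1 \<le> 2 * a + 1" "2 * a + 1 \<le> m + 2" unfolding a_def by (auto elim: oddE)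
  then have a: "real m + 1 \<le> real (2 * a + 1)" "real (2 * a + 1) \<le> real m + 2" by linarith+
  define z where "z = prod_encode (a, b)"
  have "dpos z = real (2 * a + 1) / N" by (simp add: z_def dpos_def N_def)
  moreover have "0 < N" by (simp add: N_def)
  ultimately have "u * N < dpos z * N" "dpos z * N < v * N" using a m gap by simp_all
  with \<open>0 < N\<close> have "u < dpos z" "dpos z < v" by simp_all
  moreover have "dcolor z = k" by (simp add: z_def dcolor_def b_def)
  ultimately show ?thesis by blast
qed

lemma dpos_nonneg: "0 \<le> dpos x" by (simp add: dpos_def)

lemma dlt_between: "dlt x y \<Longrightarrow> \<exists>z. dlt x z \<and> dlt z y \<and> dcolor z = k"
  unfolding dlt_iff by (rule dlt_dense[OF dpos_nonneg])

lemma dfloor_color: "\<exists>z. dfloor z = d \<and> dcolor z = k"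
  using dlt_dense[of "real d" "real d + 1" k] dfloor_eqI[of d] by (auto intro: less_imp_le)

lemma dfloor_less: "dfloor x < dfloor y \<Longrightarrow> dlt x y"
  using dfloor_bounds[of x] dfloor_bounds[of y] unfolding dlt_iff by linarith

lemma decidable_dlt: "decidable 2 (\<lambda>xs. dlt (xs ! 0) (xs ! 1))"
  unfolding dlt_def
  by (intro decidable_less computable_mult computable_add computable_power computable_const
      computable_pfst computable_psnd computable_nth) auto

lemma computable_dfloor: "total_computable k f \<Longrightarrow> total_computable k (\<lambda>xs. dfloor (f xs))"
  unfolding dfloor_def
  by (intro computable_div computable_mult computable_add computable_power computable_const
      computable_pfst computable_psnd) auto

lemma computable_dcolor: "total_computable k f \<Longrightarrow> total_computable k (\<lambda>xs. dcolor (f xs))"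
  unfolding dcolor_def by (intro computable_pfst computable_psnd)

lemma strict_weak_dlt: "strict_weak_on UNIV dlt"
  unfolding strict_weak_on_def dlt_iff by auto

lemma dlt_total: "\<not> dlt x y \<Longrightarrow> \<not> dlt y x \<Longrightarrow> x = y"
  unfolding dlt_iff by (intro dpos_inj) auto

section \<open>Blocks and the lexicographic order of their points\<close>

definition block_size :: "nat \<Rightarrow> nat" where
  "block_size x = (if dcolor x = 0 then Suc (dfloor x) else dcolor x)"

lemma computable_block_size: "total_computable k f \<Longrightarrow> total_computable k (\<lambda>xs. block_size (f xs))"
  unfolding block_size_def
  by (intro computable_if decidable_eq computable_Suc computable_dfloor computable_dcolor computable_const)

lemma block_size_pos: "0 < block_size x" by (simp add: block_size_def)

definition plt :: "nat \<Rightarrow> nat \<Rightarrow> bool" where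
  "plt w v \<longleftrightarrow> dlt (pfst w) (pfst v) \<or> pfst w = pfst v \<and> psnd w < psnd v"

lemma decidable_plt: "decidable 2 (\<lambda>xs. plt (xs ! 0) (xs ! 1))"
  unfolding plt_def
  by (intro decidable_disj decidable_conj decidable_app2[OF decidable_dlt] decidable_eq decidable_less
      computable_pfst computable_psnd computable_nth) auto

lemma strict_weak_plt: "strict_weak_on UNIV plt"
proof -
  have "plt w v \<longleftrightarrow> dpos (pfst w) < dpos (pfst v) \<or> dpos (pfst w) = dpos (pfst v) \<and> psnd w < psnd v"
    for w v unfolding plt_def dlt_iff using dpos_inj by auto
  then show ?thesis unfolding strict_weak_on_def by auto
qed

lemma plt_total: "\<not> plt w v \<Longrightarrow> \<not> plt v w \<Longrightarrow> w = v"
proof -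
  assume "\<not> plt w v" "\<not> plt v w"
  then have "pfst w = pfst v" "psnd w = psnd v" unfolding plt_def using dlt_total by (auto intro: linorder_neqE_nat)
  then show "w = v" by (metis prod_encode_pfst_psnd)
qed

text \<open>The color 0 is free to stand for \<open>alpha\<close> because 0 is not in
  \<open>X\<close>.\<close>

definition color_order :: "nat \<Rightarrow> ((nat + rat \<times> int) + nat) ord" where
  "color_order k = (if k = 0 then alpha else ord_image (Inl \<circ> Inl) (fin_ord k))"

lemma inj_Inl_Inl: "inj (Inl \<circ> Inl)" by (auto simp: inj_def)

lemma asym_color_order: "asym_ord (color_order k)"
  by (simp add: color_order_def asym_alpha asym_ord_image[OF inj_Inl_Inl] asym_fin_ord)

text \<open>\<open>E k d\<close> says that \<open>k\<close> passes the tests up to \<open>d\<close> of the \<open>\<Pi>\<^sub>2\<close> definition of \<open>X\<close>.\<close>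
locale shuffled_power = co_ce_cohesive C for C +
  fixes E :: "nat \<Rightarrow> nat \<Rightarrow> bool" and X :: "nat set"
  assumes E: "semidecidable 2 (\<lambda>xs. E (xs ! 0) (xs ! 1))"
    and E_mono: "E k d \<Longrightarrow> d' \<le> d \<Longrightarrow> E k d'"
    and X: "X = {k. \<forall>d. E k d}" and X0: "0 \<notin> X"
begin

text \<open>The bound combines two estimates for a recursive \<zeta> whose integer part is at least
  \<psi>, where \<psi> tends to infinity along \<open>C\<close>:
  \<open>count (\<zeta> n) \<le> Suc (count n)\<close> and
  \<open>count n \<le> 2 * \<psi> n\<close>.\<close>

definition admissible :: "nat \<Rightarrow> bool" where
  "admissible x \<longleftrightarrow> count x \<le> Suc (2 * dfloor x) \<and> (dcolor x = 0 \<or> E (dcolor x) (dfloor x))"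

definition member :: "nat \<Rightarrow> bool" where
  "member w \<longleftrightarrow> admissible (pfst w) \<and> psnd w < block_size (pfst w)"

lemma semidecidable_member: "semidecidable 1 (\<lambda>xs. member (xs ! 0))"
  unfolding member_def admissible_def
  by (intro semidecidable_conj semidecidable_disj semidecidable_app2[OF semidecidable_count]
      semidecidable_app2[OF E] semidecidable_decidable[OF decidable_eq]
      semidecidable_decidable[OF decidable_less] computable_block_size computable_Suc computable_mult
      computable_const computable_dfloor computable_dcolor computable_pfst computable_psnd computable_nth) auto

lemma finite_count_le: "finite {x. count x \<le> m}"
proof -
  obtain B where B: "finite B" "card B = Suc m" "B \<subseteq> C"
    using infinite_arbitrarily_large[OF infinite_C] by blast
  then obtain N where N: "B \<subseteq> {..<N}" using finite_nat_iff_bounded by blast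
  have "{x. count x \<le> m} \<subseteq> {..<N}"
  proof
    fix x assume x: "x \<in> {x. count x \<le> m}"
    show "x \<in> {..<N}"
    proof (rule ccontr)
      assume "x \<notin> {..<N}"
      then have "B \<subseteq> C \<inter> {..<x}" using B N by auto
      then have "Suc m \<le> count x" unfolding count_def B(2)[symmetric] by (intro card_mono) auto
      then show False using x by simp
    qed
  qed
  then show ?thesis using finite_subset by blast
qed

lemma finite_level: "finite {w. member w \<and> dfloor (pfst w) \<le> d}"
proof -
  have "{w. member w \<and> dfloor (pfst w) \<le> d} \<subseteq>
      prod_encode ` (SIGMA x:{x. count x \<le> Suc (2 * d)}. {..<block_size x})"
  proof
    fix w assume "w \<in> {w. member w \<and> dfloor (pfst w) \<le> d}"
    then have "(pfst w, psnd w) \<in> (SIGMA x:{x. count x \<le> Suc (2 * d)}. {..<block_size x})"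
      by (auto simp: member_def admissible_def)
    then show "w \<in> prod_encode ` (SIGMA x:{x. count x \<le> Suc (2 * d)}. {..<block_size x})"
      by (metis image_eqI prod_encode_pfst_psnd)
  qed
  moreover have "finite (prod_encode ` (SIGMA x:{x. count x \<le> Suc (2 * d)}. {..<block_size x}))"
    using finite_count_le by auto
  ultimately show ?thesis by (rule finite_subset)
qed

section \<open>Nonstandard blocks as a dense colored order\<close>

lemma eventually_admissible:
  assumes z: "recursive \<zeta>" and p: "recursive \<psi>" "\<And>d. eventually (\<lambda>n. \<psi> n \<noteq> d) at_C"
    and le: "eventually (\<lambda>n. \<psi> n \<le> dfloor (\<zeta> n)) at_C"
    and k: "eventually (\<lambda>n. dcolor (\<zeta> n) = k) at_C" "k \<in> insert 0 X"
  shows "eventually (\<lambda>n. admissible (\<zeta> n)) at_C"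
  using count_recursive[OF z] count_le_double[OF p] le k(1)
proof eventually_elim
  case (elim n)
  then show ?case using k(2) X unfolding admissible_def by auto
qed

text \<open>The nonstandard points of the dyadic order: avoiding each standard integer part almost
  everywhere means exceeding each of them almost everywhere. Points with a standard integer part
  belong to the initial \<omega>.\<close>

definition blocks :: "(nat \<Rightarrow> nat) set" where
  "blocks = {\<xi>. recursive \<xi> \<and> eventually (\<lambda>n. admissible (\<xi> n)) at_C \<and>
     (\<forall>d. eventually (\<lambda>n. dfloor (\<xi> n) \<noteq> d) at_C)}"

text \<open>A color that is not constant almost everywhere avoids each value almost everywhere, so
  the block size is nonstandard and the block has the same type as for color 0.\<close>

definition block_order :: "(nat \<Rightarrow> nat) \<Rightarrow> ((nat + rat \<times> int) + nat) ord" where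
  "block_order \<xi> = (if \<exists>k. eventually (\<lambda>n. dcolor (\<xi> n) = k) at_C
     then color_order (SOME k. eventually (\<lambda>n. dcolor (\<xi> n) = k) at_C) else alpha)"

lemma eventually_const_unique:
  assumes "eventually (\<lambda>n. f n = a) at_C" "eventually (\<lambda>n. f n = b) at_C" shows "a = b"
proof -
  have "eventually (\<lambda>n. a = b) at_C" using assms by eventually_elim simp
  then show ?thesis by simp
qed

lemma block_order_const:
  assumes "eventually (\<lambda>n. dcolor (\<xi> n) = k) at_C" shows "block_order \<xi> = color_order k"
proof -
  have "(SOME k. eventually (\<lambda>n. dcolor (\<xi> n) = k) at_C) = k"
  proof (rule some_equality)
    fix j assume "eventually (\<lambda>n. dcolor (\<xi> n) = j) at_C"
    then show "j = k" using assms by (rule eventually_const_unique[of "\<lambda>n. dcolor (\<xi> n)"])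
  qed (fact assms)
  moreover have "\<exists>k. eventually (\<lambda>n. dcolor (\<xi> n) = k) at_C" using assms ..
  ultimately show ?thesis unfolding block_order_def by (simp only: if_True)
qed

lemma with_alpha_eq: "with_alpha X = color_order ` insert 0 X"
proof -
  have "color_order k = ord_image (Inl \<circ> Inl) (fin_ord k)" if "k \<in> X" for k
    using that X0 by (cases k) (auto simp: color_order_def)
  then have "color_order ` X = (\<lambda>k. ord_image (Inl \<circ> Inl) (fin_ord k)) ` X" by (rule image_cong[OF refl])
  moreover have "color_order 0 = alpha" by (simp add: color_order_def)
  ultimately show ?thesis by (simp add: with_alpha_def)
qed

text \<open>The common core of nonemptiness and the three density properties. The requirement
  \<open>P\<close> places the new point; it must force a lower bound \<psi> on the integer part that
  is recursive and tends to infinity along \<open>C\<close>, and this makes the point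
  admissible.\<close>

lemma block_choice:
  assumes P: "decidable 2 (\<lambda>xs. P (xs ! 0) (xs ! 1))"
    and ex: "eventually (\<lambda>n. \<exists>z. P n z \<and> dcolor z = k) at_C"
    and le: "\<And>\<zeta>. eventually (\<lambda>n. P n (\<zeta> n)) at_C \<Longrightarrow> eventually (\<lambda>n. \<psi> n \<le> dfloor (\<zeta> n)) at_C"
    and p: "recursive \<psi>" "\<And>d. eventually (\<lambda>n. \<psi> n \<noteq> d) at_C" and k: "k \<in> insert 0 X"
  shows "\<exists>\<zeta>\<in>blocks. eventually (\<lambda>n. P n (\<zeta> n)) at_C \<and> block_order \<zeta> = color_order k"
proof -
  have "semidecidable 2 (\<lambda>xs. P (xs ! 0) (xs ! 1) \<and> dcolor (xs ! 1) = k)"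
    by (intro semidecidable_decidable decidable_conj P decidable_eq computable_dcolor computable_const
        computable_nth) auto
  from recursive_choice[of "\<lambda>n z. P n z \<and> dcolor z = k", OF this ex]
  obtain \<zeta> where z: "recursive \<zeta>" and "eventually (\<lambda>n. P n (\<zeta> n) \<and> dcolor (\<zeta> n) = k) at_C" by blast
  then have Pz: "eventually (\<lambda>n. P n (\<zeta> n)) at_C" and kz: "eventually (\<lambda>n. dcolor (\<zeta> n) = k) at_C"
    by (simp_all add: eventually_conj_iff)
  have "eventually (\<lambda>n. dfloor (\<zeta> n) \<noteq> d) at_C" for d
    using le[OF Pz] eventually_less_const[OF p(2), of d] by eventually_elim simp
  moreover have "eventually (\<lambda>n. admissible (\<zeta> n)) at_C"
    using eventually_admissible[OF z p le[OF Pz] kz k] .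
  ultimately have "\<zeta> \<in> blocks" using z by (simp add: blocks_def)
  then show ?thesis using Pz block_order_const[OF kz] by blast
qed

lemma blocks_nonempty:
  assumes "k \<in> insert 0 X"
  shows "\<exists>\<zeta>\<in>blocks. eventually (\<lambda>n. dfloor (\<zeta> n) = n) at_C \<and> block_order \<zeta> = color_order k"
proof (rule block_choice[where \<psi> = "\<lambda>n. n"])
  show "decidable 2 (\<lambda>xs. dfloor (xs ! 1) = xs ! 0)"
    by (intro decidable_eq computable_dfloor computable_nth) auto
  show "eventually (\<lambda>n. \<exists>z. dfloor z = n \<and> dcolor z = k) at_C" using dfloor_color by simp
  show "eventually (\<lambda>n. n \<noteq> d) at_C" for d
    using eventually_at_C_ge[of "Suc d"] by eventually_elim simp
  show "k \<in> insert 0 X" by fact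
qed (auto intro: computable_nth elim: eventually_mono)

lemma blocks_dense: "dense_colored (with_alpha X) blocks (less_C dlt) block_order"
proof
  have sub: "blocks \<subseteq> {g. recursive g}" by (auto simp: blocks_def)
  then show "countable blocks" using countable_total_computable by (rule countable_subset)
  show "blocks \<noteq> {}" using blocks_nonempty[of 0] by auto
  show "strict_weak_on blocks (less_C dlt)"
    by (rule strict_weak_on_subset[OF strict_weak_on_less_C[OF decidable_dlt strict_weak_dlt] sub])
  fix a assume a: "a \<in> blocks"
  then have ra: "recursive a" and adm: "eventually (\<lambda>n. admissible (a n)) at_C"
    and fl: "\<And>d. eventually (\<lambda>n. dfloor (a n) \<noteq> d) at_C" by (auto simp: blocks_def)
  show "block_order a \<in> with_alpha X"
  proof (cases "\<exists>k. eventually (\<lambda>n. dcolor (a n) = k) at_C")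
    case True
    then obtain k where k: "eventually (\<lambda>n. dcolor (a n) = k) at_C" by blast
    \<comment> \<open>A color outside \<open>X\<close> fails the tests up to some standard
      \<open>d\<close>. By monotonicity it fails at all larger integer parts, hence almost
      everywhere on a nonstandard block.\<close>
    have "k \<in> insert 0 X"
    proof (rule ccontr)
      assume "k \<notin> insert 0 X"
      then obtain d where d: "\<not> E k d" "k \<noteq> 0" using X by auto
      have "eventually (\<lambda>n. False) at_C" using k adm eventually_less_const[OF fl, of d]
        by eventually_elim (use d E_mono[OF _ less_imp_le, of k _ d] in \<open>auto simp: admissible_def\<close>)
      then show False by simp
    qed
    then show ?thesis unfolding with_alpha_eq block_order_const[OF k] by (rule imageI)
  next
    case False
    then show ?thesis by (simp add: block_order_def with_alpha_def)
  qed
  have rfl: "recursive (\<lambda>n. dfloor (a n))" by (intro computable_dfloor ra)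
  {
    fix b assume b: "b \<in> blocks"
    then have rb: "recursive b" by (auto simp: blocks_def)
    show "block_order a = block_order b" if "\<not> less_C dlt a b" "\<not> less_C dlt b a"
    proof -
      have ab: "eventually (\<lambda>n. a n = b n) at_C"
        using incomparable_C[OF decidable_dlt ra rb dlt_irrefl dlt_total] that by simp
      have "eventually (\<lambda>n. dcolor (a n) = k) at_C \<longleftrightarrow> eventually (\<lambda>n. dcolor (b n) = k) at_C" for k
        by (rule eventually_cong[OF ab]) simp
      then show ?thesis unfolding block_order_def by simp
    qed
  }
  fix s assume "s \<in> with_alpha X"
  then obtain k where k: "k \<in> insert 0 X" "s = color_order k"
    unfolding with_alpha_eq by blast
  have d1: "decidable 2 (\<lambda>xs. dlt (a (xs ! 0)) (xs ! 1))"
    by (intro decidable_app2[OF decidable_dlt] computable_app1[OF ra] computable_nth) auto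
  show "\<exists>x\<in>blocks. less_C dlt a x \<and> block_order x = s" unfolding k(2) less_C_def
  \<comment> \<open>A point above \<open>a n\<close> has at least the integer part of
    \<open>a n\<close>, which therefore serves as \<psi>. The same choice works for the points
    between two blocks.\<close>
  proof (rule block_choice[where P = "\<lambda>n. dlt (a n)", OF d1 _ _ rfl fl k(1)])
    have "\<exists>z. dlt (a n) z \<and> dcolor z = k" for n
      using dfloor_color[of "Suc (dfloor (a n))" k] dfloor_less by (metis lessI)
    then show "eventually (\<lambda>n. \<exists>z. dlt (a n) z \<and> dcolor z = k) at_C" by simp
  qed (auto elim: eventually_mono dest: dfloor_mono)
  show "\<exists>x\<in>blocks. less_C dlt x a \<and> block_order x = s"
  proof -
    \<comment> \<open>Lowering a nonstandard integer part by one leaves it nonstandard, so there is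
      no least block in any color.\<close>
    have "\<exists>x\<in>blocks. eventually (\<lambda>n. dfloor (x n) = dfloor (a n) - 1) at_C \<and> block_order x = color_order k"
    proof (rule block_choice[where \<psi> = "\<lambda>n. dfloor (a n) - 1"])
      show "decidable 2 (\<lambda>xs. dfloor (xs ! 1) = dfloor (a (xs ! 0)) - 1)"
        by (intro decidable_eq computable_dfloor computable_diff computable_const computable_app1[OF ra]
            computable_nth) auto
      show "eventually (\<lambda>n. \<exists>z. dfloor z = dfloor (a n) - 1 \<and> dcolor z = k) at_C" using dfloor_color by simp
      show "recursive (\<lambda>n. dfloor (a n) - 1)" by (intro computable_diff computable_const rfl)
      show "eventually (\<lambda>n. dfloor (a n) - 1 \<noteq> d) at_C" for d
        using eventually_less_const[OF fl, of "d + 1"] by eventually_elim simp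
      show "k \<in> insert 0 X" by (rule k(1))
    qed (auto elim: eventually_mono)
    then obtain x where x: "x \<in> blocks" "eventually (\<lambda>n. dfloor (x n) = dfloor (a n) - 1) at_C"
      "block_order x = color_order k" by blast
    have "less_C dlt x a" unfolding less_C_def using x(2) eventually_less_const[OF fl, of 0]
      by eventually_elim (auto intro: dfloor_less)
    then show ?thesis using x k by blast
  qed
  fix b assume b: "b \<in> blocks" and ab: "less_C dlt a b"
  then have rb: "recursive b" by (auto simp: blocks_def)
  have d2: "decidable 2 (\<lambda>xs. dlt (a (xs ! 0)) (xs ! 1) \<and> dlt (xs ! 1) (b (xs ! 0)))"
    by (intro decidable_conj d1 decidable_app2[OF decidable_dlt] computable_app1[OF rb] computable_nth) auto
  have "\<exists>x\<in>blocks. eventually (\<lambda>n. dlt (a n) (x n) \<and> dlt (x n) (b n)) at_C \<and> block_order x = color_order k"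
  proof (rule block_choice[where P = "\<lambda>n z. dlt (a n) z \<and> dlt z (b n)", OF d2 _ _ rfl fl k(1)])
    show "eventually (\<lambda>n. \<exists>z. (dlt (a n) z \<and> dlt z (b n)) \<and> dcolor z = k) at_C"
      using ab unfolding less_C_def by eventually_elim (use dlt_between in blast)
  qed (auto elim: eventually_mono dest: dfloor_mono)
  then show "\<exists>x\<in>blocks. less_C dlt a x \<and> less_C dlt x b \<and> block_order x = s"
    unfolding less_C_def k(2) by (simp add: eventually_conj_iff)
qed

lemma initial_segment_finite:
  assumes "eventually (\<lambda>n. \<sigma> n = k) at_C"
  shows "\<exists>P. presents (initial_segment \<sigma>) less_nat_C
    (ord_image (Inl \<circ> Inl) (fin_ord k) :: ((nat + rat \<times> int) + nat) ord) P"
proof -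
  let ?T = "ord_image (Inl \<circ> Inl) (fin_ord k) :: ((nat + rat \<times> int) + nat) ord"
  define R where "R \<iota> v \<longleftrightarrow> (\<exists>i. v = Inl (Inl i) \<and> eventually (\<lambda>n. \<iota> n = i) at_C)"
    for \<iota> and v :: "(nat + rat \<times> int) + nat"
  have fst: "fst ?T = (Inl \<circ> Inl) ` {..<k}" by (simp add: ord_image_def fin_ord_def)
  have rel: "(Inl (Inl i), Inl (Inl j)) \<in> snd ?T \<longleftrightarrow> i < j \<and> j < k" for i j
    using snd_ord_image[OF inj_Inl_Inl, of i j "fin_ord k"] by (simp add: fin_ord_def)
  show ?thesis
  proof (rule presentsI[where R = R])
    fix \<iota> assume "\<iota> \<in> initial_segment \<sigma>"
    then have i: "recursive \<iota>" "eventually (\<lambda>n. \<iota> n < \<sigma> n) at_C" by (auto simp: initial_segment_def)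
    have b: "eventually (\<lambda>n. \<iota> n < k) at_C" using i(2) assms by eventually_elim simp
    then have "eventually (\<lambda>n. \<iota> n \<le> k) at_C" by eventually_elim simp
    then obtain c where c: "eventually (\<lambda>n. \<iota> n = c) at_C" using recursive_eventually_const[OF i(1)] by blast
    with b have "eventually (\<lambda>n. c < k) at_C" by eventually_elim simp
    then show "\<exists>v\<in>fst ?T. R \<iota> v" using c by (auto simp: fst R_def)
  next
    fix v assume "v \<in> fst ?T"
    then obtain i where i: "i < k" "v = Inl (Inl i)" by (auto simp: fst)
    have "eventually (\<lambda>n. i < \<sigma> n) at_C" using assms by eventually_elim (use i in simp)
    then show "\<exists>\<iota>\<in>initial_segment \<sigma>. R \<iota> v"
      using i by (intro bexI[of _ "\<lambda>_. i"]) (auto simp: R_def initial_segment_def computable_const)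
  next
    fix a b v w assume a: "R a v" and b: "R b w" and w: "w \<in> fst ?T" and "less_nat_C a b"
    then have ab: "eventually (\<lambda>n. a n < b n) at_C" by (simp add: less_C_def)
    obtain i j where i: "v = Inl (Inl i)" "eventually (\<lambda>n. a n = i) at_C"
      and j: "w = Inl (Inl j)" "eventually (\<lambda>n. b n = j) at_C" using a b by (auto simp: R_def)
    have "eventually (\<lambda>n. i < j) at_C" using i(2) j(2) ab by eventually_elim simp
    then show "(v, w) \<in> snd ?T" using w unfolding i j rel by (auto simp: fst)
  next
    fix a b v w assume A: "a \<in> initial_segment \<sigma>" "b \<in> initial_segment \<sigma>" and a: "R a v" and b: "R b w"
      and "\<not> less_nat_C a b" "\<not> less_nat_C b a"
    then have ab: "eventually (\<lambda>n. a n = b n) at_C"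
      using not_less_nat_C by (simp add: initial_segment_def)
    obtain i j where i: "v = Inl (Inl i)" "eventually (\<lambda>n. a n = i) at_C"
      and j: "w = Inl (Inl j)" "eventually (\<lambda>n. b n = j) at_C" using a b by (auto simp: R_def)
    have "eventually (\<lambda>n. i = j) at_C" using i(2) j(2) ab by eventually_elim simp
    then show "v = w" unfolding i j by simp
  qed (rule asym_ord_image[OF inj_Inl_Inl asym_fin_ord])
qed

lemma block_presentation:
  assumes "\<xi> \<in> blocks"
  shows "\<exists>P. presents (initial_segment (\<lambda>n. block_size (\<xi> n))) less_nat_C (block_order \<xi>) P"
proof -
  have r: "recursive \<xi>" and fl: "\<And>d. eventually (\<lambda>n. dfloor (\<xi> n) \<noteq> d) at_C"
    using assms by (auto simp: blocks_def)
  have rs: "recursive (\<lambda>n. block_size (\<xi> n))" by (intro computable_block_size r)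
  show ?thesis
  proof (cases "\<exists>k. k \<noteq> 0 \<and> eventually (\<lambda>n. dcolor (\<xi> n) = k) at_C")
    case True
    then obtain k where k: "k \<noteq> 0" "eventually (\<lambda>n. dcolor (\<xi> n) = k) at_C" by blast
    have "eventually (\<lambda>n. block_size (\<xi> n) = k) at_C"
      using k(2) by eventually_elim (use k(1) in \<open>simp add: block_size_def\<close>)
    then show ?thesis
      using initial_segment_finite block_order_const[OF k(2)] k(1) by (simp add: color_order_def)
  next
    case False
    have "block_order \<xi> = alpha"
    proof (cases "eventually (\<lambda>n. dcolor (\<xi> n) = 0) at_C")
      case True
      then show ?thesis by (simp add: block_order_const color_order_def)
    next
      case F: False
      then have "\<nexists>k. eventually (\<lambda>n. dcolor (\<xi> n) = k) at_C" using False by metis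
      then show ?thesis by (simp add: block_order_def)
    qed
    moreover have "eventually (\<lambda>n. m < block_size (\<xi> n)) at_C" for m
    proof (rule eventually_less_const)
      fix d
      \<comment> \<open>A block has size \<open>d > 0\<close> only if its color is \<open>d\<close>,
        or if its color is 0 and its integer part is \<open>d - 1\<close>. Each alternative is
        excluded almost everywhere.\<close>
      show "eventually (\<lambda>n. block_size (\<xi> n) \<noteq> d) at_C"
      proof (cases "d = 0")
        case True
        then show ?thesis using block_size_pos by simp
      next
        case d: False
        have "semidecidable 1 (\<lambda>xs. dcolor (\<xi> (xs ! 0)) = d)"
          by (intro semidecidable_decidable decidable_eq computable_dcolor r computable_const)
        then have "eventually (\<lambda>n. dcolor (\<xi> n) \<noteq> d) at_C"
          using dichotomy[of "\<lambda>n. dcolor (\<xi> n) = d"] d False by blast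
        with fl[of "d - 1"] show ?thesis by eventually_elim (auto simp: block_size_def)
      qed
    qed
    ultimately show ?thesis using initial_segment_alpha[OF rs] by simp
  qed
qed

section \<open>Standard and nonstandard germs of the constructed order\<close>

lemma infinite_member: "infinite {w. member w}"
proof
  assume fin: "finite {w. member w}"
  obtain \<zeta> where z: "\<zeta> \<in> blocks" "eventually (\<lambda>n. dfloor (\<zeta> n) = n) at_C"
    using blocks_nonempty[of 0] by blast
  obtain b where b: "\<And>x. x \<in> (\<lambda>w. dfloor (pfst w)) ` {w. member w} \<Longrightarrow> x < b"
    using fin finite_nat_set_iff_bounded by (metis finite_imageI)
  have "eventually (\<lambda>n. admissible (\<zeta> n)) at_C" using z by (simp add: blocks_def)
  with z(2) eventually_at_C_ge[of b] have "eventually (\<lambda>n. False) at_C"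
  proof eventually_elim
    case (elim n)
    then have "member (prod_encode (\<zeta> n, 0))" by (simp add: member_def block_size_pos)
    then have "dfloor (\<zeta> n) \<in> (\<lambda>w. dfloor (pfst w)) ` {w. member w}"
      by (intro image_eqI[of _ _ "prod_encode (\<zeta> n, 0)"]) auto
    from b[OF this] elim show ?case by simp
  qed
  then show False by simp
qed

lemma plt_dfloor: "plt v w \<Longrightarrow> dfloor (pfst v) \<le> dfloor (pfst w)"
  by (auto simp: plt_def dest: dfloor_mono)

lemma member_omega: "presents {w. member w} plt omega (\<lambda>w. card {v \<in> {w. member w}. plt v w})"
proof (rule presents_omega)
  show "strict_weak_on {w. member w} plt" by (rule strict_weak_on_subset[OF strict_weak_plt]) auto
  show "finite {b \<in> {w. member w}. plt b a}" for a
    by (rule finite_subset[OF _ finite_level[of "dfloor (pfst a)"]]) (auto dest: plt_dfloor)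
qed (use plt_total infinite_member in auto)


text \<open>If some integer part is not avoided almost everywhere, the dichotomy makes it constant.
  The germ then takes almost all its values on \<open>C\<close> in a finite level, so it is constant
  itself.\<close>

lemma germ_cases:
  assumes g: "g \<in> germs member"
  shows "(\<exists>w. member w \<and> eventually (\<lambda>n. g n = w) at_C) \<or>
    (\<lambda>n. pfst (g n)) \<in> blocks"
proof (cases "\<forall>d. eventually (\<lambda>n. dfloor (pfst (g n)) \<noteq> d) at_C")
  case True
  have "eventually (\<lambda>n. member (g n)) at_C" using g by (simp add: germs_def)
  then have "eventually (\<lambda>n. admissible (pfst (g n))) at_C" by eventually_elim (simp add: member_def)
  moreover have "recursive (\<lambda>n. pfst (g n))" using g by (auto simp: germs_def intro: computable_pfst)
  ultimately show ?thesis using True by (simp add: blocks_def)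
next
  case False
  have r: "recursive g" and mem: "eventually (\<lambda>n. member (g n)) at_C" using g by (simp_all add: germs_def)
  obtain d where d: "\<not> eventually (\<lambda>n. dfloor (pfst (g n)) \<noteq> d) at_C" using False by blast
  have "semidecidable 1 (\<lambda>xs. dfloor (pfst (g (xs ! 0))) = d)"
    by (intro semidecidable_decidable decidable_eq computable_dfloor computable_pfst r computable_const)
  then have "eventually (\<lambda>n. dfloor (pfst (g n)) = d) at_C"
    using dichotomy[of "\<lambda>n. dfloor (pfst (g n)) = d"] d by blast
  with mem have "eventually (\<lambda>n. g n \<le> Max {w. member w \<and> dfloor (pfst w) \<le> d}) at_C"
    by eventually_elim (intro Max_ge finite_level, simp)
  then obtain w where w: "eventually (\<lambda>n. g n = w) at_C" using recursive_eventually_const[OF r] by blast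
  with mem have "eventually (\<lambda>n. member w) at_C" by eventually_elim simp
  then show ?thesis using w by auto
qed

lemma block_not_const:
  assumes "(\<lambda>n. pfst (g n)) \<in> blocks"
  shows "\<not> eventually (\<lambda>n. dfloor (pfst (g n)) \<le> d) at_C"
proof
  assume "eventually (\<lambda>n. dfloor (pfst (g n)) \<le> d) at_C"
  moreover have "eventually (\<lambda>n. d < dfloor (pfst (g n))) at_C"
    using assms by (intro eventually_less_const) (simp add: blocks_def)
  ultimately have "eventually (\<lambda>n. False) at_C" by eventually_elim simp
  then show False by simp
qed

text \<open>Constant germs give the initial \<omega>. For any other germ the first component is a
  nonstandard block, placed at a rational by the colored form of Cantor's theorem, and the second
  component is a position in that block, which has the type of its color.\<close>

lemma germs_presentation:
  assumes c: "dense_coloring (with_alpha X) c"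
  shows "\<exists>G. presents (germs member) (less_C plt) (omega \<oplus> rat_sum c) G"
proof -
  have "\<exists>F. F ` blocks = (UNIV :: rat set) \<and>
      (\<forall>a\<in>blocks. \<forall>b\<in>blocks. F a < F b \<longleftrightarrow> less_C dlt a b) \<and> (\<forall>a\<in>blocks. c (F a) = block_order a)"
    by (rule colored_Cantor[OF blocks_dense c])
  then obtain F where F: "F ` blocks = (UNIV :: rat set)"
      "\<And>a b. a \<in> blocks \<Longrightarrow> b \<in> blocks \<Longrightarrow> F a < F b \<longleftrightarrow> less_C dlt a b"
      "\<And>a. a \<in> blocks \<Longrightarrow> c (F a) = block_order a" by blast
  have "\<forall>q. \<exists>a. a \<in> blocks \<and> F a = q" using F(1) by (metis UNIV_I imageE)
  then obtain \<rho> where \<rho>: "\<And>q. \<rho> q \<in> blocks" "\<And>q. F (\<rho> q) = q" by metis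
  have rec_block: "recursive \<xi>" if "\<xi> \<in> blocks" for \<xi> using that by (simp add: blocks_def)
  \<comment> \<open>Positions are measured in the block of a fixed representative
    \<open>\<rho> q\<close>. \<open>P_eq\<close> and \<open>F_eq\<close> make the result independent
    of the representatives of germs.\<close>
  define I where "I q = initial_segment (\<lambda>n. block_size (\<rho> q n))" for q
  have "\<exists>P. presents (I q) less_nat_C (c q) P" for q
    using block_presentation[OF \<rho>(1)[of q]] F(3)[OF \<rho>(1)[of q]] \<rho>(2) by (simp add: I_def)
  then obtain P where P: "\<And>q. presents (I q) less_nat_C (c q) (P q)" by metis
  have P_lt: "(P q a, P q b) \<in> snd (c q)" if "a \<in> I q" "b \<in> I q" "less_nat_C a b" for q a b
    using P[of q] that unfolding presents_def by blast
  have P_eq: "P q a = P q b" if "a \<in> I q" "b \<in> I q" "eventually (\<lambda>n. a n = b n) at_C" for q a b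
  proof -
    have "recursive a" "recursive b" using that by (auto simp: I_def initial_segment_def)
    then have "\<not> less_nat_C a b \<and> \<not> less_nat_C b a"
      using incomparable_C[OF decidable_less_nat, of a b] that(3) by auto
    then show ?thesis using P[of q] that(1,2) unfolding presents_def by blast
  qed
  have P_mem: "P q a \<in> fst (c q)" if "a \<in> I q" for q a using P[of q] that unfolding presents_def by blast
  have P_onto: "\<exists>a\<in>I q. P q a = y" if "y \<in> fst (c q)" for q y
    using P[of q] that unfolding presents_def by (metis imageE)
  have F_eq: "F a = F b \<longleftrightarrow> eventually (\<lambda>n. a n = b n) at_C" if ab: "a \<in> blocks" "b \<in> blocks" for a b
  proof -
    have "F a = F b \<longleftrightarrow> \<not> less_C dlt a b \<and> \<not> less_C dlt b a"
      using F(2)[OF ab] F(2)[OF ab(2,1)] by (metis less_irrefl less_linear)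
    then show ?thesis
      using incomparable_C[OF decidable_dlt rec_block[OF ab(1)] rec_block[OF ab(2)] dlt_irrefl dlt_total] by blast
  qed
  let ?rank = "\<lambda>w. card {v \<in> {w. member w}. plt v w}"
  have rank: "?rank ` {w. member w} = UNIV" "\<And>v w. member v \<Longrightarrow> member w \<Longrightarrow> plt v w \<Longrightarrow> ?rank v < ?rank w"
    using member_omega unfolding presents_def by (auto simp: omega_def)
  define R where "R g v = (case v of
      Inl m \<Rightarrow> \<exists>w. member w \<and> eventually (\<lambda>n. g n = w) at_C \<and> ?rank w = m
    | Inr (q, y) \<Rightarrow> (\<lambda>n. pfst (g n)) \<in> blocks \<and> F (\<lambda>n. pfst (g n)) = q \<and>
        (\<lambda>n. psnd (g n)) \<in> I q \<and> P q (\<lambda>n. psnd (g n)) = y)"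
    for g and v :: "nat + rat \<times> ((nat + rat \<times> int) + nat)"
  show ?thesis
  proof (rule presentsI[where R = R])
    fix g assume g: "g \<in> germs member"
    then have r: "recursive g" and mem: "eventually (\<lambda>n. member (g n)) at_C" by (simp_all add: germs_def)
    from germ_cases[OF g] show "\<exists>v\<in>fst (omega \<oplus> rat_sum c). R g v"
    proof
      assume "\<exists>w. member w \<and> eventually (\<lambda>n. g n = w) at_C"
      then obtain w where "member w" "eventually (\<lambda>n. g n = w) at_C" by blast
      then have "R g (Inl (?rank w))" by (auto simp: R_def)
      moreover have "Inl (?rank w) \<in> fst (omega \<oplus> rat_sum c)" by (auto simp: omega_def)
      ultimately show ?thesis by blast
    next
      assume b: "(\<lambda>n. pfst (g n)) \<in> blocks"
      define q where "q = F (\<lambda>n. pfst (g n))"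
      have "eventually (\<lambda>n. pfst (g n) = \<rho> q n) at_C"
        using F_eq[OF b \<rho>(1)[of q]] \<rho>(2)[of q] by (simp add: q_def)
      with mem have "eventually (\<lambda>n. psnd (g n) < block_size (\<rho> q n)) at_C"
        by eventually_elim (auto simp: member_def)
      then have I: "(\<lambda>n. psnd (g n)) \<in> I q"
        using r by (simp add: I_def initial_segment_def computable_psnd)
      then have "R g (Inr (q, P q (\<lambda>n. psnd (g n))))" using b by (simp add: R_def q_def)
      moreover have "Inr (q, P q (\<lambda>n. psnd (g n))) \<in> fst (omega \<oplus> rat_sum c)"
        using P_mem[OF I] by (auto simp: fst_rat_sum)
      ultimately show ?thesis by blast
    qed
  next
    fix v assume v: "v \<in> fst (omega \<oplus> rat_sum c)"
    show "\<exists>g\<in>germs member. R g v"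
    proof (cases v)
      case (Inl m)
      have "m \<in> ?rank ` {w. member w}" using rank(1) by simp
      then obtain w where "member w" "?rank w = m" by blast
      then show ?thesis using Inl
        by (intro bexI[of _ "\<lambda>_. w"]) (auto simp: R_def germs_def computable_const)
    next
      case (Inr p)
      obtain q y where p: "p = (q, y)" by (cases p)
      then have "y \<in> fst (c q)" using v Inr by (auto simp: fst_rat_sum)
      then obtain a where a: "a \<in> I q" "P q a = y" using P_onto by blast
      define g where "g n = prod_encode (\<rho> q n, a n)" for n
      have ra: "recursive a" and less: "eventually (\<lambda>n. a n < block_size (\<rho> q n)) at_C"
        using a(1) by (auto simp: I_def initial_segment_def)
      have "recursive g" unfolding g_def by (intro computable_pair rec_block[OF \<rho>(1)] ra)
      moreover have "eventually (\<lambda>n. admissible (\<rho> q n)) at_C" using \<rho>(1)[of q] by (simp add: blocks_def)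
      with less have "eventually (\<lambda>n. member (g n)) at_C"
        by eventually_elim (simp add: member_def g_def)
      ultimately have "g \<in> germs member" by (simp add: germs_def)
      moreover have "R g v" unfolding R_def Inr p using \<rho>[of q] a by (simp add: g_def)
      ultimately show ?thesis by blast
    qed
  next
    fix g h v w
    assume g: "g \<in> germs member" and h: "h \<in> germs member" and v: "v \<in> fst (omega \<oplus> rat_sum c)"
      and w: "w \<in> fst (omega \<oplus> rat_sum c)" and Rg: "R g v" and Rh: "R h w" and "less_C plt g h"
    then have gh: "eventually (\<lambda>n. plt (g n) (h n)) at_C" by (simp add: less_C_def)
    show "(v, w) \<in> snd (omega \<oplus> rat_sum c)"
    proof (cases v)
      case v': (Inl m)
      then obtain a where a: "member a" "eventually (\<lambda>n. g n = a) at_C" "?rank a = m" using Rg by (auto simp: R_def)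
      show ?thesis
      proof (cases w)
        case (Inl k)
        then obtain b where b: "member b" "eventually (\<lambda>n. h n = b) at_C" "?rank b = k" using Rh by (auto simp: R_def)
        have "eventually (\<lambda>n. plt a b) at_C" using a(2) b(2) gh by eventually_elim simp
        then have "?rank a < ?rank b" using rank(2)[OF a(1) b(1)] by simp
        then show ?thesis using v' Inl a(3) b(3) by (simp add: omega_def)
      next
        case (Inr p)
        then show ?thesis using v w v' by auto
      qed
    next
      case v': (Inr p)
      obtain q y where p: "p = (q, y)" by (cases p)
      then have a: "(\<lambda>n. pfst (g n)) \<in> blocks" "F (\<lambda>n. pfst (g n)) = q"
        "(\<lambda>n. psnd (g n)) \<in> I q" "P q (\<lambda>n. psnd (g n)) = y" using Rg v' by (simp_all add: R_def)
      show ?thesis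
      proof (cases w)
        case (Inl k)
        then obtain b where b: "eventually (\<lambda>n. h n = b) at_C" using Rh by (auto simp: R_def)
        \<comment> \<open>A germ below a constant would have bounded integer part, which is
          impossible for a nonstandard block.\<close>
        then have "eventually (\<lambda>n. dfloor (pfst (g n)) \<le> dfloor (pfst b)) at_C"
          using gh by eventually_elim (auto dest: plt_dfloor)
        then show ?thesis using block_not_const[OF a(1)] by blast
      next
        case (Inr p')
        obtain q' y' where p': "p' = (q', y')" by (cases p')
        then have b: "(\<lambda>n. pfst (h n)) \<in> blocks" "F (\<lambda>n. pfst (h n)) = q'"
          "(\<lambda>n. psnd (h n)) \<in> I q'" "P q' (\<lambda>n. psnd (h n)) = y'" using Rh Inr by (simp_all add: R_def)
        have "q < q' \<or> q = q' \<and> (y, y') \<in> snd (c q')"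
        proof (cases "less_C dlt (\<lambda>n. pfst (g n)) (\<lambda>n. pfst (h n))")
          case True
          then show ?thesis using F(2)[OF a(1) b(1)] a(2) b(2) by simp
        next
          case False
          \<comment> \<open>Since \<open>plt\<close> holds almost everywhere, failure of the
            comparison of blocks leaves only the case of the same block with a smaller
            position.\<close>
          then have "eventually (\<lambda>n. \<not> dlt (pfst (g n)) (pfst (h n))) at_C"
            using not_less_C[OF decidable_dlt rec_block[OF a(1)] rec_block[OF b(1)]] by blast
          with gh have "eventually (\<lambda>n. pfst (g n) = pfst (h n) \<and> psnd (g n) < psnd (h n)) at_C"
            by eventually_elim (auto simp: plt_def)
          then have "eventually (\<lambda>n. pfst (g n) = pfst (h n)) at_C"
            and less: "less_nat_C (\<lambda>n. psnd (g n)) (\<lambda>n. psnd (h n))"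
            by (simp_all add: eventually_conj_iff less_C_def)
          then have "q = q'" using F_eq[OF a(1) b(1)] a(2) b(2) by simp
          then show ?thesis using P_lt[OF a(3) _ less] a(4) b(3,4) by auto
        qed
        then show ?thesis using v w v' Inr p p' by (auto simp: rat_sum_rel fst_rat_sum)
      qed
    qed
  next
    fix g h v w
    assume g: "g \<in> germs member" and h: "h \<in> germs member" and Rg: "R g v" and Rh: "R h w"
      and nl: "\<not> less_C plt g h" "\<not> less_C plt h g"
    have "recursive g" "recursive h" using g h by (simp_all add: germs_def)
    moreover have "\<not> plt x x" for x using strict_weak_on_irrefl[OF strict_weak_plt] by simp
    ultimately have gh: "eventually (\<lambda>n. g n = h n) at_C"
      using incomparable_C[OF decidable_plt _ _ _ plt_total] nl by blast
    have no: False if "eventually (\<lambda>n. f n = a) at_C" "(\<lambda>n. pfst (k n)) \<in> blocks"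
      "eventually (\<lambda>n. f n = k n) at_C" for f k a
    proof -
      have "eventually (\<lambda>n. dfloor (pfst (k n)) \<le> dfloor (pfst a)) at_C"
        using that(1,3) by eventually_elim auto
      then show False using block_not_const[OF that(2)] by blast
    qed
    show "v = w"
    proof (cases v)
      case v': (Inl m)
      then obtain a where a: "eventually (\<lambda>n. g n = a) at_C" "?rank a = m" using Rg by (auto simp: R_def)
      show ?thesis
      proof (cases w)
        case (Inl k)
        then obtain b where b: "eventually (\<lambda>n. h n = b) at_C" "?rank b = k" using Rh by (auto simp: R_def)
        have "eventually (\<lambda>n. a = b) at_C" using a(1) b(1) gh by eventually_elim simp
        then show ?thesis using v' Inl a(2) b(2) by simp
      next
        case (Inr p)
        then show ?thesis using no[OF a(1) _ gh] Rh by (cases p) (auto simp: R_def)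
      qed
    next
      case v': (Inr p)
      obtain q y where p: "p = (q, y)" by (cases p)
      then have a: "(\<lambda>n. pfst (g n)) \<in> blocks" "F (\<lambda>n. pfst (g n)) = q"
        "(\<lambda>n. psnd (g n)) \<in> I q" "P q (\<lambda>n. psnd (g n)) = y" using Rg v' by (simp_all add: R_def)
      show ?thesis
      proof (cases w)
        case (Inl k)
        then obtain b where b: "eventually (\<lambda>n. h n = b) at_C" using Rh by (auto simp: R_def)
        have "eventually (\<lambda>n. h n = g n) at_C" using gh by eventually_elim simp
        then show ?thesis using no[OF b a(1)] by blast
      next
        case (Inr p')
        obtain q' y' where p': "p' = (q', y')" by (cases p')
        then have b: "(\<lambda>n. pfst (h n)) \<in> blocks" "F (\<lambda>n. pfst (h n)) = q'"
          "(\<lambda>n. psnd (h n)) \<in> I q'" "P q' (\<lambda>n. psnd (h n)) = y'" using Rh Inr by (simp_all add: R_def)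
        have e: "eventually (\<lambda>n. pfst (g n) = pfst (h n)) at_C" "eventually (\<lambda>n. psnd (g n) = psnd (h n)) at_C"
          using gh by (auto elim: eventually_mono)
        then have "q = q'" using F_eq[OF a(1) b(1)] a(2) b(2) by simp
        moreover have "y = y'" using P_eq[OF a(3) _ e(2)] a(4) b(3,4) \<open>q = q'\<close> by auto
        ultimately show ?thesis using v' Inr p p' by simp
      qed
    qed
  next
    have "asym_ord (c q)" for q
    proof -
      have "c q \<in> with_alpha X" using c by (auto simp: dense_coloring_def)
      then show ?thesis by (auto simp: with_alpha_eq asym_color_order)
    qed
    then show "asym_ord (omega \<oplus> rat_sum c)" by (intro asym_ord_plus asym_omega asym_rat_sum)
  qed
qed

lemma shuffle_power:
  "\<exists>M. computable_linear_order M \<and> M \<cong> omega \<and> cohesive_power C M \<cong> omega \<oplus> shuffle (with_alpha X)"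
proof -
  have "countable (with_alpha X)" "with_alpha X \<noteq> {}" by (simp_all add: with_alpha_def)
  then have "\<exists>c. dense_coloring (with_alpha X) c" by (rule dense_coloring_exists)
  \<comment> \<open>\<open>shuffle\<close> fixes an unspecified coloring. The presentation applies
    to it because it was established for every dense coloring.\<close>
  then have "dense_coloring (with_alpha X) (SOME c. dense_coloring (with_alpha X) c)" by (rule someI_ex)
  from germs_presentation[OF this]
  obtain G where G: "presents (germs member) (less_C plt) (omega \<oplus> shuffle (with_alpha X)) G"
    unfolding shuffle_def by blast
  obtain w where w: "member w" using infinite_member by fastforce
  show ?thesis
    by (rule cohesive_power_presentation[OF semidecidable_member w decidable_plt strict_weak_plt plt_total
          member_omega G])
qed

end

theorem theorem6p4:
  fixes X C :: "nat set"
  assumes "X \<subseteq> UNIV - {0}"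
    and "Pi2 X"
    and "co_ce C"
    and "cohesive C"
  shows "\<exists>M. computable_linear_order M \<and> M \<cong> omega \<and>
           cohesive_power C M \<cong> omega \<oplus> shuffle (with_alpha X)"
proof -
  obtain Q where Q: "decidable 3 Q" "X = {n. \<forall>y. \<exists>z. Q [n, y, z]}"
    using assms(2) unfolding Pi2_def by blast
  \<comment> \<open>Bounding the universal quantifier turns the \<Pi>2 condition into a decreasing
    sequence of c.e. conditions whose intersection is \<open>X\<close>.\<close>
  define E where "E k d \<longleftrightarrow> (\<forall>y<Suc d. \<exists>z. Q [k, y, z])" for k d
  \<comment> \<open>The innermost bound variable \<open>z\<close> comes first in the list, then
    \<open>y\<close>, then the parameters; \<open>Q\<close> expects the order
    \<open>[k, y, z]\<close>.\<close>
  have "list_computable (Suc (Suc 2)) 3 (\<lambda>zs. [tl (tl zs) ! 0, hd (tl zs), hd zs])"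
    unfolding numeral_3_eq_3
    by (intro list_intros computable_hd computable_hd_tl computable_tl_tl_nth) auto
  from decidable_subst[OF Q(1) this]
  have "semidecidable 2 (\<lambda>xs. E (xs ! 0) (xs ! 1))" unfolding E_def
    by (intro semidecidable_ball semidecidable_ex semidecidable_decidable computable_Suc computable_nth) auto
  moreover have "X = {k. \<forall>d. E k d}" unfolding Q(2) E_def by auto
  moreover have "0 \<notin> X" using assms(1) by blast
  moreover have "E k d'" if "E k d" "d' \<le> d" for k d d' using that by (auto simp: E_def)
  ultimately interpret shuffled_power C E X
    using assms(3,4) by unfold_locales
  show ?thesis by (rule shuffle_power)
qed

end
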